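(* Let $G$ be a topological group and let $K\subset G$ be a spherical subgroup. Assume that $K$ does not admit nontrivial finite-dimensional unitary representations. Let $\Phi_1(g)$, $\Phi_2(g)$ be $K$-spherical functions on $G$. Then the product $\Phi_1(g)\Phi_2(g)$ is a $K$-spherical function on $G$.
   Context: Unitary representations of a topological group are continuous and act in complex Hilbert spaces. A subgroup $K$ of a topological group $G$ is called spherical (and $G\supset K$ is called a spherical pair) if for every irreducible unitary representation of $G$ the space of $K$-invariant vectors has dimension $\le 1$. An irreducible unitary representation $\rho$ of $G$ in a Hilbert space $H$ is called ($K$-)spherical if there is a unique up to a scalar factor nonzero $K$-invariant vector $v\in H$; the matrix element $\Phi(g)=\langle\rho(g)v,v\rangle$ is then called a ($K$-)spherical function on $G$. *)

theory Defs
  imports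
    "HOL-Analysis.Analysis"
    "HOL-Algebra.Group_Action"
    "Jordan_Normal_Form.Missing_VectorSpace"
begin

hide_const (open) Modules.module Modules.module_hom Vector_Spaces.vector_space
  Polynomial.smult Multiset.mult

section \<open>Topological groups\<close>

locale topological_group = group G for G (structure) +
  fixes T :: "'a topology"
  assumes topspace_eq: "topspace T = carrier G"
    and continuous_mult: "continuous_map (prod_topology T T) T (\<lambda>(x, y). x \<otimes> y)"
    and continuous_inv: "continuous_map T T (\<lambda>x. inv x)"


section \<open>Complex Hilbert spaces\<close>

text \<open>Hilbert spaces have to be quantified over inside formulas, so they are records with an
  explicit carrier. The fields \<open>mult\<close> and \<open>one\<close>, which the record
  of modules inherits from that of rings, are never used.\<close>

definition complex_field :: "complex ring"
  where "complex_field = \<lparr>carrier = UNIV, mult = (*), one = 1, zero = 0, add = (+)\<rparr>"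

lemma complex_field_simps [simp]:
  "carrier complex_field = UNIV" "mult complex_field = (*)" "one complex_field = 1"
  "zero complex_field = 0" "add complex_field = (+)"
  by (simp_all add: complex_field_def)

lemma field_complex_field: "Ring.field complex_field"
proof (rule Ring.cring.cring_fieldI2)
  show "cring complex_field"
  proof (rule cringI)
    show "abelian_group complex_field"
      by (rule abelian_groupI) (auto simp: algebra_simps intro: exI[of _ "- _"])
    show "Group.comm_monoid complex_field"
      by (rule comm_monoidI) (auto simp: algebra_simps)
  qed (auto simp: algebra_simps)
  fix a assume "a \<noteq> \<zero>\<^bsub>complex_field\<^esub>"
  then show "\<exists>b\<in>carrier complex_field. a \<otimes>\<^bsub>complex_field\<^esub> b = \<one>\<^bsub>complex_field\<^esub>"
    by (auto intro!: exI[of _ "inverse a"])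
qed auto


record 'v cinner_space = "(complex, 'v) module" +
  cinner :: "'v \<Rightarrow> 'v \<Rightarrow> complex"

text \<open>The inner product is linear in the first argument.\<close>

locale complex_inner_space = vectorspace complex_field H
  for H :: "'v cinner_space" (structure) +
  assumes cinner_add_left:
      "\<lbrakk>x \<in> carrier H; y \<in> carrier H; z \<in> carrier H\<rbrakk>
        \<Longrightarrow> cinner H (x \<oplus> y) z = cinner H x z + cinner H y z"
    and cinner_smult_left:
      "\<lbrakk>x \<in> carrier H; y \<in> carrier H\<rbrakk> \<Longrightarrow> cinner H (c \<odot> x) y = c * cinner H x y"
    and cinner_commute:
      "\<lbrakk>x \<in> carrier H; y \<in> carrier H\<rbrakk> \<Longrightarrow> cinner H y x = cnj (cinner H x y)"
    and cinner_pos: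
      "\<lbrakk>x \<in> carrier H; x \<noteq> \<zero>\<rbrakk> \<Longrightarrow> 0 < Re (cinner H x x)"

text \<open>The locale \<^locale>\<open>Metric_space\<close> demands symmetry and nonnegativity off the carrier too;
  hence the default value 0 there.\<close>

definition hdist :: "'v cinner_space \<Rightarrow> 'v \<Rightarrow> 'v \<Rightarrow> real"
  where "hdist H x y =
    (if x \<in> carrier H \<and> y \<in> carrier H
     then sqrt (Re (cinner H (x \<ominus>\<^bsub>H\<^esub> y) (x \<ominus>\<^bsub>H\<^esub> y))) else 0)"

definition htopology :: "'v cinner_space \<Rightarrow> 'v topology"
  where "htopology H = Metric_space.mtopology (carrier H) (hdist H)"

locale complex_hilbert_space = complex_inner_space +
  assumes complete: "Metric_space.mcomplete (carrier H) (hdist H)"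


section \<open>Unitary representations\<close>

text \<open>The operator \<open>\<rho> g\<close> is a bijection of the carrier by \<^locale>\<open>group_action\<close>
  (and \<open>undefined\<close> off the carrier); continuity is with respect to the strong
  operator topology.\<close>

definition unitary_rep ::
  "('g, 'm) monoid_scheme \<Rightarrow> 'g topology \<Rightarrow> 'v cinner_space \<Rightarrow> ('g \<Rightarrow> 'v \<Rightarrow> 'v) \<Rightarrow> bool"
  where "unitary_rep G T H \<rho> \<longleftrightarrow>
    complex_hilbert_space H \<and>
    group_action G (carrier H) \<rho> \<and>
    (\<forall>g\<in>carrier G. \<rho> g \<in> module_hom complex_field H H \<and>
      (\<forall>x\<in>carrier H. \<forall>y\<in>carrier H. cinner H (\<rho> g x) (\<rho> g y) = cinner H x y)) \<and>
    (\<forall>x\<in>carrier H. continuous_map T (htopology H) (\<lambda>g. \<rho> g x))"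

definition irreducible_unitary_rep ::
  "('g, 'm) monoid_scheme \<Rightarrow> 'g topology \<Rightarrow> 'v cinner_space \<Rightarrow> ('g \<Rightarrow> 'v \<Rightarrow> 'v) \<Rightarrow> bool"
  where "irreducible_unitary_rep G T H \<rho> \<longleftrightarrow>
    unitary_rep G T H \<rho> \<and>
    carrier H \<noteq> {\<zero>\<^bsub>H\<^esub>} \<and>
    (\<forall>W. VectorSpace.subspace complex_field W H \<and> closedin (htopology H) W \<and>
         (\<forall>g\<in>carrier G. \<forall>x\<in>W. \<rho> g x \<in> W)
       \<longrightarrow> W = {\<zero>\<^bsub>H\<^esub>} \<or> W = carrier H)"

definition invariant_vectors :: "'v cinner_space \<Rightarrow> ('g \<Rightarrow> 'v \<Rightarrow> 'v) \<Rightarrow> 'g set \<Rightarrow> 'v set"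
  where "invariant_vectors H \<rho> K = {x \<in> carrier H. \<forall>k\<in>K. \<rho> k x = x}"


section \<open>Spherical subgroups and spherical functions\<close>

text \<open>A bound variable ranges over the Hilbert spaces on one type only, so a universe has to
  be fixed; it is \<^typ>\<open>'g \<Rightarrow> complex\<close>. This loses no generality: an irreducible
  unitary representation on any type is unitarily equivalent to one in this universe (lemma
  \<open>irreducible_unitary_rep_transfer\<close> below), and so is a finite-dimensional one, since
  \<^typ>\<open>'g \<Rightarrow> complex\<close> has at least the cardinality of the continuum.\<close>

definition spherical_subgroup ::
  "('g, 'm) monoid_scheme \<Rightarrow> 'g topology \<Rightarrow> 'g set \<Rightarrow> bool"
  where "spherical_subgroup G T K \<longleftrightarrow>
    subgroup K G \<and>
    (\<forall>(H :: ('g \<Rightarrow> complex) cinner_space) \<rho>. irreducible_unitary_rep G T H \<rho> \<longrightarrow>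
      vectorspace.fin_dim complex_field (H\<lparr>carrier := invariant_vectors H \<rho> K\<rparr>) \<and>
      vectorspace.dim complex_field (H\<lparr>carrier := invariant_vectors H \<rho> K\<rparr>) \<le> 1)"

text \<open>The vector \<open>v\<close> is not required to be a unit vector. On the carrier of \<open>G\<close> the
  function \<open>\<Phi>\<close> is a matrix element; its values elsewhere are irrelevant.\<close>

definition spherical_function_via ::
  "('g, 'm) monoid_scheme \<Rightarrow> 'g topology \<Rightarrow> 'g set \<Rightarrow> 'v cinner_space
    \<Rightarrow> ('g \<Rightarrow> 'v \<Rightarrow> 'v) \<Rightarrow> ('g \<Rightarrow> complex) \<Rightarrow> bool"
  where "spherical_function_via G T K H \<rho> \<Phi> \<longleftrightarrow>
    irreducible_unitary_rep G T H \<rho> \<and>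
    (\<exists>v\<in>invariant_vectors H \<rho> K. v \<noteq> \<zero>\<^bsub>H\<^esub> \<and>
      (\<forall>w\<in>invariant_vectors H \<rho> K. \<exists>c. w = c \<odot>\<^bsub>H\<^esub> v) \<and>
      (\<forall>g\<in>carrier G. \<Phi> g = cinner H (\<rho> g v) v))"

definition spherical_function ::
  "('g, 'm) monoid_scheme \<Rightarrow> 'g topology \<Rightarrow> 'g set \<Rightarrow> ('g \<Rightarrow> complex) \<Rightarrow> bool"
  where "spherical_function G T K \<Phi> \<longleftrightarrow>
    (\<exists>(H :: ('g \<Rightarrow> complex) cinner_space) \<rho>. spherical_function_via G T K H \<rho> \<Phi>)"

definition no_nontrivial_findim_unitary_rep ::
  "('g, 'm) monoid_scheme \<Rightarrow> 'g topology \<Rightarrow> bool"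
  where "no_nontrivial_findim_unitary_rep G T \<longleftrightarrow>
    (\<forall>(H :: ('g \<Rightarrow> complex) cinner_space) \<rho>.
      unitary_rep G T H \<rho> \<and> vectorspace.fin_dim complex_field H
      \<longrightarrow> (\<forall>g\<in>carrier G. \<forall>x\<in>carrier H. \<rho> g x = x))"


section \<open>Independence of the universe\<close>

context complex_inner_space
begin

lemma cinner_add_right:
  assumes "x \<in> carrier H" "y \<in> carrier H" "z \<in> carrier H"
  shows "cinner H z (x \<oplus> y) = cinner H z x + cinner H z y"
proof -
  have "cinner H z (x \<oplus> y) = cnj (cinner H (x \<oplus> y) z)"
    using assms by (intro cinner_commute) auto
  also have "\<dots> = cnj (cinner H x z) + cnj (cinner H y z)"
    using assms by (simp add: cinner_add_left)
  finally show ?thesis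
    using assms by (simp add: cinner_commute[of x z] cinner_commute[of y z])
qed

lemma cinner_smult_right:
  assumes "x \<in> carrier H" "y \<in> carrier H"
  shows "cinner H x (c \<odot> y) = cnj c * cinner H x y"
proof -
  have "cinner H x (c \<odot> y) = cnj (cinner H (c \<odot> y) x)"
    using assms by (intro cinner_commute) auto
  then show ?thesis
    using assms by (simp add: cinner_smult_left cinner_commute[of y x])
qed

lemma cinner_zero_left [simp]: "x \<in> carrier H \<Longrightarrow> cinner H \<zero> x = 0"
  using cinner_smult_left[of \<zero> x 0] smult_r_null[of "0"] by simp

lemma cinner_minus_left:
  assumes "x \<in> carrier H" "y \<in> carrier H" "z \<in> carrier H"
  shows "cinner H (x \<ominus> y) z = cinner H x z - cinner H y z"
proof -
  have "x \<ominus> y \<oplus> y = x"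
    using assms by (simp add: a_minus_def M.a_assoc M.l_neg)
  then show ?thesis
    using cinner_add_left[of "x \<ominus> y" y z] assms by simp
qed

lemma cinner_minus_right:
  assumes "x \<in> carrier H" "y \<in> carrier H" "z \<in> carrier H"
  shows "cinner H z (x \<ominus> y) = cinner H z x - cinner H z y"
  using assms cinner_minus_left[of x y z] cinner_commute[of "x \<ominus> y" z]
    cinner_commute[of x z] cinner_commute[of y z]
  by simp

lemma cinner_self:
  assumes "x \<in> carrier H"
  shows "Im (cinner H x x) = 0" "0 \<le> Re (cinner H x x)"
    "Re (cinner H x x) = 0 \<longleftrightarrow> x = \<zero>"
proof -
  show "Im (cinner H x x) = 0"
    using cinner_commute[of x x] assms by (metis complex_cnj_cancel_iff complex_is_Real_iff Reals_cnj_iff)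
  show "0 \<le> Re (cinner H x x)" "Re (cinner H x x) = 0 \<longleftrightarrow> x = \<zero>"
    using cinner_pos[of x] assms by (cases "x = \<zero>"; force)+
qed

lemma Cauchy_Schwarz:
  assumes x: "x \<in> carrier H" and y: "y \<in> carrier H"
  shows "cmod (cinner H x y) \<le> sqrt (Re (cinner H x x)) * sqrt (Re (cinner H y y))"
proof (cases "y = \<zero>")
  case True
  then show ?thesis
    using x cinner_commute[of \<zero> x] by (simp add: cinner_self)
next
  case False
  define q where "q = Re (cinner H y y)"
  have q: "q > 0" "cinner H y y = of_real q"
    using False y cinner_pos[of y] cinner_self(1)[of y] by (auto simp: q_def complex_eq_iff)
  define c where "c = cinner H x y / of_real q"
  have "0 \<le> Re (cinner H (x \<ominus> c \<odot> y) (x \<ominus> c \<odot> y))"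
    using x y by (intro cinner_self(2)) auto
  also have "cinner H (x \<ominus> c \<odot> y) (x \<ominus> c \<odot> y) =
      cinner H x x - cnj c * cinner H x y - c * cnj (cinner H x y) + c * cnj c * of_real q"
    using x y
    by (simp add: cinner_minus_left cinner_minus_right cinner_smult_left cinner_smult_right
        cinner_commute[of x y] q algebra_simps)
  also have "\<dots> = cinner H x x - cinner H x y * cnj (cinner H x y) / of_real q"
    using q by (simp add: c_def field_simps)
  also have "\<dots> = cinner H x x - of_real ((cmod (cinner H x y))\<^sup>2 / q)"
    by (simp only: complex_norm_square[symmetric] of_real_divide)
  finally have "(cmod (cinner H x y))\<^sup>2 \<le> Re (cinner H x x) * q"
    using q by (simp add: field_simps)
  then have "cmod (cinner H x y) \<le> sqrt (Re (cinner H x x) * q)"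
    by (intro real_le_rsqrt)
  then show ?thesis
    by (simp add: real_sqrt_mult q_def)
qed

lemma hdist_eq:
  "\<lbrakk>x \<in> carrier H; y \<in> carrier H\<rbrakk>
    \<Longrightarrow> hdist H x y = sqrt (Re (cinner H (x \<ominus> y) (x \<ominus> y)))"
  by (simp add: hdist_def)

lemma hdist_expand:
  "\<lbrakk>x \<in> carrier H; y \<in> carrier H\<rbrakk> \<Longrightarrow> hdist H x y =
    sqrt (Re (cinner H x x - cinner H x y - cinner H y x + cinner H y y))"
  by (simp add: hdist_eq cinner_minus_left cinner_minus_right algebra_simps)

lemma norm_triangle:
  assumes x: "x \<in> carrier H" and y: "y \<in> carrier H"
  shows "sqrt (Re (cinner H (x \<oplus> y) (x \<oplus> y)))
    \<le> sqrt (Re (cinner H x x)) + sqrt (Re (cinner H y y))"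
proof (rule real_le_lsqrt)
  have "cinner H (x \<oplus> y) (x \<oplus> y)
      = cinner H x x + cinner H x y + cnj (cinner H x y) + cinner H y y"
    using x y by (simp add: cinner_add_left cinner_add_right cinner_commute[of x y])
  then have "Re (cinner H (x \<oplus> y) (x \<oplus> y))
      = Re (cinner H x x) + 2 * Re (cinner H x y) + Re (cinner H y y)"
    by simp
  also have "\<dots> \<le> (sqrt (Re (cinner H x x)) + sqrt (Re (cinner H y y)))\<^sup>2"
    using Cauchy_Schwarz[OF x y] complex_Re_le_cmod[of "cinner H x y"] cinner_self(2) x y
    by (simp add: power2_sum)
  finally show "Re (cinner H (x \<oplus> y) (x \<oplus> y))
      \<le> (sqrt (Re (cinner H x x)) + sqrt (Re (cinner H y y)))\<^sup>2" .
qed (use x y cinner_self(2) in auto)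

lemma Metric_space_hdist: "Metric_space (carrier H) (hdist H)"
proof
  fix x y
  show "0 \<le> hdist H x y"
    by (simp add: hdist_def cinner_self(2))
  show "hdist H x y = hdist H y x"
    by (auto simp: hdist_def cinner_minus_left cinner_minus_right algebra_simps)
next
  fix x y assume "x \<in> carrier H" "y \<in> carrier H"
  then show "hdist H x y = 0 \<longleftrightarrow> x = y"
    by (simp add: hdist_eq cinner_self)
next
  fix x y z assume *: "x \<in> carrier H" "y \<in> carrier H" "z \<in> carrier H"
  have "x \<ominus> z = (x \<ominus> y) \<oplus> (y \<ominus> z)"
    using * by (simp add: a_minus_def M.a_assoc M.r_neg1)
  then show "hdist H x z \<le> hdist H x y + hdist H y z"
    using norm_triangle[of "x \<ominus> y" "y \<ominus> z"] * by (simp add: hdist_eq)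
qed

lemma closedin_orthogonal:
  assumes u: "u \<in> carrier H"
  shows "closedin (htopology H) {x \<in> carrier H. cinner H x u = 0}"
proof -
  interpret Metric_space "carrier H" "hdist H" by (rule Metric_space_hdist)
  define n where "n = sqrt (Re (cinner H u u)) + 1"
  have n: "n > 0" using cinner_self(2)[OF u] by (simp add: n_def add_nonneg_pos)
  have *: "cmod (cinner H x u - cinner H y u) \<le> hdist H x y * n"
    if "x \<in> carrier H" "y \<in> carrier H" for x y
  proof -
    have "cmod (cinner H x u - cinner H y u)
        \<le> hdist H x y * sqrt (Re (cinner H u u))"
      using Cauchy_Schwarz[of "x \<ominus> y" u] that u by (simp add: hdist_eq cinner_minus_left)
    also have "\<dots> \<le> hdist H x y * n"
      by (intro mult_left_mono) (auto simp: n_def)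
    finally show ?thesis .
  qed
  show ?thesis
    unfolding htopology_def closedin_metric
  proof (intro conjI allI impI)
    fix x assume "x \<in> carrier H - {x \<in> carrier H. cinner H x u = 0}"
    then have x: "x \<in> carrier H" "cinner H x u \<noteq> 0" by auto
    show "\<exists>r>0. disjnt {x \<in> carrier H. cinner H x u = 0} (mball x r)"
    proof (intro exI conjI)
      show "0 < cmod (cinner H x u) / n" using x n by simp
      show "disjnt {x \<in> carrier H. cinner H x u = 0} (mball x (cmod (cinner H x u) / n))"
        using *[of x] n x by (fastforce simp: disjnt_iff field_simps)
    qed
  qed auto
qed

end

definition unitary_equiv ::
  "('g, 'm) monoid_scheme \<Rightarrow> 'v cinner_space \<Rightarrow> ('g \<Rightarrow> 'v \<Rightarrow> 'v)
    \<Rightarrow> 'w cinner_space \<Rightarrow> ('g \<Rightarrow> 'w \<Rightarrow> 'w) \<Rightarrow> ('v \<Rightarrow> 'w) \<Rightarrow> bool"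
  where "unitary_equiv G H \<rho> H' \<rho>' U \<longleftrightarrow>
    bij_betw U (carrier H) (carrier H') \<and> U \<in> module_hom complex_field H H' \<and>
    (\<forall>x\<in>carrier H. \<forall>y\<in>carrier H. cinner H' (U x) (U y) = cinner H x y) \<and>
    (\<forall>g\<in>carrier G. \<forall>x\<in>carrier H. \<rho>' g (U x) = U (\<rho> g x))"

definition transport_space :: "'v cinner_space \<Rightarrow> ('v \<Rightarrow> 'w) \<Rightarrow> 'w cinner_space"
  where "transport_space H U =
    (let V = inv_into (carrier H) U in
     \<lparr>carrier = U ` carrier H, mult = undefined, one = undefined, zero = U \<zero>\<^bsub>H\<^esub>,
      add = (\<lambda>a b. U (V a \<oplus>\<^bsub>H\<^esub> V b)), smult = (\<lambda>c a. U (c \<odot>\<^bsub>H\<^esub> V a)),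
      cinner = (\<lambda>a b. cinner H (V a) (V b))\<rparr>)"

definition transport_rep ::
    "'v cinner_space \<Rightarrow> ('v \<Rightarrow> 'w) \<Rightarrow> ('g \<Rightarrow> 'v \<Rightarrow> 'v) \<Rightarrow> 'g \<Rightarrow> 'w \<Rightarrow> 'w"
  where "transport_rep H U \<rho> g =
    (\<lambda>a\<in>U ` carrier H. U (\<rho> g (inv_into (carrier H) U a)))"

lemma transport_space_simps:
  assumes "inj_on U (carrier H)"
  shows "carrier (transport_space H U) = U ` carrier H"
    and "\<zero>\<^bsub>transport_space H U\<^esub> = U \<zero>\<^bsub>H\<^esub>"
    and "\<lbrakk>x \<in> carrier H; y \<in> carrier H\<rbrakk> \<Longrightarrow> U x \<oplus>\<^bsub>transport_space H U\<^esub> U y = U (x \<oplus>\<^bsub>H\<^esub> y)"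
    and "x \<in> carrier H \<Longrightarrow> c \<odot>\<^bsub>transport_space H U\<^esub> U x = U (c \<odot>\<^bsub>H\<^esub> x)"
    and "\<lbrakk>x \<in> carrier H; y \<in> carrier H\<rbrakk>
      \<Longrightarrow> cinner (transport_space H U) (U x) (U y) = cinner H x y"
    and "x \<in> carrier H \<Longrightarrow> transport_rep H U \<rho> g (U x) = U (\<rho> g x)"
  using assms by (simp_all add: transport_space_def transport_rep_def Let_def)

lemma transport_inner_space:
  assumes H: "complex_inner_space H" and U: "inj_on U (carrier H)"
  shows "complex_inner_space (transport_space H U)"
proof -
  interpret complex_inner_space H by (rule H)
  let ?H = "transport_space H U"
  note simps = transport_space_simps[OF U]
  have ag: "abelian_group ?H"
  proof (rule abelian_groupI)
    show "\<And>x. x \<in> carrier ?H \<Longrightarrow> \<exists>y\<in>carrier ?H. y \<oplus>\<^bsub>?H\<^esub> x = \<zero>\<^bsub>?H\<^esub>"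
      using M.l_neg by (auto simp: simps) (metis M.a_inv_closed simps(3))
    next
    fix x y assume "x \<in> carrier ?H" "y \<in> carrier ?H"
    then show "x \<oplus>\<^bsub>?H\<^esub> y = y \<oplus>\<^bsub>?H\<^esub> x"
      by (auto simp: simps M.a_comm)
  qed (auto simp: simps M.a_assoc)
  have "module complex_field ?H"
    by (rule moduleI)
      (auto simp: simps ag R.is_cring
        smult_l_distr[simplified] smult_r_distr smult_assoc1[simplified]
        smult_one[simplified])
  then have "vectorspace complex_field ?H"
    by (simp add: vectorspace_def field_complex_field)
  moreover have "complex_inner_space_axioms ?H"
    using U by unfold_locales
      (auto simp: simps cinner_add_left cinner_smult_left intro: cinner_commute cinner_pos)
  ultimately show ?thesis
    by (simp add: complex_inner_space_def)
qed

lemma transport_hdist: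
  assumes H: "complex_inner_space H" and U: "inj_on U (carrier H)"
    and x: "x \<in> carrier H" and y: "y \<in> carrier H"
  shows "hdist (transport_space H U) (U x) (U y) = hdist H x y"
proof -
  interpret complex_inner_space H by (rule H)
  interpret H': complex_inner_space "transport_space H U"
    by (rule transport_inner_space[OF H U])
  note simps = transport_space_simps[OF U]
  have xy: "U x \<in> carrier (transport_space H U)" "U y \<in> carrier (transport_space H U)"
    using x y by (auto simp: simps)
  show ?thesis
    unfolding hdist_expand[OF x y] H'.hdist_expand[OF xy] using x y by (simp add: simps)
qed

lemma isometry_homeomorphic_map:
  assumes "Metric_space M d" "Metric_space M' d'" "bij_betw U M M'"
    and iso: "\<And>x y. \<lbrakk>x \<in> M; y \<in> M\<rbrakk> \<Longrightarrow> d' (U x) (U y) = d x y"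
  shows "homeomorphic_map (Metric_space.mtopology M d) (Metric_space.mtopology M' d') U"
proof -
  interpret M: Metric_space M d by fact
  interpret M': Metric_space M' d' by fact
  have M': "M' = U ` M" and inj: "inj_on U M"
    using assms(3) by (auto simp: bij_betw_def)
  have mem_M': "y \<in> M' \<longleftrightarrow> (\<exists>x\<in>M. y = U x)" for y
    by (auto simp: M')
  have "openin M.mtopology A \<longleftrightarrow> openin M'.mtopology (U ` A)" if "A \<subseteq> M" for A
  proof -
    have ball: "M'.mball (U x) r = U ` M.mball x r" if "x \<in> M" for x r
      using that by (fastforce simp: mem_M' iso set_eq_iff image_iff dest!: inj_onD[OF inj])
    have "M'.mball (U x) r \<subseteq> U ` A \<longleftrightarrow> M.mball x r \<subseteq> A" if "x \<in> A" for x r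
      using ball[OF subsetD[OF \<open>A \<subseteq> M\<close> that], of r]
      by (simp only: inj_on_image_subset_iff[OF inj M.mball_subset_mspace \<open>A \<subseteq> M\<close>])
    then have "(\<forall>x\<in>A. \<exists>r>0. M.mball x r \<subseteq> A) \<longleftrightarrow> (\<forall>y\<in>U ` A. \<exists>r>0. M'.mball y r \<subseteq> U ` A)"
      by simp
    moreover have "U ` A \<subseteq> M'"
      using that mem_M' by blast
    ultimately show ?thesis
      using that unfolding M.openin_mtopology M'.openin_mtopology Ball_def by blast
  qed
  note image = this
  have pre: "openin M.mtopology {x \<in> M. U x \<in> B} \<longleftrightarrow> openin M'.mtopology B" if "B \<subseteq> M'" for B
  proof -
    have "U ` {x \<in> M. U x \<in> B} = B" using that unfolding M' by blast
    then show ?thesis using image[OF Collect_restrict[of M "\<lambda>x. U x \<in> B"]] by (simp only:)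
  qed
  then show ?thesis
    unfolding homeomorphic_map_def quotient_map_def M.topspace_mtopology M'.topspace_mtopology
    by (intro conjI allI impI inj M'[symmetric] pre)
qed

lemma transport_hilbert_space:
  assumes H: "complex_hilbert_space H" and U: "inj_on U (carrier H)"
  shows "complex_hilbert_space (transport_space H U)"
    and "homeomorphic_map (htopology H) (htopology (transport_space H U)) U"
proof -
  interpret complex_hilbert_space H by (rule H)
  let ?H = "transport_space H U"
  interpret H': complex_inner_space ?H
    by (rule transport_inner_space[OF complex_inner_space_axioms U])
  interpret M: Metric_space "carrier H" "hdist H" by (rule Metric_space_hdist)
  interpret M': Metric_space "carrier ?H" "hdist ?H" by (rule H'.Metric_space_hdist)
  note simps = transport_space_simps[OF U]
  note dist = transport_hdist[OF complex_inner_space_axioms U]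
  have bij: "bij_betw U (carrier H) (carrier ?H)"
    using U by (simp add: simps bij_betw_def)
  show "homeomorphic_map (htopology H) (htopology ?H) U"
    unfolding htopology_def
    by (rule isometry_homeomorphic_map[OF Metric_space_hdist H'.Metric_space_hdist bij dist])
  have "M'.mcomplete"
    unfolding M'.mcomplete_def
  proof (intro allI impI)
    fix s assume s: "M'.MCauchy s"
    define t where "t n = inv_into (carrier H) U (s n)" for n
    have "s n \<in> U ` carrier H" for n
      using s unfolding M'.MCauchy_def simps(1)[symmetric] by blast
    then have t: "t n \<in> carrier H" "s n = U (t n)" for n
      unfolding t_def by (simp_all only: inv_into_into f_inv_into_f)
    have st: "s = (\<lambda>n. U (t n))"
      using t(2) by blast
    have "M.MCauchy t"
      using s t(1) by (simp add: M.MCauchy_def M'.MCauchy_def st dist image_subset_iff)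
    then obtain x where x: "limitin M.mtopology t x sequentially"
      using complete M.mcomplete_def by blast
    have "U x \<in> carrier ?H" "U (t n) \<in> carrier ?H" for n
      using x t(1) unfolding simps(1) M.limit_metric_sequentially by blast+
    then have "limitin M'.mtopology s (U x) sequentially"
      using x t(1) unfolding M.limit_metric_sequentially M'.limit_metric_sequentially st
      by (simp add: dist)
    then show "\<exists>x. limitin M'.mtopology s x sequentially" by blast
  qed
  then show "complex_hilbert_space ?H"
    by (intro complex_hilbert_space.intro complex_hilbert_space_axioms.intro
      H'.complex_inner_space_axioms)
qed

lemma group_actionI:
  assumes "group G"
    and "\<And>g. g \<in> carrier G \<Longrightarrow> \<rho> g \<in> Bij E"
    and "\<And>g h x. \<lbrakk>g \<in> carrier G; h \<in> carrier G; x \<in> E\<rbrakk>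
      \<Longrightarrow> \<rho> (g \<otimes>\<^bsub>G\<^esub> h) x = \<rho> g (\<rho> h x)"
  shows "group_action G E \<rho>"
proof -
  interpret group G by fact
  have "\<rho> (g \<otimes>\<^bsub>G\<^esub> h) = compose E (\<rho> g) (\<rho> h)" if "g \<in> carrier G" "h \<in> carrier G" for g h
  proof (rule extensionalityI)
    show "\<rho> (g \<otimes>\<^bsub>G\<^esub> h) \<in> extensional E"
      using assms(2)[of "g \<otimes>\<^bsub>G\<^esub> h"] that by (simp add: Bij_def)
  qed (use assms(3) that in \<open>auto simp: compose_def\<close>)
  then have "\<rho> \<in> hom G (BijGroup E)"
    using assms(2) by (auto simp: hom_def BijGroup_def)
  then show ?thesis
    unfolding group_action_def group_hom_def group_hom_axioms_def
    using group_BijGroup by (auto intro: assms(1))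
qed

lemma transport_irreducible:
  assumes irr: "irreducible_unitary_rep G T H \<rho>" and U: "inj_on U (carrier H)"
  shows "irreducible_unitary_rep G T (transport_space H U) (transport_rep H U \<rho>)"
    and "unitary_equiv G H \<rho> (transport_space H U) (transport_rep H U \<rho>) U"
proof -
  let ?H = "transport_space H U" and ?r = "transport_rep H U \<rho>"
  have rep: "unitary_rep G T H \<rho>" and hil: "complex_hilbert_space H"
    and act: "group_action G (carrier H) \<rho>" and ne: "carrier H \<noteq> {\<zero>\<^bsub>H\<^esub>}"
    using irr by (auto simp: irreducible_unitary_rep_def unitary_rep_def)
  interpret complex_hilbert_space H by (rule hil)
  interpret H': complex_hilbert_space ?H by (rule transport_hilbert_space[OF hil U])
  interpret A: group_action G "carrier H" \<rho> by (rule act)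
  have grp: "group G" using A.group_hom by (simp add: group_hom_def)
  note simps = transport_space_simps[OF U]
  have hom: "\<rho> g \<in> module_hom complex_field H H"
    and isom: "\<And>x y. \<lbrakk>x \<in> carrier H; y \<in> carrier H\<rbrakk> \<Longrightarrow> cinner H (\<rho> g x) (\<rho> g y) = cinner H x y"
    if "g \<in> carrier G" for g
    using rep that by (auto simp: unitary_rep_def)
  have rho: "\<rho> g x \<in> carrier H" if "g \<in> carrier G" "x \<in> carrier H" for g x
    using hom[OF that(1)] that(2) by (auto simp: module_hom_def)
  have bij: "bij_betw (\<rho> g) (carrier H) (carrier H)" if "g \<in> carrier G" for g
    using A.bij_prop0[OF that] by (simp add: Bij_def)
  have homeo: "homeomorphic_map (htopology H) (htopology ?H) U"
    by (rule transport_hilbert_space[OF hil U])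
  have act': "group_action G (carrier ?H) ?r"
  proof (rule group_actionI[OF grp])
    fix g assume g: "g \<in> carrier G"
    have "inj_on (?r g) (U ` carrier H)"
      using bij_betw_imp_inj_on[OF bij[OF g]]
      by (auto simp: inj_on_def simps inj_on_eq_iff[OF U] rho[OF g])
    moreover have "?r g ` U ` carrier H = U ` \<rho> g ` carrier H"
      by (auto simp: image_image simps)
    ultimately have "bij_betw (?r g) (carrier ?H) (carrier ?H)"
      using bij_betw_imp_surj_on[OF bij[OF g]] by (simp add: bij_betw_def simps)
    then show "?r g \<in> Bij (carrier ?H)"
      by (simp add: Bij_def simps transport_rep_def)
  next
    fix g h x assume "g \<in> carrier G" "h \<in> carrier G" "x \<in> carrier ?H"
    then show "?r (g \<otimes>\<^bsub>G\<^esub> h) x = ?r g (?r h x)"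
      using A.composition_rule rho by (auto simp: simps)
  qed
  have unit': "?r g \<in> module_hom complex_field ?H ?H"
    if g: "g \<in> carrier G" for g
    using hom[OF g] rho[OF g] by (auto simp: module_hom_def simps)
  have cont': "continuous_map T (htopology ?H) (\<lambda>g. ?r g x)" if "x \<in> carrier ?H" for x
  proof -
    have "x \<in> U ` carrier H"
      using that by (simp only: simps(1))
    then obtain y where y: "y \<in> carrier H" "x = U y"
      by (rule imageE)
    have "continuous_map T (htopology H) (\<lambda>g. \<rho> g y)"
      using rep y by (simp add: unitary_rep_def)
    then have "continuous_map T (htopology ?H) (U \<circ> (\<lambda>g. \<rho> g y))"
      using continuous_map_compose homeomorphic_imp_continuous_map[OF homeo] by blast
    then show ?thesis
      by (simp add: y simps o_def)
  qed
  have "unitary_rep G T ?H ?r"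
    using H'.complex_hilbert_space_axioms act' unit' cont' isom rho
    by (auto simp: unitary_rep_def simps)
  moreover have "carrier ?H \<noteq> {\<zero>\<^bsub>?H\<^esub>}"
    using ne inj_on_image_eq_iff[OF U, of "carrier H" "{\<zero>\<^bsub>H\<^esub>}"] by (simp add: simps)
  moreover have "W = {\<zero>\<^bsub>?H\<^esub>} \<or> W = carrier ?H"
    if W: "VectorSpace.subspace complex_field W ?H" "closedin (htopology ?H) W"
      "\<forall>g\<in>carrier G. \<forall>x\<in>W. ?r g x \<in> W" for W
  proof -
    define V where "V = {x \<in> carrier H. U x \<in> W}"
    have sub: "W \<subseteq> carrier ?H" "\<And>v w. \<lbrakk>v \<in> W; w \<in> W\<rbrakk> \<Longrightarrow> v \<oplus>\<^bsub>?H\<^esub> w \<in> W" "\<zero>\<^bsub>?H\<^esub> \<in> W"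
        "\<And>c v. v \<in> W \<Longrightarrow> c \<odot>\<^bsub>?H\<^esub> v \<in> W"
      using W(1) by (auto simp: VectorSpace.subspace_def LinearCombinations.submodule_def)
    have WV: "W = U ` V"
      using sub(1) by (auto simp: V_def simps)
    have "VectorSpace.subspace complex_field V H"
      unfolding VectorSpace.subspace_def LinearCombinations.submodule_def
      using sub(2-4) vectorspace_axioms module_axioms
      by (auto simp: V_def simps(2) simps(3,4)[symmetric])
    moreover have "closedin (htopology H) V"
    proof -
      have "V \<subseteq> topspace (htopology H)"
        by (auto simp: V_def htopology_def Metric_space.topspace_mtopology[OF Metric_space_hdist])
      then show ?thesis
        using W(2) homeomorphic_map_closedness[OF homeo] WV by simp
    qed
    moreover have "\<forall>g\<in>carrier G. \<forall>x\<in>V. \<rho> g x \<in> V"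
    proof (intro ballI)
      fix g x assume g: "g \<in> carrier G" and x: "x \<in> V"
      have "?r g (U x) \<in> W"
        using W(3) g x by (simp add: V_def)
      moreover have "?r g (U x) = U (\<rho> g x)"
        using x by (intro simps(6)) (simp add: V_def)
      ultimately show "\<rho> g x \<in> V"
        using rho[OF g] x by (simp add: V_def)
    qed
    ultimately have "V = {\<zero>\<^bsub>H\<^esub>} \<or> V = carrier H"
      using irr by (simp add: irreducible_unitary_rep_def)
    then show ?thesis
      unfolding WV simps(1,2) by blast
  qed
  ultimately show "irreducible_unitary_rep G T ?H ?r"
    unfolding irreducible_unitary_rep_def by blast
  show "unitary_equiv G H \<rho> ?H ?r U"
    using U by (auto simp: unitary_equiv_def module_hom_def bij_betw_def simps)
qed

text \<open>A vector \<open>w\<close> of an irreducible representation is determined by the function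
  \<open>\<lambda>g. cinner H w (\<rho> g v)\<close>, for any fixed nonzero \<open>v\<close>.\<close>

lemma irreducible_unitary_rep_transfer:
  fixes G :: "('g, 'm) monoid_scheme" and H :: "'v cinner_space"
  assumes irr: "irreducible_unitary_rep G T H \<rho>"
  obtains H' :: "('g \<Rightarrow> complex) cinner_space" and \<rho>' U
  where "irreducible_unitary_rep G T H' \<rho>'" "unitary_equiv G H \<rho> H' \<rho>' U"
proof -
  have rep: "unitary_rep G T H \<rho>" and hil: "complex_hilbert_space H"
    and act: "group_action G (carrier H) \<rho>" and ne: "carrier H \<noteq> {\<zero>\<^bsub>H\<^esub>}"
    using irr by (auto simp: irreducible_unitary_rep_def unitary_rep_def)
  interpret complex_hilbert_space H by (rule hil)
  interpret A: group_action G "carrier H" \<rho> by (rule act)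
  interpret G: group G using A.group_hom by (simp add: group_hom_def)
  have hom: "\<rho> g \<in> module_hom complex_field H H"
    and isom: "\<And>x y. \<lbrakk>x \<in> carrier H; y \<in> carrier H\<rbrakk> \<Longrightarrow> cinner H (\<rho> g x) (\<rho> g y) = cinner H x y"
    if "g \<in> carrier G" for g
    using rep that by (auto simp: unitary_rep_def)
  have rho: "\<rho> g x \<in> carrier H" if "g \<in> carrier G" "x \<in> carrier H" for g x
    using hom[OF that(1)] that(2) by (auto simp: module_hom_def)
  obtain v where v: "v \<in> carrier H" "v \<noteq> \<zero>\<^bsub>H\<^esub>"
    using ne by (metis M.zero_closed is_singletonI' is_singleton_def singletonD empty_iff)
  define W where "W = {x \<in> carrier H. \<forall>g\<in>carrier G. cinner H x (\<rho> g v) = 0}"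
  have "VectorSpace.subspace complex_field W H"
    unfolding VectorSpace.subspace_def LinearCombinations.submodule_def
    using vectorspace_axioms module_axioms v(1) rho
    by (auto simp: W_def cinner_add_left cinner_smult_left)
  moreover have "closedin (htopology H) W"
  proof -
    have "W = (\<Inter>g\<in>carrier G. {x \<in> carrier H. cinner H x (\<rho> g v) = 0})"
      using G.one_closed by (auto simp: W_def)
    moreover have "closedin (htopology H) \<dots>"
      using G.one_closed by (intro closedin_INT closedin_orthogonal rho v) auto
    ultimately show ?thesis by simp
  qed
  moreover have "\<forall>h\<in>carrier G. \<forall>x\<in>W. \<rho> h x \<in> W"
  proof (intro ballI)
    fix h x assume h: "h \<in> carrier G" and x: "x \<in> W"
    have "cinner H (\<rho> h x) (\<rho> g v) = 0" if g: "g \<in> carrier G" for g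
    proof -
      define k where "k = inv\<^bsub>G\<^esub> h \<otimes>\<^bsub>G\<^esub> g"
      have k: "k \<in> carrier G" "g = h \<otimes>\<^bsub>G\<^esub> k"
        using g h by (simp_all add: k_def flip: G.m_assoc)
      have "\<rho> g v = \<rho> h (\<rho> k v)"
        unfolding k(2) using A.composition_rule h k(1) v(1) by blast
      then show ?thesis
        using isom[OF h] x k(1) rho v(1) by (simp add: W_def)
    qed
    then show "\<rho> h x \<in> W"
      using rho[OF h] x by (simp add: W_def)
  qed
  ultimately have "W = {\<zero>\<^bsub>H\<^esub>} \<or> W = carrier H"
    using irr by (simp add: irreducible_unitary_rep_def)
  moreover have "v \<notin> W"
  proof
    assume "v \<in> W"
    then have "cinner H v (\<rho> \<one>\<^bsub>G\<^esub> v) = 0" by (simp add: W_def)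
    moreover have "\<rho> \<one>\<^bsub>G\<^esub> v = v"
      using A.id_eq_one v(1) by (metis restrict_apply')
    ultimately show False
      using cinner_pos[OF v] by simp
  qed
  ultimately have W0: "W = {\<zero>\<^bsub>H\<^esub>}" using v(1) by auto
  define U where "U w g = (if g \<in> carrier G then cinner H w (\<rho> g v) else 0)" for w g
  have "inj_on U (carrier H)"
  proof (rule inj_onI)
    fix x y assume xy: "x \<in> carrier H" "y \<in> carrier H" "U x = U y"
    have "cinner H x (\<rho> g v) = cinner H y (\<rho> g v)" if "g \<in> carrier G" for g
      using fun_cong[OF xy(3), of g] that by (simp add: U_def)
    then have "x \<ominus>\<^bsub>H\<^esub> y \<in> W"
      using xy rho v(1) by (simp add: W_def cinner_minus_left)
    then show "x = y"
      using W0 xy by simp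
  qed
  then show thesis
    using transport_irreducible[OF irr] that by blast
qed

lemma unitary_equiv_spherical:
  assumes "unitary_equiv G H \<rho> H' \<rho>' U" and K: "K \<subseteq> carrier G"
    and irr: "irreducible_unitary_rep G T H \<rho>" and irr': "irreducible_unitary_rep G T H' \<rho>'"
    and sph: "spherical_function_via G T K H \<rho> \<Phi>"
  shows "spherical_function_via G T K H' \<rho>' \<Phi>"
proof -
  have U: "bij_betw U (carrier H) (carrier H')" "U \<in> module_hom complex_field H H'"
    "\<And>x y. \<lbrakk>x \<in> carrier H; y \<in> carrier H\<rbrakk> \<Longrightarrow> cinner H' (U x) (U y) = cinner H x y"
    "\<And>g x. \<lbrakk>g \<in> carrier G; x \<in> carrier H\<rbrakk> \<Longrightarrow> \<rho>' g (U x) = U (\<rho> g x)"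
    using assms(1) by (auto simp: unitary_equiv_def)
  interpret complex_hilbert_space H
    using irr by (simp add: irreducible_unitary_rep_def unitary_rep_def)
  interpret H': complex_hilbert_space H'
    using irr' by (simp add: irreducible_unitary_rep_def unitary_rep_def)
  have rho: "\<rho> g x \<in> carrier H" if "g \<in> carrier G" "x \<in> carrier H" for g x
    using irr that by (auto simp: irreducible_unitary_rep_def unitary_rep_def module_hom_def)
  have inj: "U x = U y \<longleftrightarrow> x = y" if "x \<in> carrier H" "y \<in> carrier H" for x y
    using U(1) that by (auto simp: bij_betw_def inj_on_def)
  have car: "carrier H' = U ` carrier H"
    using U(1) by (simp add: bij_betw_def)
  have inv: "invariant_vectors H' \<rho>' K = U ` invariant_vectors H \<rho> K"
    using K by (auto simp: invariant_vectors_def car U(4) inj rho subset_iff)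
  obtain v where v: "v \<in> invariant_vectors H \<rho> K" "v \<noteq> \<zero>\<^bsub>H\<^esub>"
      "\<forall>w\<in>invariant_vectors H \<rho> K. \<exists>c. w = c \<odot>\<^bsub>H\<^esub> v"
      "\<forall>g\<in>carrier G. \<Phi> g = cinner H (\<rho> g v) v"
    using sph by (auto simp: spherical_function_via_def)
  have v': "v \<in> carrier H" using v(1) by (simp add: invariant_vectors_def)
  have "Re (cinner H' (U v) (U v)) > 0"
    using U(3) v' cinner_pos[OF v' v(2)] by simp
  then have "U v \<noteq> \<zero>\<^bsub>H'\<^esub>" by auto
  moreover have "\<exists>c. U w = c \<odot>\<^bsub>H'\<^esub> U v" if "w \<in> invariant_vectors H \<rho> K" for w
    using v(3) that U(2) v' by (fastforce simp: module_hom_def)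
  moreover have "\<Phi> g = cinner H' (\<rho>' g (U v)) (U v)" if "g \<in> carrier G" for g
    using that v(4) U(3,4) v' rho by simp
  ultimately show ?thesis
    using irr' v(1) by (auto simp: spherical_function_via_def inv intro!: bexI[of _ v])
qed

theorem spherical_function_via_imp_spherical_function:
  fixes H :: "'v cinner_space"
  assumes "subgroup K G" "spherical_function_via G T K H \<rho> \<Phi>"
  shows "spherical_function G T K \<Phi>"
proof -
  have irr: "irreducible_unitary_rep G T H \<rho>"
    using assms by (simp add: spherical_function_via_def)
  obtain H' :: "('a \<Rightarrow> complex) cinner_space" and \<rho>' U where
    "irreducible_unitary_rep G T H' \<rho>'" "unitary_equiv G H \<rho> H' \<rho>' U"
    using irreducible_unitary_rep_transfer[OF irr] by blast
  then have "spherical_function_via G T K H' \<rho>' \<Phi>"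
    using unitary_equiv_spherical[OF _ subgroup.subset[OF assms(1)] irr] assms(2) by blast
  then show ?thesis
    by (auto simp: spherical_function_def)
qed

end

theory Submission
  imports Defs
begin

text \<open>Let \<open>\<Phi>\<^sub>1\<close>, \<open>\<Phi>\<^sub>2\<close> be the matrix elements of the spherical vectors \<open>v1\<close>, \<open>v2\<close> of two irreducible
  representations on \<open>H1\<close>, \<open>H2\<close>. In the tensor product representation on \<open>H1 \<otimes> H2\<close>
  (\<open>hilbert_tensor_exists\<close>, \<open>tensor_rep_exists\<close>) the matrix element of \<open>v1 \<otimes> v2\<close> is
  \<open>\<Phi>\<^sub>1 \<Phi>\<^sub>2\<close>. The tensor product is in general reducible, but suppose that its only
  \<open>K\<close>-invariant vectors are the multiples of \<open>v1 \<otimes> v2\<close>. Then the closed subspace generated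
  by the orbit of \<open>v1 \<otimes> v2\<close> is irreducible: the projection of \<open>v1 \<otimes> v2\<close> to a closed
  invariant subspace is \<open>K\<close>-invariant, so it is a multiple of \<open>v1 \<otimes> v2\<close>, and the subspace
  is everything or zero (\<open>spherical_function_via_cyclic\<close>). So \<open>\<Phi>\<^sub>1 \<Phi>\<^sub>2\<close> is spherical.

  The assumption on \<open>K\<close> enters in the determination of the invariant vectors
  (\<open>tensor_invariant_vector_zero\<close>). A \<open>K\<close>-invariant vector \<open>w\<close> of \<open>H1 \<otimes> H2\<close> is the same as a
  Hilbert-Schmidt antilinear map \<open>A\<close> from \<open>H1\<close> to \<open>H2\<close> that commutes with \<open>K\<close>, by
  \<open>\<langle>A x, y\<rangle> = \<langle>w, x \<otimes> y\<rangle>\<close>. If \<open>w \<noteq> 0\<close>, the compact positive operator \<open>A\<^sup>*A\<close> has a largest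
  eigenvalue, which is positive, and its eigenspace is finite-dimensional and stable under \<open>K\<close>
  (\<open>top_value_attained\<close>, \<open>top_space_fin_dim\<close>). As \<open>K\<close> has only trivial finite-dimensional
  unitary representations, the eigenspace consists of \<open>K\<close>-invariant vectors \<open>x\<close>. For such an
  \<open>x \<noteq> 0\<close> also \<open>A x\<close> is \<open>K\<close>-invariant, and \<open>\<langle>w, x \<otimes> A x\<rangle>\<close> is the positive number
  \<open>\<langle>A x, A x\<rangle>\<close>. Here \<open>x\<close> and \<open>A x\<close> are multiples of \<open>v1\<close> and \<open>v2\<close>, so \<open>w\<close> is not orthogonal
  to \<open>v1 \<otimes> v2\<close>. Subtracting from an invariant vector its component along \<open>v1 \<otimes> v2\<close>
  therefore leaves zero.

  The Hilbert space theory behind this rests on one construction, the Riesz-Fischer theorem for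
  arbitrary orthonormal families (\<open>Riesz_Fischer\<close>): it gives Parseval's identity, orthogonal
  projections, the representation of functionals, and the unitary operators on the tensor
  product.\<close>

section \<open>Norms and inner products\<close>

definition norm_sq :: "'v cinner_space \<Rightarrow> 'v \<Rightarrow> real"
  where "norm_sq H x = Re (cinner H x x)"

definition closed_subspace :: "'v cinner_space \<Rightarrow> 'v set \<Rightarrow> bool"
  where "closed_subspace H W \<longleftrightarrow>
    VectorSpace.subspace complex_field W H \<and> closedin (htopology H) W"

definition hconv :: "'v cinner_space \<Rightarrow> (nat \<Rightarrow> 'v) \<Rightarrow> 'v \<Rightarrow> bool"
  where "hconv H s x \<longleftrightarrow> range s \<subseteq> carrier H \<and> x \<in> carrier H \<and> (\<lambda>n. hdist H (s n) x) \<longlonglongrightarrow> 0"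

text \<open>Families rather than sets: the images of a basis under a unitary operator, and the tensor
  products of two bases, are again families on the given index sets.\<close>

definition orthonormal :: "'v cinner_space \<Rightarrow> ('i \<Rightarrow> 'v) \<Rightarrow> 'i set \<Rightarrow> bool"
  where "orthonormal H b I \<longleftrightarrow> b ` I \<subseteq> carrier H \<and>
    (\<forall>i\<in>I. \<forall>j\<in>I. cinner H (b i) (b j) = (if i = j then 1 else 0))"

definition total_in :: "'v cinner_space \<Rightarrow> ('i \<Rightarrow> 'v) \<Rightarrow> 'i set \<Rightarrow> bool"
  where "total_in H b I \<longleftrightarrow> b ` I \<subseteq> carrier H \<and>
    (\<forall>x\<in>carrier H. (\<forall>i\<in>I. cinner H x (b i) = 0) \<longrightarrow> x = \<zero>\<^bsub>H\<^esub>)"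

context complex_inner_space
begin

lemma cinner_zero_right [simp]: "x \<in> carrier H \<Longrightarrow> cinner H x \<zero> = 0"
  using cinner_commute[of \<zero> x] by simp

lemma norm_sq_nonneg [simp]: "x \<in> carrier H \<Longrightarrow> 0 \<le> norm_sq H x"
  by (simp add: norm_sq_def cinner_self)

lemma norm_sq_eq_0: "x \<in> carrier H \<Longrightarrow> norm_sq H x = 0 \<longleftrightarrow> x = \<zero>"
  by (simp add: norm_sq_def cinner_self)

lemma norm_sq_zero [simp]: "norm_sq H \<zero> = 0"
  by (simp add: norm_sq_eq_0)

lemma cinner_self_norm_sq: "x \<in> carrier H \<Longrightarrow> cinner H x x = of_real (norm_sq H x)"
  by (simp add: norm_sq_def complex_eq_iff cinner_self)

lemma norm_sq_smult: "x \<in> carrier H \<Longrightarrow> norm_sq H (c \<odot> x) = (cmod c)\<^sup>2 * norm_sq H x"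
proof -
  assume x: "x \<in> carrier H"
  have "cinner H (c \<odot> x) (c \<odot> x) = (c * cnj c) * cinner H x x"
    using x by (simp add: cinner_smult_left cinner_smult_right)
  also have "\<dots> = of_real ((cmod c)\<^sup>2 * norm_sq H x)"
    using x by (simp only: complex_norm_square[symmetric] cinner_self_norm_sq of_real_mult)
  finally show ?thesis by (simp add: norm_sq_def)
qed

lemma norm_sq_add: "\<lbrakk>x \<in> carrier H; y \<in> carrier H\<rbrakk>
    \<Longrightarrow> norm_sq H (x \<oplus> y) = norm_sq H x + norm_sq H y + 2 * Re (cinner H x y)"
  by (simp add: norm_sq_def cinner_add_left cinner_add_right cinner_commute[of x y])

lemma norm_sq_minus: "\<lbrakk>x \<in> carrier H; y \<in> carrier H\<rbrakk>
    \<Longrightarrow> norm_sq H (x \<ominus> y) = norm_sq H x + norm_sq H y - 2 * Re (cinner H x y)"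
  by (simp add: norm_sq_def cinner_minus_left cinner_minus_right cinner_commute[of x y])

lemma parallelogram: "\<lbrakk>x \<in> carrier H; y \<in> carrier H\<rbrakk>
    \<Longrightarrow> norm_sq H (x \<oplus> y) + norm_sq H (x \<ominus> y) = 2 * norm_sq H x + 2 * norm_sq H y"
  by (simp add: norm_sq_add norm_sq_minus)

lemma hdist_norm_sq: "\<lbrakk>x \<in> carrier H; y \<in> carrier H\<rbrakk> \<Longrightarrow> hdist H x y = sqrt (norm_sq H (x \<ominus> y))"
  by (simp add: hdist_eq norm_sq_def)

lemma Cauchy_Schwarz_sq: "\<lbrakk>x \<in> carrier H; y \<in> carrier H\<rbrakk>
    \<Longrightarrow> (cmod (cinner H x y))\<^sup>2 \<le> norm_sq H x * norm_sq H y"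
  using power_mono[OF Cauchy_Schwarz[of x y], of 2] by (simp add: norm_sq_def power_mult_distrib cinner_self)

lemma minus_eq_zero_iff: "\<lbrakk>x \<in> carrier H; y \<in> carrier H\<rbrakk> \<Longrightarrow> x \<ominus> y = \<zero> \<longleftrightarrow> x = y"
  by (metis M.minus_closed M.add.inv_closed M.a_inv_closed M.minus_eq M.minus_equality M.r_neg M.a_comm M.minus_minus)

text \<open>Identities between vectors are proved below by comparing inner products, because these
  expand by rewriting; this avoids calculations with the operations of the module.\<close>

lemma cinner_ext:
  assumes "x \<in> carrier H" "y \<in> carrier H" "\<And>z. z \<in> carrier H \<Longrightarrow> cinner H x z = cinner H y z"
  shows "x = y"
proof -
  have "norm_sq H (x \<ominus> y) = 0"
    using assms by (simp add: norm_sq_def cinner_minus_left)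
  then show ?thesis using assms by (simp add: norm_sq_eq_0 minus_eq_zero_iff)
qed

lemma total_ext:
  assumes "total_in H b I" "x \<in> carrier H" "y \<in> carrier H"
    and "\<And>i. i \<in> I \<Longrightarrow> cinner H x (b i) = cinner H y (b i)"
  shows "x = y"
proof -
  have "b i \<in> carrier H" if "i \<in> I" for i using assms(1) that by (auto simp: total_in_def)
  then have "\<forall>i\<in>I. cinner H (x \<ominus> y) (b i) = 0"
    using assms by (simp add: cinner_minus_left)
  then have "x \<ominus> y = \<zero>" using assms(1-3) unfolding total_in_def by blast
  then show ?thesis using assms(2,3) minus_eq_zero_iff by blast
qed

lemma subspace_iff: "VectorSpace.subspace complex_field W H \<longleftrightarrow>
    W \<subseteq> carrier H \<and> \<zero> \<in> W \<and> (\<forall>x\<in>W. \<forall>y\<in>W. x \<oplus> y \<in> W) \<and> (\<forall>c. \<forall>x\<in>W. c \<odot> x \<in> W)"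
  unfolding VectorSpace.subspace_def LinearCombinations.submodule_def
  using vectorspace_axioms module_axioms by auto

lemma minus_smult: "\<lbrakk>x \<in> carrier H; y \<in> carrier H\<rbrakk> \<Longrightarrow> x \<ominus> y = x \<oplus> (- 1) \<odot> y"
  by (rule cinner_ext) (auto simp: cinner_minus_left cinner_add_left cinner_smult_left)

lemma subspace_minus: "\<lbrakk>VectorSpace.subspace complex_field W H; x \<in> W; y \<in> W\<rbrakk> \<Longrightarrow> x \<ominus> y \<in> W"
  unfolding subspace_iff by (subst minus_smult) auto

section \<open>Convergent sequences and closed subspaces\<close>

lemma hconv_iff_limitin:
  "hconv H s x \<longleftrightarrow> range s \<subseteq> carrier H \<and> limitin (htopology H) s x sequentially"
proof -
  interpret Metric_space "carrier H" "hdist H" by (rule Metric_space_hdist)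
  show ?thesis
    unfolding hconv_def htopology_def limitin_metric_dist_null by (auto intro: always_eventually)
qed

lemma closedin_iff_hconv:
  "closedin (htopology H) W \<longleftrightarrow> W \<subseteq> carrier H \<and> (\<forall>s x. range s \<subseteq> W \<and> hconv H s x \<longrightarrow> x \<in> W)"
proof -
  interpret Metric_space "carrier H" "hdist H" by (rule Metric_space_hdist)
  show ?thesis
    unfolding htopology_def metric_closedin_iff_sequentially_closed hconv_iff_limitin by blast
qed

lemma hconv_cinner:
  assumes "hconv H s x" "y \<in> carrier H"
  shows "(\<lambda>n. cinner H (s n) y) \<longlonglongrightarrow> cinner H x y"
proof -
  have s: "s n \<in> carrier H" for n using assms by (auto simp: hconv_def)
  have x: "x \<in> carrier H" using assms by (simp add: hconv_def)
  have "(\<lambda>n. hdist H (s n) x * sqrt (norm_sq H y)) \<longlonglongrightarrow> 0"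
    using tendsto_mult_left_zero assms(1) unfolding hconv_def by blast
  moreover have "cmod (cinner H (s n) y - cinner H x y) \<le> hdist H (s n) x * sqrt (norm_sq H y)" for n
    using Cauchy_Schwarz[of "s n \<ominus> x" y] s x assms(2)
    by (simp add: hdist_norm_sq cinner_minus_left norm_sq_def)
  ultimately have "(\<lambda>n. cinner H (s n) y - cinner H x y) \<longlonglongrightarrow> 0"
    by (rule_tac Lim_null_comparison[OF always_eventually[OF allI]]) auto
  then show ?thesis by (simp add: LIM_zero_iff)
qed

lemma hconv_norm_sq_minus:
  assumes "hconv H s x"
  shows "(\<lambda>n. norm_sq H (s n \<ominus> x)) \<longlonglongrightarrow> 0"
proof -
  have s: "s n \<in> carrier H" for n using assms by (auto simp: hconv_def)
  have x: "x \<in> carrier H" using assms by (simp add: hconv_def)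
  have "(\<lambda>n. (hdist H (s n) x)\<^sup>2) \<longlonglongrightarrow> 0\<^sup>2"
    using assms unfolding hconv_def by (intro tendsto_power) blast
  then show ?thesis using s x by (simp add: hdist_norm_sq)
qed

lemma hconv_norm_sq:
  assumes "hconv H s x"
  shows "(\<lambda>n. norm_sq H (s n)) \<longlonglongrightarrow> norm_sq H x"
proof -
  have s: "s n \<in> carrier H" for n using assms by (auto simp: hconv_def)
  have x: "x \<in> carrier H" using assms by (simp add: hconv_def)
  have "(\<lambda>n. norm_sq H (s n \<ominus> x) - norm_sq H x + 2 * Re (cinner H (s n) x))
      \<longlonglongrightarrow> 0 - norm_sq H x + 2 * Re (cinner H x x)"
    by (intro tendsto_intros hconv_norm_sq_minus hconv_cinner assms x)
  also have "(\<lambda>n. norm_sq H (s n \<ominus> x) - norm_sq H x + 2 * Re (cinner H (s n) x)) = (\<lambda>n. norm_sq H (s n))"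
    using s x by (simp add: norm_sq_minus)
  finally show ?thesis by (simp add: norm_sq_def)
qed

lemma hconvI:
  assumes "\<And>n. s n \<in> carrier H" "x \<in> carrier H" "(\<lambda>n. norm_sq H (s n \<ominus> x)) \<longlonglongrightarrow> 0"
  shows "hconv H s x"
proof -
  have "(\<lambda>n. sqrt (norm_sq H (s n \<ominus> x))) \<longlonglongrightarrow> sqrt 0"
    by (intro tendsto_intros assms)
  then show ?thesis using assms by (auto simp: hconv_def hdist_norm_sq)
qed

text \<open>Both linear and antilinear functionals are covered: \<open>g\<close> is the identity or the conjugation.
  The bound expresses continuity.\<close>

lemma closed_subspace_zero_set:
  assumes "\<And>x y. \<lbrakk>x \<in> carrier H; y \<in> carrier H\<rbrakk> \<Longrightarrow> f (x \<oplus> y) = f x + f y"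
    and "\<And>c x. x \<in> carrier H \<Longrightarrow> f (c \<odot> x) = g c * f x"
    and bd: "\<And>x. x \<in> carrier H \<Longrightarrow> (cmod (f x))\<^sup>2 \<le> B * norm_sq H x"
  shows "closed_subspace H {x \<in> carrier H. f x = 0}"
proof -
  have z: "f \<zero> = 0" using bd[of \<zero>] by simp
  have m: "f (x \<ominus> y) = f x - f y" if "x \<in> carrier H" "y \<in> carrier H" for x y
  proof -
    have "x \<ominus> y \<oplus> y = x" using that by (simp add: a_minus_def M.a_assoc M.l_neg)
    then show ?thesis using assms(1)[of "x \<ominus> y" y] that by simp
  qed
  have "x \<in> {x \<in> carrier H. f x = 0}"
    if s: "range s \<subseteq> {x \<in> carrier H. f x = 0}" and c: "hconv H s x" for s x
  proof -
    have sc: "s n \<in> carrier H" "f (s n) = 0" for n using s by auto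
    have x: "x \<in> carrier H" using c by (simp add: hconv_def)
    have "(\<lambda>n. B * norm_sq H (s n \<ominus> x)) \<longlonglongrightarrow> B * 0"
      by (intro tendsto_intros hconv_norm_sq_minus c)
    moreover have "(cmod (f x))\<^sup>2 \<le> B * norm_sq H (s n \<ominus> x)" for n
      using bd[of "s n \<ominus> x"] m[of "s n" x] sc x by simp
    ultimately have "(cmod (f x))\<^sup>2 \<le> 0"
      by (intro LIMSEQ_le_const[where X = "\<lambda>n. B * norm_sq H (s n \<ominus> x)"]) auto
    then show ?thesis using x by simp
  qed
  then have "closedin (htopology H) {x \<in> carrier H. f x = 0}"
    unfolding closedin_iff_hconv by blast
  moreover have "VectorSpace.subspace complex_field {x \<in> carrier H. f x = 0} H"
    unfolding subspace_iff by (simp add: assms(1,2) z subset_iff)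
  ultimately show ?thesis by (simp add: closed_subspace_def)
qed

lemma closed_subspace_orthogonal:
  assumes "A \<subseteq> carrier H"
  shows "closed_subspace H {x \<in> carrier H. \<forall>a\<in>A. cinner H x a = 0}"
proof -
  have "x \<in> {x \<in> carrier H. \<forall>a\<in>A. cinner H x a = 0}"
    if s: "range s \<subseteq> {x \<in> carrier H. \<forall>a\<in>A. cinner H x a = 0}" and c: "hconv H s x" for s x
  proof -
    have "cinner H x a = 0" if a: "a \<in> A" for a
    proof -
      have "(\<lambda>n. cinner H (s n) a) \<longlonglongrightarrow> cinner H x a"
        using c a assms by (intro hconv_cinner) auto
      moreover have "cinner H (s n) a = 0" for n using s a by auto
      ultimately show ?thesis by (simp add: LIMSEQ_const_iff)
    qed
    then show ?thesis using c by (simp add: hconv_def)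
  qed
  then have "closedin (htopology H) {x \<in> carrier H. \<forall>a\<in>A. cinner H x a = 0}"
    unfolding closedin_iff_hconv by blast
  moreover have "VectorSpace.subspace complex_field {x \<in> carrier H. \<forall>a\<in>A. cinner H x a = 0} H"
    unfolding subspace_iff using assms by (auto simp: cinner_add_left cinner_smult_left subset_iff)
  ultimately show ?thesis by (simp add: closed_subspace_def)
qed

lemma closed_subspace_Inter:
  assumes "\<S> \<noteq> {}" "\<And>W. W \<in> \<S> \<Longrightarrow> closed_subspace H W"
  shows "closed_subspace H (\<Inter>\<S>)"
  using assms unfolding closed_subspace_def subspace_iff
  by (intro conjI closedin_Inter) (blast+)

section \<open>Orthonormal families\<close>

text \<open>The sum of a finite family, characterised by its inner products and by its membership in
  every subspace that contains the family.\<close>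

lemma vsum_exists:
  assumes "finite F" "\<And>i. i \<in> F \<Longrightarrow> b i \<in> carrier H"
  shows "\<exists>z\<in>carrier H. (\<forall>W. VectorSpace.subspace complex_field W H \<and> b ` F \<subseteq> W \<longrightarrow> z \<in> W) \<and>
      (\<forall>y\<in>carrier H. cinner H z y = (\<Sum>i\<in>F. cinner H (b i) y))"
  using assms
proof (induction F)
  case empty
  then show ?case by (intro bexI[of _ \<zero>]) (auto simp: subspace_iff)
next
  case (insert i F)
  then obtain z where z: "z \<in> carrier H"
    "\<forall>W. VectorSpace.subspace complex_field W H \<and> b ` F \<subseteq> W \<longrightarrow> z \<in> W"
    "\<forall>y\<in>carrier H. cinner H z y = (\<Sum>i\<in>F. cinner H (b i) y)" by auto
  have "b i \<oplus> z \<in> W" if W: "VectorSpace.subspace complex_field W H" "b ` insert i F \<subseteq> W" for W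
  proof -
    have "z \<in> W" "b i \<in> W" using z(2) W by auto
    then show ?thesis using W(1) by (simp add: subspace_iff)
  qed
  moreover have "\<forall>y\<in>carrier H. cinner H (b i \<oplus> z) y = (\<Sum>i\<in>insert i F. cinner H (b i) y)"
    using insert z by (simp add: cinner_add_left)
  ultimately show ?case
    using insert.prems z(1) by (intro bexI[of _ "b i \<oplus> z"]) auto
qed

lemma orthonormal_vsum_exists:
  assumes on: "orthonormal H b I" and F: "finite F" "F \<subseteq> I"
  shows "\<exists>z\<in>carrier H. (\<forall>W. VectorSpace.subspace complex_field W H \<and> b ` F \<subseteq> W \<longrightarrow> z \<in> W) \<and>
      (\<forall>y\<in>carrier H. cinner H z y = (\<Sum>i\<in>F. c i * cinner H (b i) y)) \<and>
      (\<forall>j\<in>I. cinner H z (b j) = (if j \<in> F then c j else 0)) \<and>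
      norm_sq H z = (\<Sum>i\<in>F. (cmod (c i))\<^sup>2)"
proof -
  have b: "b i \<in> carrier H" if "i \<in> I" for i using on that by (auto simp: orthonormal_def)
  have cb: "c i \<odot> b i \<in> carrier H" if "i \<in> F" for i using that F b by auto
  obtain z where z: "z \<in> carrier H"
    "\<And>W. VectorSpace.subspace complex_field W H \<and> (\<lambda>i. c i \<odot> b i) ` F \<subseteq> W \<Longrightarrow> z \<in> W"
    "\<And>y. y \<in> carrier H \<Longrightarrow> cinner H z y = (\<Sum>i\<in>F. cinner H (c i \<odot> b i) y)"
    using vsum_exists[of F "\<lambda>i. c i \<odot> b i", OF F(1) cb] by blast
  have z3: "cinner H z y = (\<Sum>i\<in>F. c i * cinner H (b i) y)" if "y \<in> carrier H" for y
    using z(3)[OF that] F that b by (simp add: cinner_smult_left subset_iff)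
  have z4: "cinner H z (b j) = (if j \<in> F then c j else 0)" if "j \<in> I" for j
  proof -
    have "cinner H z (b j) = (\<Sum>i\<in>F. if i = j then c i else 0)"
      unfolding z3[OF b[OF that]] using on F that
      by (intro sum.cong) (auto simp: orthonormal_def)
    then show ?thesis using F by simp
  qed
  have "cinner H z z = (\<Sum>i\<in>F. of_real ((cmod (c i))\<^sup>2))"
    unfolding z3[OF z(1)]
  proof (rule sum.cong[OF refl])
    fix i assume i: "i \<in> F"
    have "cinner H (b i) z = cnj (c i)"
      using z4[of i] cinner_commute[of z "b i"] b i F z(1) by auto
    then show "c i * cinner H (b i) z = of_real ((cmod (c i))\<^sup>2)"
      by (simp add: complex_norm_square del: of_real_power)
  qed
  then have "norm_sq H z = (\<Sum>i\<in>F. (cmod (c i))\<^sup>2)" by (simp add: norm_sq_def)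
  moreover have "z \<in> W" if W: "VectorSpace.subspace complex_field W H" "b ` F \<subseteq> W" for W
    using W by (intro z(2)) (auto simp: subspace_iff)
  ultimately show ?thesis using z(1) z3 z4 by blast
qed

text \<open>The orthogonal projection \<open>z\<close> of \<open>x\<close> to the span of finitely many members satisfies
  \<open>\<langle>z, x\<rangle> = \<langle>z, z\<rangle>\<close>, so that the claim is the positivity of the norm of \<open>z - x\<close>.\<close>

lemma Bessel:
  assumes on: "orthonormal H b I" and F: "finite F" "F \<subseteq> I" and x: "x \<in> carrier H"
  shows "(\<Sum>i\<in>F. (cmod (cinner H x (b i)))\<^sup>2) \<le> norm_sq H x"
proof -
  obtain z where z: "z \<in> carrier H"
    "\<And>y. y \<in> carrier H \<Longrightarrow> cinner H z y = (\<Sum>i\<in>F. cinner H x (b i) * cinner H (b i) y)"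
    "norm_sq H z = (\<Sum>i\<in>F. (cmod (cinner H x (b i)))\<^sup>2)"
    using orthonormal_vsum_exists[OF on F, of "\<lambda>i. cinner H x (b i)"] by blast
  have b: "b i \<in> carrier H" if "i \<in> I" for i using on that by (auto simp: orthonormal_def)
  have "cinner H z x = (\<Sum>i\<in>F. of_real ((cmod (cinner H x (b i)))\<^sup>2))"
    unfolding z(2)[OF x]
  proof (rule sum.cong[OF refl])
    fix i assume "i \<in> F"
    then have "cinner H (b i) x = cnj (cinner H x (b i))" using b F x by (intro cinner_commute) auto
    then show "cinner H x (b i) * cinner H (b i) x = of_real ((cmod (cinner H x (b i)))\<^sup>2)"
      by (simp add: complex_norm_square del: of_real_power)
  qed
  then have "Re (cinner H z x) = norm_sq H z" by (simp add: z(3))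
  moreover have "0 \<le> norm_sq H (z \<ominus> x)" using z x by simp
  ultimately show ?thesis using z x by (simp add: norm_sq_minus)
qed

text \<open>By Zorn's lemma there is a maximal orthonormal set; a nonzero vector orthogonal to it could be
  normalised and added.\<close>

lemma orthonormal_basis_exists:
  obtains B where "orthonormal H (\<lambda>x. x) B" "total_in H (\<lambda>x. x) B"
proof -
  define \<A> where "\<A> = {B. orthonormal H (\<lambda>x. x) B}"
  have "\<exists>B\<in>\<A>. \<forall>X\<in>\<A>. B \<subseteq> X \<longrightarrow> X = B"
  proof (rule subset_Zorn')
    fix \<C> assume ch: "subset.chain \<A> \<C>"
    have "\<exists>X\<in>\<C>. x \<in> X \<and> y \<in> X" if "x \<in> \<Union>\<C>" "y \<in> \<Union>\<C>" for x y
    proof -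
      from that obtain X Y where XY: "X \<in> \<C>" "Y \<in> \<C>" "x \<in> X" "y \<in> Y" by blast
      then have "X \<subseteq> Y \<or> Y \<subseteq> X" using ch unfolding subset_chain_def by blast
      then show ?thesis using XY by blast
    qed
    moreover have X: "orthonormal H (\<lambda>x. x) X" if "X \<in> \<C>" for X
      using ch that by (auto simp: subset_chain_def \<A>_def)
    ultimately have "cinner H x y = (if x = y then 1 else 0)" if "x \<in> \<Union>\<C>" "y \<in> \<Union>\<C>" for x y
      using that unfolding orthonormal_def by blast
    moreover have "\<Union>\<C> \<subseteq> carrier H" using X by (auto simp: orthonormal_def)
    ultimately show "\<Union>\<C> \<in> \<A>"
      by (simp add: \<A>_def orthonormal_def)
  qed
  then obtain B where B: "orthonormal H (\<lambda>x. x) B"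
    and max: "\<And>X. \<lbrakk>orthonormal H (\<lambda>x. x) X; B \<subseteq> X\<rbrakk> \<Longrightarrow> X = B"
    by (auto simp: \<A>_def)
  have "x = \<zero>" if x: "x \<in> carrier H" "\<forall>b\<in>B. cinner H x b = 0" for x
  proof (rule ccontr)
    assume "x \<noteq> \<zero>"
    then have s: "norm_sq H x > 0" using x by (simp add: norm_sq_def cinner_pos)
    define u where "u = of_real (1 / sqrt (norm_sq H x)) \<odot> x"
    have u: "u \<in> carrier H" using x by (simp add: u_def)
    have "norm_sq H u = 1" using s x(1) by (simp add: u_def norm_sq_smult norm_divide power_divide)
    then have uu: "cinner H u u = 1" using u by (simp add: cinner_self_norm_sq)
    have ub: "cinner H u b = 0" if "b \<in> B" for b
      using that x B by (auto simp: u_def cinner_smult_left orthonormal_def)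
    moreover have "cinner H b u = 0" if "b \<in> B" for b
      using ub[OF that] cinner_commute[of u b] u B that by (auto simp: orthonormal_def)
    ultimately have "orthonormal H (\<lambda>x. x) (insert u B)"
      using B u uu by (auto simp: orthonormal_def)
    then have "u \<in> B" using max by blast
    then show False using ub uu by force
  qed
  then show thesis using that B by (auto simp: total_in_def orthonormal_def)
qed

end

section \<open>The Riesz-Fischer theorem and Parseval identities\<close>

lemma complex_polarization:
  fixes a b :: complex
  shows "a * cnj b = 1/4 * of_real ((cmod (a + b))\<^sup>2) + - 1/4 * of_real ((cmod (a - b))\<^sup>2)
    + (\<i>/4 * of_real ((cmod (a + \<i> * b))\<^sup>2) + - \<i>/4 * of_real ((cmod (a - \<i> * b))\<^sup>2))"
  by (simp add: complex_eq_iff cmod_power2) (simp add: power2_eq_square field_simps)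

context complex_hilbert_space
begin

lemma hilbert_convergent:
  assumes s: "\<And>n. s n \<in> carrier H"
    and C: "\<And>\<epsilon>. \<epsilon> > 0 \<Longrightarrow> \<exists>N. \<forall>m\<ge>N. \<forall>n\<ge>N. norm_sq H (s m \<ominus> s n) < \<epsilon>"
  obtains x where "hconv H s x"
proof -
  interpret MS: Metric_space "carrier H" "hdist H" by (rule Metric_space_hdist)
  have "MS.MCauchy s"
    unfolding MS.MCauchy_def
  proof (intro conjI allI impI)
    fix e :: real assume e: "e > 0"
    obtain N where N: "\<forall>m\<ge>N. \<forall>n\<ge>N. norm_sq H (s m \<ominus> s n) < e\<^sup>2" using C[of "e\<^sup>2"] e by auto
    have "sqrt (norm_sq H (s m \<ominus> s n)) < e" if "m \<ge> N" "n \<ge> N" for m n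
      using N that e by (intro real_less_lsqrt) auto
    then show "\<exists>N. \<forall>n n'. N \<le> n \<longrightarrow> N \<le> n' \<longrightarrow> hdist H (s n) (s n') < e"
      using s by (auto simp: hdist_norm_sq)
  qed (use s in auto)
  then obtain x where "limitin MS.mtopology s x sequentially"
    using complete MS.mcomplete_def by blast
  then show thesis
    using that s by (auto simp: hconv_iff_limitin htopology_def)
qed

text \<open>Choose increasing finite sets \<open>F n\<close> of indices on which the sum of the squares
  \<open>(cmod (c i))\<^sup>2\<close> comes within \<open>1 / (n + 1)\<close> of its supremum. The distances between the finite
  sums \<open>\<Sum>i\<in>F n. c i b i\<close> are controlled by these defects, so they have a limit. The third
  conclusion says that the limit lies in the closed span of the family.\<close>

theorem Riesz_Fischer:
  assumes on: "orthonormal H b I"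
    and bd: "\<And>F. \<lbrakk>finite F; F \<subseteq> I\<rbrakk> \<Longrightarrow> (\<Sum>i\<in>F. (cmod (c i))\<^sup>2) \<le> C"
  obtains z where "z \<in> carrier H" "\<forall>i\<in>I. cinner H z (b i) = c i"
    "\<forall>W. closed_subspace H W \<and> b ` I \<subseteq> W \<longrightarrow> z \<in> W"
    "((\<lambda>i. (cmod (c i))\<^sup>2) has_sum norm_sq H z) I"
proof -
  define Q where "Q F = (\<Sum>i\<in>F. (cmod (c i))\<^sup>2)" for F
  define S where "S = (SUP F\<in>{F. finite F \<and> F \<subseteq> I}. Q F)"
  have bdd: "bdd_above (Q ` {F. finite F \<and> F \<subseteq> I})"
    using bd by (auto simp: bdd_above_def Q_def)
  have QS: "Q F \<le> S" if "finite F" "F \<subseteq> I" for F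
    unfolding S_def using that by (intro cSUP_upper bdd) auto
  have "\<exists>F. finite F \<and> F \<subseteq> I \<and> Q F > S - 1 / Suc n" for n
  proof -
    have "\<exists>F\<in>{F. finite F \<and> F \<subseteq> I}. S - 1 / Suc n < Q F"
      unfolding less_cSUP_iff[OF _ bdd, symmetric, of "S - 1 / Suc n"]
      by (subst less_cSUP_iff[symmetric]) (use bdd in \<open>auto simp flip: S_def\<close>)
    then show ?thesis by auto
  qed
  then obtain F0 where F0: "\<And>n. finite (F0 n)" "\<And>n. F0 n \<subseteq> I" "\<And>n. Q (F0 n) > S - 1 / Suc n"
    by metis
  define F where "F n = (\<Union>k\<le>n. F0 k)" for n :: nat
  have F: "finite (F n)" "F n \<subseteq> I" for n using F0 by (auto simp: F_def)
  have Fmono: "F m \<subseteq> F n" if "m \<le> n" for m n using that by (fastforce simp: F_def)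
  have QF: "Q (F n) > S - 1 / Suc n" for n
  proof -
    have "Q (F0 n) \<le> Q (F n)"
      unfolding Q_def using F by (intro sum_mono2) (auto simp: F_def)
    then show ?thesis using F0(3)[of n] by simp
  qed
  define P where "P n z \<longleftrightarrow>
      (\<forall>W. VectorSpace.subspace complex_field W H \<and> b ` F n \<subseteq> W \<longrightarrow> z \<in> W) \<and>
      (\<forall>y\<in>carrier H. cinner H z y = (\<Sum>i\<in>F n. c i * cinner H (b i) y)) \<and>
      (\<forall>j\<in>I. cinner H z (b j) = (if j \<in> F n then c j else 0)) \<and> norm_sq H z = Q (F n)" for n z
  have "\<exists>z\<in>carrier H. P n z" for n
    using orthonormal_vsum_exists[OF on F(1)[of n] F(2)[of n], of c] unfolding Q_def P_def .
  then obtain s where s: "\<And>n. s n \<in> carrier H" and s': "\<And>n. P n (s n)"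
    by metis
  have sW: "\<And>n W. \<lbrakk>VectorSpace.subspace complex_field W H; b ` F n \<subseteq> W\<rbrakk> \<Longrightarrow> s n \<in> W"
    and sy: "\<And>n y. y \<in> carrier H \<Longrightarrow> cinner H (s n) y = (\<Sum>i\<in>F n. c i * cinner H (b i) y)"
    and sb: "\<And>n j. j \<in> I \<Longrightarrow> cinner H (s n) (b j) = (if j \<in> F n then c j else 0)"
    and sQ: "\<And>n. norm_sq H (s n) = Q (F n)"
    using s' unfolding P_def by blast+
  have b: "b i \<in> carrier H" if "i \<in> I" for i using on that by (auto simp: orthonormal_def)
  have diff: "norm_sq H (s m \<ominus> s n) < 1 / Suc N" if "N \<le> m" "N \<le> n" for m n N
  proof -
    have *: "norm_sq H (s m \<ominus> s n) = Q (F n) - Q (F m)" if "m \<le> n" for m n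
    proof -
      have "cinner H (s m) (s n) = (\<Sum>i\<in>F m. of_real ((cmod (c i))\<^sup>2))"
        unfolding sy[OF s]
      proof (rule sum.cong[OF refl])
        fix i assume i: "i \<in> F m"
        then have "i \<in> F n" "i \<in> I" using Fmono[OF that] F(2)[of m] by auto
        then have "cinner H (b i) (s n) = cnj (c i)"
          using sb[of i n] cinner_commute[of "s n" "b i"] b s by auto
        then show "c i * cinner H (b i) (s n) = of_real ((cmod (c i))\<^sup>2)"
          by (simp add: complex_norm_square del: of_real_power)
      qed
      then show ?thesis using s by (simp add: norm_sq_minus sQ Q_def)
    qed
    have "Q (F k) \<le> S" "Q (F k) > S - 1 / Suc N" if "N \<le> k" for k
    proof -
      show "Q (F k) \<le> S" using QS F by blast
      have "1 / Suc k \<le> 1 / Suc N" using that by (simp add: field_simps)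
      then show "Q (F k) > S - 1 / Suc N" using QF[of k] by linarith
    qed
    note Qk = this
    show ?thesis
    proof (cases "m \<le> n")
      case True then show ?thesis using * Qk[of m] Qk[of n] that by force
    next
      case False
      then have "norm_sq H (s m \<ominus> s n) = norm_sq H (s n \<ominus> s m)"
        using s cinner_commute[of "s m" "s n"] by (simp add: norm_sq_minus)
      then show ?thesis using *[of n m] False Qk[of m] Qk[of n] that by force
    qed
  qed
  obtain z where z: "hconv H s z"
  proof (rule hilbert_convergent[OF s])
    fix e :: real assume "e > 0"
    then obtain N where "1 / Suc N < e" using nat_approx_posE by blast
    then show "\<exists>N. \<forall>m\<ge>N. \<forall>n\<ge>N. norm_sq H (s m \<ominus> s n) < e"
      using diff by (meson less_trans)
  qed
  have zc: "z \<in> carrier H" using z by (simp add: hconv_def)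
  have "norm_sq H z = S"
  proof (rule LIMSEQ_unique[OF hconv_norm_sq[OF z]])
    have "(\<lambda>n. Q (F n)) \<longlonglongrightarrow> S"
    proof (rule tendsto_sandwich[of "\<lambda>n. S - 1 / Suc n" _ _ "\<lambda>n. S"])
      have "(\<lambda>n. S - 1 / real (Suc n)) \<longlonglongrightarrow> S - 0"
        by (intro tendsto_intros LIMSEQ_Suc lim_1_over_n)
      then show "(\<lambda>n. S - 1 / real (Suc n)) \<longlonglongrightarrow> S" by simp
      show "\<forall>\<^sub>F n in sequentially. S - 1 / real (Suc n) \<le> Q (F n)"
        using QF by (intro always_eventually) (simp add: less_imp_le)
      show "\<forall>\<^sub>F n in sequentially. Q (F n) \<le> S" using QS F by (intro always_eventually) blast
    qed auto
    then show "(\<lambda>n. norm_sq H (s n)) \<longlonglongrightarrow> S" by (simp add: sQ)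
  qed
  moreover have "((\<lambda>i. (cmod (c i))\<^sup>2) has_sum S) I"
  proof -
    have "bdd_above (sum (\<lambda>i. (cmod (c i))\<^sup>2) ` {F. F \<subseteq> I \<and> finite F})"
      using bd by (auto simp: bdd_above_def)
    then show ?thesis
      unfolding S_def Q_def by (intro nonneg_bdd_above_has_sum) auto
  qed
  moreover have "cinner H z (b j) = c j" if j: "j \<in> I" for j
  proof (rule LIMSEQ_unique[OF hconv_cinner[OF z b[OF j]]])
    \<comment> \<open>an index outside all the \<open>F n\<close> has coefficient 0, since the \<open>F n\<close> exhaust the sum\<close>
    have "\<exists>N. j \<in> F N" if "c j \<noteq> 0"
    proof (rule ccontr)
      assume *: "\<nexists>N. j \<in> F N"
      have "0 < (cmod (c j))\<^sup>2" using that by simp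
      then obtain N where N: "1 / Suc N < (cmod (c j))\<^sup>2" by (rule nat_approx_posE)
      have "Q (insert j (F N)) = (cmod (c j))\<^sup>2 + Q (F N)"
        using * F by (simp add: Q_def)
      moreover have "Q (insert j (F N)) \<le> S" using QS F j by blast
      ultimately show False using QF[of N] N by linarith
    qed
    then obtain N where "c j \<noteq> 0 \<Longrightarrow> j \<in> F N" by blast
    then have "cinner H (s n) (b j) = c j" if "n \<ge> N" for n
      using sb[OF j] Fmono[OF that] by auto
    then show "(\<lambda>n. cinner H (s n) (b j)) \<longlonglongrightarrow> c j"
      by (intro tendsto_eventually) (auto simp: eventually_sequentially)
  qed
  moreover have "z \<in> W" if W: "closed_subspace H W" "b ` I \<subseteq> W" for W
  proof -
    have "range s \<subseteq> W"
      using sW W F(2) unfolding closed_subspace_def by blast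
    then show ?thesis
      using W(1) z unfolding closed_subspace_def closedin_iff_hconv by blast
  qed
  ultimately show thesis using that zc by blast
qed

text \<open>The vector of \<open>W\<close> that has the coordinates of \<open>x\<close> is \<open>x\<close>, by totality.\<close>

lemma total_closed_subspace:
  assumes on: "orthonormal H b I" and tot: "total_in H b I"
    and W: "closed_subspace H W" "b ` I \<subseteq> W"
  shows "W = carrier H"
proof
  show "W \<subseteq> carrier H" using W(1) by (auto simp: closed_subspace_def subspace_iff)
  show "carrier H \<subseteq> W"
  proof
    fix x assume x: "x \<in> carrier H"
    obtain z where z: "z \<in> carrier H" "\<forall>i\<in>I. cinner H z (b i) = cinner H x (b i)"
        "\<forall>W. closed_subspace H W \<and> b ` I \<subseteq> W \<longrightarrow> z \<in> W"
        "((\<lambda>i. (cmod (cinner H x (b i)))\<^sup>2) has_sum norm_sq H z) I"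
      by (rule Riesz_Fischer[OF on Bessel[OF on _ _ x]])
    have "z = x" using total_ext[OF tot z(1) x] z(2) by blast
    then show "x \<in> W" using z(3) W by blast
  qed
qed

lemma Parseval_norm:
  assumes on: "orthonormal H b I" and tot: "total_in H b I" and x: "x \<in> carrier H"
  shows "((\<lambda>i. (cmod (cinner H x (b i)))\<^sup>2) has_sum norm_sq H x) I"
proof -
  have bd: "(\<Sum>i\<in>F. (cmod (cinner H x (b i)))\<^sup>2) \<le> norm_sq H x" if "finite F" "F \<subseteq> I" for F
    by (rule Bessel[OF on that x])
  obtain z where z: "z \<in> carrier H" "\<forall>i\<in>I. cinner H z (b i) = cinner H x (b i)"
      "\<forall>W. closed_subspace H W \<and> b ` I \<subseteq> W \<longrightarrow> z \<in> W"
      "((\<lambda>i. (cmod (cinner H x (b i)))\<^sup>2) has_sum norm_sq H z) I"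
    by (rule Riesz_Fischer[OF on bd])
  have "z = x" using total_ext[OF tot z(1) x] z(2) by blast
  then show ?thesis using z(4) by simp
qed

lemma Parseval:
  assumes on: "orthonormal H b I" and tot: "total_in H b I"
    and x: "x \<in> carrier H" and y: "y \<in> carrier H"
  shows "((\<lambda>i. cinner H x (b i) * cnj (cinner H y (b i))) has_sum cinner H x y) I"
proof -
  have b: "b i \<in> carrier H" if "i \<in> I" for i using on that by (auto simp: orthonormal_def)
  define N where "N v i = complex_of_real ((cmod (cinner H v (b i)))\<^sup>2)" for v i
  have N: "(N v has_sum of_real (norm_sq H v)) I" if "v \<in> carrier H" for v
    unfolding N_def by (rule has_sum_of_real[OF Parseval_norm[OF on tot that]])
  have "((\<lambda>i. 1/4 * N (x \<oplus> y) i + - 1/4 * N (x \<ominus> y) i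
        + (\<i>/4 * N (x \<oplus> \<i> \<odot> y) i + - \<i>/4 * N (x \<ominus> \<i> \<odot> y) i))
      has_sum 1/4 * of_real (norm_sq H (x \<oplus> y)) + - 1/4 * of_real (norm_sq H (x \<ominus> y))
        + (\<i>/4 * of_real (norm_sq H (x \<oplus> \<i> \<odot> y)) + - \<i>/4 * of_real (norm_sq H (x \<ominus> \<i> \<odot> y)))) I"
    by (rule has_sum_add[OF has_sum_add[OF has_sum_cmult_right[OF N] has_sum_cmult_right[OF N]]
          has_sum_add[OF has_sum_cmult_right[OF N] has_sum_cmult_right[OF N]]]) (use x y in auto)
  also have "1/4 * of_real (norm_sq H (x \<oplus> y)) + - 1/4 * of_real (norm_sq H (x \<ominus> y))
        + (\<i>/4 * of_real (norm_sq H (x \<oplus> \<i> \<odot> y)) + - \<i>/4 * of_real (norm_sq H (x \<ominus> \<i> \<odot> y)))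
      = cinner H x y"
    using x y by (simp add: norm_sq_add norm_sq_minus norm_sq_smult cinner_smult_right complex_eq_iff) (simp add: field_simps)
  finally show ?thesis
  proof (rule has_sum_cong[THEN iffD1, rotated])
    fix i assume i: "i \<in> I"
    show "1/4 * N (x \<oplus> y) i + - 1/4 * N (x \<ominus> y) i
        + (\<i>/4 * N (x \<oplus> \<i> \<odot> y) i + - \<i>/4 * N (x \<ominus> \<i> \<odot> y) i)
      = cinner H x (b i) * cnj (cinner H y (b i))"
      using x y b[OF i] unfolding complex_polarization[of "cinner H x (b i)" "cinner H y (b i)"]
      by (simp add: N_def cinner_add_left cinner_minus_left cinner_smult_left)
  qed
qed

end

section \<open>Closed subspaces of Hilbert spaces\<close>

context complex_inner_space
begin

text \<open>Completeness in terms of Cauchy sequences for the squared norm, the form in which it is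
  verified for subspaces and for spaces of square summable functions.\<close>

lemma complete_if_Cauchy_convergent:
  assumes "\<And>s. \<lbrakk>\<And>n. s n \<in> carrier H; \<And>\<epsilon>. \<epsilon> > 0 \<Longrightarrow> \<exists>N. \<forall>m\<ge>N. \<forall>n\<ge>N. norm_sq H (s m \<ominus> s n) < \<epsilon>\<rbrakk>
    \<Longrightarrow> \<exists>x. hconv H s x"
  shows "complex_hilbert_space H"
proof (intro complex_hilbert_space.intro complex_hilbert_space_axioms.intro complex_inner_space_axioms)
  interpret MS: Metric_space "carrier H" "hdist H" by (rule Metric_space_hdist)
  show "MS.mcomplete"
    unfolding MS.mcomplete_def
  proof (intro allI impI)
    fix s assume s: "MS.MCauchy s"
    have c: "s n \<in> carrier H" for n using s by (auto simp: MS.MCauchy_def)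
    have "\<exists>x. hconv H s x"
    proof (rule assms[OF c])
      fix e :: real assume e: "e > 0"
      then obtain N where N: "\<And>n n'. \<lbrakk>N \<le> n; N \<le> n'\<rbrakk> \<Longrightarrow> hdist H (s n) (s n') < sqrt e"
        using s unfolding MS.MCauchy_def by (metis real_sqrt_gt_0_iff)
      then show "\<exists>N. \<forall>m\<ge>N. \<forall>n\<ge>N. norm_sq H (s m \<ominus> s n) < e"
        using c by (auto simp: hdist_norm_sq)
    qed
    then show "\<exists>x. limitin MS.mtopology s x sequentially"
      by (auto simp: hconv_iff_limitin htopology_def)
  qed
qed

lemma subspace_inner_space:
  assumes W: "VectorSpace.subspace complex_field W H"
  shows "complex_inner_space (H\<lparr>carrier := W\<rparr>)"
proof -
  have "W \<subseteq> carrier H" using W by (simp add: subspace_iff)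
  then have "complex_inner_space_axioms (H\<lparr>carrier := W\<rparr>)"
    by unfold_locales (auto simp: subset_iff cinner_add_left cinner_smult_left intro: cinner_commute cinner_pos)
  then show ?thesis
    using subspace_is_vs[OF W] by (simp add: complex_inner_space_def)
qed

lemma norm_sq_restrict [simp]: "norm_sq (H\<lparr>carrier := W\<rparr>) = norm_sq H"
  by (simp add: fun_eq_iff norm_sq_def)

text \<open>The subtraction of a restricted space is defined from inverses in the smaller carrier, so
  this is not true by unfolding; but distances can be written without subtraction.\<close>

lemma hdist_subspace:
  assumes W: "VectorSpace.subspace complex_field W H" and x: "x \<in> W" "y \<in> W"
  shows "hdist (H\<lparr>carrier := W\<rparr>) x y = hdist H x y"
proof -
  interpret S: complex_inner_space "H\<lparr>carrier := W\<rparr>" by (rule subspace_inner_space[OF W])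
  have "x \<in> carrier H" "y \<in> carrier H" using W x by (auto simp: subspace_iff)
  then show ?thesis using S.hdist_expand[of x y] hdist_expand[of x y] x by simp
qed

lemma htopology_subspace:
  assumes W: "VectorSpace.subspace complex_field W H"
  shows "htopology (H\<lparr>carrier := W\<rparr>) = subtopology (htopology H) W"
proof -
  interpret S: complex_inner_space "H\<lparr>carrier := W\<rparr>" by (rule subspace_inner_space[OF W])
  have "W \<subseteq> carrier H" using W by (simp add: subspace_iff)
  then interpret M: Submetric "carrier H" "hdist H" W
    using Metric_space_hdist by (simp add: Submetric_def Submetric_axioms_def)
  have "homeomorphic_map M.sub.mtopology (htopology (H\<lparr>carrier := W\<rparr>)) id"
    using isometry_homeomorphic_map[OF M.sub.Metric_space_axioms S.Metric_space_hdist, of id]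
    by (simp add: hdist_subspace[OF W] htopology_def)
  then show ?thesis
    by (simp add: M.mtopology_submetric htopology_def)
qed

lemma hconv_subspace:
  assumes W: "VectorSpace.subspace complex_field W H" and "range s \<subseteq> W" "x \<in> W"
  shows "hconv (H\<lparr>carrier := W\<rparr>) s x \<longleftrightarrow> hconv H s x"
proof -
  have "hdist (H\<lparr>carrier := W\<rparr>) (s n) x = hdist H (s n) x" for n
    using hdist_subspace[OF W] assms(2,3) by blast
  then show ?thesis using assms W by (auto simp: hconv_def subspace_iff)
qed

lemma minus_subspace:
  assumes W: "VectorSpace.subspace complex_field W H" and x: "x \<in> W" "y \<in> W"
  shows "x \<ominus>\<^bsub>H\<lparr>carrier := W\<rparr>\<^esub> y = x \<ominus> y"
proof -
  interpret S: complex_inner_space "H\<lparr>carrier := W\<rparr>" by (rule subspace_inner_space[OF W])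
  have "x \<in> carrier H" "y \<in> carrier H" using W x by (auto simp: subspace_iff)
  then show ?thesis using S.minus_smult[of x y] minus_smult[of x y] x by simp
qed

lemma closed_subspace_subspace:
  assumes W: "closed_subspace H W"
  shows "closed_subspace (H\<lparr>carrier := W\<rparr>) V \<longleftrightarrow> closed_subspace H V \<and> V \<subseteq> W"
proof -
  have W': "VectorSpace.subspace complex_field W H" and cl: "closedin (htopology H) W"
    using W by (auto simp: closed_subspace_def)
  interpret S: complex_inner_space "H\<lparr>carrier := W\<rparr>" by (rule subspace_inner_space[OF W'])
  show ?thesis
    using W' unfolding closed_subspace_def htopology_subspace[OF W'] S.subspace_iff subspace_iff
      closedin_closed_subtopology[OF cl]
    by auto
qed

lemma closed_subspace_carrier: "closed_subspace H W \<Longrightarrow> W \<subseteq> carrier H"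
  by (simp add: closed_subspace_def subspace_iff)

text \<open>Every vector agrees with the finite sum that has its coordinates.\<close>

lemma fin_dim_if_finite_total:
  assumes on: "orthonormal H (\<lambda>x. x) F" and F: "finite F" and tot: "total_in H (\<lambda>x. x) F"
  shows "fin_dim"
proof -
  have Fc: "F \<subseteq> carrier H" using on by (auto simp: orthonormal_def)
  have sub: "VectorSpace.subspace complex_field (span F) H"
    using span_is_submodule[OF Fc] vectorspace_axioms by (simp add: VectorSpace.subspace_def)
  have "carrier H \<subseteq> span F"
  proof
    fix x assume x: "x \<in> carrier H"
    obtain z where z: "z \<in> carrier H"
      "\<forall>W. VectorSpace.subspace complex_field W H \<and> (\<lambda>x. x) ` F \<subseteq> W \<longrightarrow> z \<in> W"
      "\<forall>j\<in>F. cinner H z j = (if j \<in> F then cinner H x j else 0)"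
      using orthonormal_vsum_exists[OF on F subset_refl, of "\<lambda>i. cinner H x i"] by blast
    have "z = x" by (rule total_ext[OF tot z(1) x]) (use z(3) in auto)
    then show "x \<in> span F" using z(2) sub in_own_span[OF Fc] by auto
  qed
  then have "gen_set F" using sub by (auto simp: subspace_iff)
  then show ?thesis unfolding fin_dim_def using F Fc by blast
qed

end

context complex_hilbert_space
begin

lemma subspace_hilbert_space:
  assumes W: "closed_subspace H W"
  shows "complex_hilbert_space (H\<lparr>carrier := W\<rparr>)"
proof -
  have W': "VectorSpace.subspace complex_field W H" and cl: "closedin (htopology H) W"
    using W by (auto simp: closed_subspace_def)
  interpret S: complex_inner_space "H\<lparr>carrier := W\<rparr>" by (rule subspace_inner_space[OF W'])
  show ?thesis
  proof (rule S.complete_if_Cauchy_convergent)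
    fix s :: "nat \<Rightarrow> 'a"
    assume s: "\<And>n. s n \<in> carrier (H\<lparr>carrier := W\<rparr>)"
      and C: "\<And>e. e > 0 \<Longrightarrow> \<exists>N. \<forall>m\<ge>N. \<forall>n\<ge>N.
        norm_sq (H\<lparr>carrier := W\<rparr>) (s m \<ominus>\<^bsub>H\<lparr>carrier := W\<rparr>\<^esub> s n) < e"
    have sW: "s n \<in> W" for n using s by simp
    then have sH: "s n \<in> carrier H" for n using W' by (auto simp: subspace_iff)
    have C': "\<exists>N. \<forall>m\<ge>N. \<forall>n\<ge>N. norm_sq H (s m \<ominus> s n) < e" if "e > 0" for e
      using C[OF that] by (simp add: minus_subspace[OF W' sW sW])
    obtain x where x: "hconv H s x" using hilbert_convergent[OF sH C'] by blast
    then have "x \<in> W" using cl sW unfolding closedin_iff_hconv by blast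
    then show "\<exists>x. hconv (H\<lparr>carrier := W\<rparr>) s x"
      using x hconv_subspace[OF W'] sW by blast
  qed
qed

text \<open>The projection has the same coordinates as \<open>x\<close> with respect to an orthonormal basis of \<open>W\<close>.\<close>

theorem orthogonal_projection:
  assumes W: "closed_subspace H W" and x: "x \<in> carrier H"
  obtains z where "z \<in> W" "\<forall>w\<in>W. cinner H w (x \<ominus> z) = 0"
proof -
  interpret S: complex_hilbert_space "H\<lparr>carrier := W\<rparr>" by (rule subspace_hilbert_space[OF W])
  have WH: "W \<subseteq> carrier H" by (rule closed_subspace_carrier[OF W])
  obtain B where B: "orthonormal (H\<lparr>carrier := W\<rparr>) (\<lambda>x. x) B" "total_in (H\<lparr>carrier := W\<rparr>) (\<lambda>x. x) B"
    by (rule S.orthonormal_basis_exists)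
  have on: "orthonormal H (\<lambda>x. x) B" using B(1) WH by (auto simp: orthonormal_def)
  have bd: "(\<Sum>i\<in>F. (cmod (cinner H x i))\<^sup>2) \<le> norm_sq H x" if "finite F" "F \<subseteq> B" for F
    by (rule Bessel[OF on that x])
  obtain z where z: "z \<in> carrier (H\<lparr>carrier := W\<rparr>)" "\<forall>i\<in>B. cinner (H\<lparr>carrier := W\<rparr>) z i = cinner H x i"
      "\<forall>V. closed_subspace (H\<lparr>carrier := W\<rparr>) V \<and> (\<lambda>x. x) ` B \<subseteq> V \<longrightarrow> z \<in> V"
      "((\<lambda>i. (cmod (cinner H x i))\<^sup>2) has_sum norm_sq (H\<lparr>carrier := W\<rparr>) z) B"
    by (rule S.Riesz_Fischer[OF B(1) bd])
  have zW: "z \<in> W" and zH: "z \<in> carrier H" using z(1) WH by auto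
  define u where "u = x \<ominus> z"
  have u: "u \<in> carrier H" using x zH by (simp add: u_def)
  have cs: "closed_subspace (H\<lparr>carrier := W\<rparr>) {w \<in> carrier (H\<lparr>carrier := W\<rparr>). cinner H w u = 0}"
  proof (rule S.closed_subspace_zero_set[where g = id and B = "norm_sq H u"])
    show "(cmod (cinner H w u))\<^sup>2 \<le> norm_sq H u * norm_sq (H\<lparr>carrier := W\<rparr>) w" if "w \<in> carrier (H\<lparr>carrier := W\<rparr>)" for w
      using Cauchy_Schwarz_sq[of w u] that WH u by (auto simp: mult.commute)
  qed (use WH u in \<open>auto simp: cinner_add_left cinner_smult_left subset_iff\<close>)
  have "cinner H b u = 0" if b: "b \<in> B" for b
  proof -
    have bH: "b \<in> carrier H" using on b by (auto simp: orthonormal_def)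
    have "cinner H u b = 0" using z(2) b bH x zH by (simp add: u_def cinner_minus_left)
    then show ?thesis using cinner_commute[OF u bH] by simp
  qed
  then have "(\<lambda>x. x) ` B \<subseteq> {w \<in> carrier (H\<lparr>carrier := W\<rparr>). cinner H w u = 0}"
    using B(1) by (auto simp: orthonormal_def)
  then have "{w \<in> carrier (H\<lparr>carrier := W\<rparr>). cinner H w u = 0} = carrier (H\<lparr>carrier := W\<rparr>)"
    by (rule S.total_closed_subspace[OF B cs])
  then show thesis using that[OF zW] unfolding u_def by auto
qed

end

text \<open>A vector \<open>z\<close> orthogonal to the kernel of \<open>f\<close> but outside it spans the orthogonal complement
  of the kernel, and a suitable multiple of it represents \<open>f\<close>. As the inner product is linear
  in its first argument, \<open>f\<close> has to be antilinear.\<close>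

lemma (in complex_hilbert_space) Riesz_representation:
  assumes add: "\<And>x y. \<lbrakk>x \<in> carrier H; y \<in> carrier H\<rbrakk> \<Longrightarrow> f (x \<oplus> y) = f x + f y"
    and smult: "\<And>c x. x \<in> carrier H \<Longrightarrow> f (c \<odot> x) = cnj c * f x"
    and bd: "\<And>x. x \<in> carrier H \<Longrightarrow> (cmod (f x))\<^sup>2 \<le> B * norm_sq H x"
  shows "\<exists>u\<in>carrier H. \<forall>y\<in>carrier H. cinner H u y = f y"
proof (cases "\<forall>y\<in>carrier H. f y = 0")
  case True
  then show ?thesis by (intro bexI[of _ \<zero>]) auto
next
  case False
  then obtain x where x: "x \<in> carrier H" "f x \<noteq> 0" by blast
  have N: "closed_subspace H {y \<in> carrier H. f y = 0}"
    by (rule closed_subspace_zero_set[OF add smult bd])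
  obtain p where p: "p \<in> carrier H" "f p = 0" and perp: "\<forall>w\<in>{y \<in> carrier H. f y = 0}. cinner H w (x \<ominus> p) = 0"
    using orthogonal_projection[OF N x(1)] by blast
  define z where "z = x \<ominus> p"
  have z: "z \<in> carrier H" using x p by (simp add: z_def)
  have fm: "f (a \<ominus> b) = f a - f b" if "a \<in> carrier H" "b \<in> carrier H" for a b
    using that by (simp add: minus_smult add smult)
  have fz: "f z \<noteq> 0" using x p by (simp add: z_def fm)
  then have "z \<noteq> \<zero>" using smult[of \<zero> 0] smult_r_null[of 0] by auto
  then have sz: "norm_sq H z \<noteq> 0" using z by (simp add: norm_sq_eq_0)
  have "cinner H ((f z / of_real (norm_sq H z)) \<odot> z) y = f y" if y: "y \<in> carrier H" for y
  proof -
    define c where "c = cnj (f y / f z)"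
    have "f (y \<ominus> c \<odot> z) = 0" using y z fz by (simp add: fm smult c_def)
    then have "cinner H (y \<ominus> c \<odot> z) z = 0" using perp y z unfolding z_def[symmetric] by simp
    then have "cinner H y z = c * of_real (norm_sq H z)"
      using y z by (simp add: cinner_minus_left cinner_smult_left cinner_self_norm_sq)
    then have "cinner H z y = f y / f z * of_real (norm_sq H z)"
      using cinner_commute[OF y z] by (simp add: c_def)
    then show ?thesis using y z fz sz by (simp add: cinner_smult_left)
  qed
  then show ?thesis using z by (intro bexI[of _ "(f z / of_real (norm_sq H z)) \<odot> z"]) auto
qed

section \<open>The top eigenspace of a positive trace class operator\<close>

text \<open>The form \<open>q x = \<langle>B x, x\<rangle>\<close> of a positive operator \<open>B\<close> of trace at most \<open>C\<close>. For the largest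
  eigenvalue and its eigenspace only the form is needed, so \<open>B\<close> is not mentioned; the
  parallelogram law takes the place of sesquilinearity.\<close>

locale trace_class_quadratic_form = complex_hilbert_space +
  fixes q :: "'a \<Rightarrow> real" and C :: real
  assumes q_nonneg: "x \<in> carrier H \<Longrightarrow> 0 \<le> q x"
    and q_parallelogram: "\<lbrakk>x \<in> carrier H; y \<in> carrier H\<rbrakk>
      \<Longrightarrow> q (x \<oplus> y) + q (x \<ominus> y) = 2 * q x + 2 * q y"
    and q_smult: "x \<in> carrier H \<Longrightarrow> q (c \<odot> x) = (cmod c)\<^sup>2 * q x"
    and q_trace: "\<lbrakk>finite F; orthonormal H (\<lambda>x. x) F\<rbrakk> \<Longrightarrow> (\<Sum>e\<in>F. q e) \<le> C"
begin

definition top_value :: real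
  where "top_value = (SUP x\<in>{x \<in> carrier H. norm_sq H x = 1}. q x)"

text \<open>The form of the positive operator \<open>top_value - B\<close>; its kernel is the eigenspace of the
  largest eigenvalue.\<close>

definition gap :: "'a \<Rightarrow> real"
  where "gap x = top_value * norm_sq H x - q x"

definition top_space :: "'a set"
  where "top_space = {x \<in> carrier H. gap x = 0}"

lemma orthonormal_singleton: "\<lbrakk>x \<in> carrier H; norm_sq H x = 1\<rbrakk> \<Longrightarrow> orthonormal H (\<lambda>x. x) {x}"
  by (simp add: orthonormal_def cinner_self_norm_sq)

lemma q_le_top_value: "\<lbrakk>x \<in> carrier H; norm_sq H x = 1\<rbrakk> \<Longrightarrow> q x \<le> top_value"
  unfolding top_value_def
proof (rule cSUP_upper)
  show "bdd_above (q ` {x \<in> carrier H. norm_sq H x = 1})"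
    using q_trace[OF _ orthonormal_singleton] by (auto simp: bdd_above_def)
qed auto

lemma q_zero [simp]: "q \<zero> = 0"
  using q_smult[of \<zero> 0] smult_r_null[of 0] by simp

lemma normalize:
  assumes "x \<in> carrier H" "x \<noteq> \<zero>"
  shows "\<exists>u\<in>carrier H. norm_sq H u = 1 \<and> x = of_real (sqrt (norm_sq H x)) \<odot> u"
proof -
  have s: "norm_sq H x > 0" using assms norm_sq_eq_0[of x] norm_sq_nonneg[of x] by linarith
  define r where "r = sqrt (norm_sq H x)"
  have r: "r > 0" "r\<^sup>2 = norm_sq H x" using s by (auto simp: r_def)
  define u where "u = of_real (1 / r) \<odot> x"
  have "u \<in> carrier H" using assms by (simp add: u_def)
  moreover have "norm_sq H u = 1" using r(1) assms(1) by (simp add: u_def norm_sq_smult norm_divide power_divide r(2)[symmetric])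
  moreover have "x = of_real r \<odot> u"
    using r assms by (intro cinner_ext) (auto simp: u_def cinner_smult_left)
  ultimately show ?thesis unfolding r_def by blast
qed

lemma gap_nonneg: "x \<in> carrier H \<Longrightarrow> 0 \<le> gap x"
proof (cases "x = \<zero>")
  case False
  assume x: "x \<in> carrier H"
  then obtain u where u: "u \<in> carrier H" "norm_sq H u = 1" "x = of_real (sqrt (norm_sq H x)) \<odot> u"
    using normalize False by blast
  have "q x = norm_sq H x * q u"
    using q_smult[OF u(1), of "of_real (sqrt (norm_sq H x))"] u(3)[symmetric] x by simp
  also have "\<dots> \<le> norm_sq H x * top_value" using q_le_top_value[OF u(1,2)] x by (intro mult_left_mono) auto
  finally show ?thesis by (simp add: gap_def mult.commute)
qed (simp add: gap_def)

lemma gap_parallelogram: "\<lbrakk>x \<in> carrier H; y \<in> carrier H\<rbrakk>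
    \<Longrightarrow> gap (x \<oplus> y) + gap (x \<ominus> y) = 2 * gap x + 2 * gap y"
proof -
  assume xy: "x \<in> carrier H" "y \<in> carrier H"
  have "gap (x \<oplus> y) + gap (x \<ominus> y)
      = top_value * (norm_sq H (x \<oplus> y) + norm_sq H (x \<ominus> y)) - (q (x \<oplus> y) + q (x \<ominus> y))"
    by (simp add: gap_def algebra_simps)
  then show ?thesis
    unfolding parallelogram[OF xy] q_parallelogram[OF xy] by (simp add: gap_def algebra_simps)
qed

lemma gap_add_le: "\<lbrakk>x \<in> carrier H; y \<in> carrier H\<rbrakk> \<Longrightarrow> gap (x \<oplus> y) \<le> 2 * gap x + 2 * gap y"
  using gap_parallelogram[of x y] gap_nonneg[of "x \<ominus> y"] by simp

lemma gap_minus_le: "\<lbrakk>x \<in> carrier H; y \<in> carrier H\<rbrakk> \<Longrightarrow> gap (x \<ominus> y) \<le> 2 * gap x + 2 * gap y"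
  using gap_parallelogram[of x y] gap_nonneg[of "x \<oplus> y"] by simp

lemma gap_smult: "x \<in> carrier H \<Longrightarrow> gap (c \<odot> x) = (cmod c)\<^sup>2 * gap x"
  by (simp add: gap_def norm_sq_smult q_smult algebra_simps)

lemma gap_le: "x \<in> carrier H \<Longrightarrow> gap x \<le> top_value * norm_sq H x"
  using q_nonneg by (simp add: gap_def)

text \<open>The square root of \<open>gap\<close> is a continuous seminorm.\<close>

lemma gap_limit:
  assumes s: "hconv H s x" and g: "(\<lambda>n. gap (s n)) \<longlonglongrightarrow> 0"
  shows "gap x = 0"
proof -
  have sc: "s n \<in> carrier H" for n using s by (auto simp: hconv_def)
  have x: "x \<in> carrier H" using s by (simp add: hconv_def)
  have "(\<lambda>n. 2 * gap (s n) + 2 * (top_value * norm_sq H (s n \<ominus> x))) \<longlonglongrightarrow> 2 * 0 + 2 * (top_value * 0)"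
    by (intro tendsto_intros g hconv_norm_sq_minus s)
  moreover have "gap x \<le> 2 * gap (s n) + 2 * (top_value * norm_sq H (s n \<ominus> x))" for n
  proof -
    have "x = s n \<ominus> (s n \<ominus> x)"
      by (rule cinner_ext) (use sc x in \<open>auto simp: cinner_minus_left\<close>)
    then have "gap x \<le> 2 * gap (s n) + 2 * gap (s n \<ominus> x)"
      using gap_minus_le[of "s n" "s n \<ominus> x"] sc x by simp
    then show ?thesis using gap_le[of "s n \<ominus> x"] sc x by simp
  qed
  ultimately have "gap x \<le> 2 * 0 + 2 * (top_value * 0)"
    by (intro LIMSEQ_le_const[where X = "\<lambda>n. 2 * gap (s n) + 2 * (top_value * norm_sq H (s n \<ominus> x))"]) auto
  then show ?thesis using gap_nonneg[OF x] by simp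
qed

lemma closed_subspace_top_space: "closed_subspace H top_space"
  unfolding closed_subspace_def subspace_iff closedin_iff_hconv
proof (intro conjI ballI allI impI)
  show "\<zero> \<in> top_space" by (simp add: top_space_def gap_def)
  show "x \<oplus> y \<in> top_space" if "x \<in> top_space" "y \<in> top_space" for x y
    using gap_add_le[of x y] gap_nonneg[of "x \<oplus> y"] that by (simp add: top_space_def)
  show "c \<odot> x \<in> top_space" if "x \<in> top_space" for c x
    using that by (simp add: top_space_def gap_smult)
  fix s x assume *: "range s \<subseteq> top_space \<and> hconv H s x"
  then have "gap (s n) = 0" for n by (auto simp: top_space_def)
  then show "x \<in> top_space" using gap_limit[of s x] * by (simp add: top_space_def hconv_def)
qed (auto simp: top_space_def)

text \<open>If the supremum \<open>top_value\<close> is not attained, then it stays the supremum after passing to the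
  orthogonal complement of a unit vector \<open>e\<close>. Otherwise \<open>gap\<close> would be bounded below by
  \<open>\<epsilon> * norm_sq\<close> on this complement. Take a maximising sequence. A subsequence has convergent
  components along \<open>e\<close>; the seminorm \<open>sqrt gap\<close> tends to 0 along it, so by the lower bound the
  components orthogonal to \<open>e\<close> form a Cauchy sequence as well. The limit would be a unit vector
  at which the supremum is attained.\<close>

lemma near_maximizer_orthogonal_to:
  assumes none: "top_space = {\<zero>}" and F: "F \<subseteq> carrier H"
    and near: "\<And>\<epsilon>. \<epsilon> > 0 \<Longrightarrow> \<exists>x\<in>carrier H. (\<forall>f\<in>F. cinner H x f = 0) \<and> norm_sq H x = 1 \<and> gap x < \<epsilon>"
    and e: "e \<in> carrier H" "norm_sq H e = 1" "\<And>f. f \<in> F \<Longrightarrow> cinner H e f = 0"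
    and \<epsilon>: "\<epsilon> > 0"
  shows "\<exists>x\<in>carrier H. (\<forall>f\<in>insert e F. cinner H x f = 0) \<and> norm_sq H x = 1 \<and> gap x < \<epsilon>"
proof (rule ccontr)
  assume neg: "\<not> ?thesis"
  \<comment> \<open>the negated claim, extended from unit vectors by homogeneity\<close>
  have coercive: "\<epsilon> * norm_sq H x \<le> gap x" if x: "x \<in> carrier H" "\<forall>f\<in>insert e F. cinner H x f = 0" for x
  proof (cases "x = \<zero>")
    case False
    then obtain u where u: "u \<in> carrier H" "norm_sq H u = 1" "x = of_real (sqrt (norm_sq H x)) \<odot> u"
      using normalize x by blast
    have s: "norm_sq H x \<noteq> 0" using False x(1) by (simp add: norm_sq_eq_0)
    have fc: "f \<in> carrier H" if "f \<in> insert e F" for f using that e(1) F by auto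
    have "of_real (sqrt (norm_sq H x)) * cinner H u f = cinner H x f" if "f \<in> insert e F" for f
      using cinner_smult_left[OF u(1) fc[OF that]] u(3) by metis
    then have "\<forall>f\<in>insert e F. cinner H u f = 0" using x(2) s by (auto simp del: of_real_mult)
    then have "gap u \<ge> \<epsilon>" using neg u(1,2) by (meson not_le)
    moreover have "gap x = norm_sq H x * gap u"
      using gap_smult[OF u(1), of "of_real (sqrt (norm_sq H x))"] u(3)[symmetric] x by simp
    ultimately show ?thesis using x(1) mult_left_mono[of \<epsilon> "gap u" "norm_sq H x"] by (simp add: mult.commute)
  qed (simp add: gap_def)
  have "\<exists>x\<in>carrier H. (\<forall>f\<in>F. cinner H x f = 0) \<and> norm_sq H x = 1 \<and> gap x < 1 / Suc n" for n
    by (rule near) simp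
  then obtain x where x: "\<And>n. x n \<in> carrier H" "\<And>n. \<forall>f\<in>F. cinner H (x n) f = 0"
      "\<And>n. norm_sq H (x n) = 1" "\<And>n. gap (x n) < 1 / Suc n"
    by metis
  define a where "a n = cinner H (x n) e" for n
  have "cmod (a n) \<le> 1" for n
    using Cauchy_Schwarz_sq[OF x(1) e(1), of n] x(3) e(2) by (simp add: a_def power_le_one_iff)
  then have "\<forall>n. a n \<in> cball 0 1" by simp
  then obtain l r where r: "strict_mono r" "(a \<circ> r) \<longlonglongrightarrow> l"
    using compact_cball[of "0::complex" 1] unfolding compact_def by metis
  define y where "y n = x (r n)" for n
  have y: "y n \<in> carrier H" "\<forall>f\<in>F. cinner H (y n) f = 0" "norm_sq H (y n) = 1" "gap (y n) < 1 / Suc n" for n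
  proof -
    have "n \<le> r n" using r(1) by (rule seq_suble)
    then have "1 / real (Suc (r n)) \<le> 1 / Suc n" by (simp add: field_simps)
    then show "gap (y n) < 1 / Suc n" using x(4)[of "r n"] by (simp add: y_def)
  qed (use x in \<open>auto simp: y_def\<close>)
  have Ca: "Cauchy (\<lambda>n. cinner H (y n) e)"
    using LIMSEQ_imp_Cauchy[OF r(2)] by (simp add: o_def a_def y_def)
  \<comment> \<open>\<open>M\<close> collects the contributions of the component along \<open>e\<close>: \<open>2 * top_value / \<epsilon>\<close> through
    \<open>gap\<close>, and 1 through its own norm\<close>
  define M where "M = 2 * top_value / \<epsilon> + 1"
  have top0: "0 \<le> top_value" using q_le_top_value[OF e(1,2)] q_nonneg[OF e(1)] by simp
  have M: "M > 0" using top0 \<epsilon> by (simp add: M_def add_nonneg_pos)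
  have est: "norm_sq H (y m \<ominus> y n) \<le> 2 / \<epsilon> * gap (y m \<ominus> y n) + M * (cmod (cinner H (y m) e - cinner H (y n) e))\<^sup>2" for m n
  proof -
    define d where "d = y m \<ominus> y n"
    define c where "c = cinner H d e"
    have d: "d \<in> carrier H" using y by (simp add: d_def)
    have c: "c = cinner H (y m) e - cinner H (y n) e" using y e(1) by (simp add: c_def d_def cinner_minus_left)
    define u where "u = d \<ominus> c \<odot> e"
    have u: "u \<in> carrier H" using d e(1) by (simp add: u_def)
    have "cinner H u f = 0" if "f \<in> insert e F" for f
    proof (cases "f = e")
      case True
      then show ?thesis using d e(1,2)
        by (simp add: u_def c_def cinner_minus_left cinner_smult_left cinner_self_norm_sq)
    next
      case False
      then have f: "f \<in> F" "f \<in> carrier H" using that F by auto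
      then show ?thesis using d e y
        by (simp add: u_def d_def cinner_minus_left cinner_smult_left)
    qed
    then have "\<epsilon> * norm_sq H u \<le> gap u" using coercive u by blast
    also have "gap u \<le> 2 * gap d + 2 * gap (c \<odot> e)"
      unfolding u_def using gap_minus_le[of d "c \<odot> e"] d e(1) by simp
    also have "gap (c \<odot> e) \<le> top_value * (cmod c)\<^sup>2"
      using gap_le[of "c \<odot> e"] e(1,2) by (simp add: norm_sq_smult)
    finally have "\<epsilon> * norm_sq H u \<le> 2 * gap d + 2 * (top_value * (cmod c)\<^sup>2)" by simp
    then have "norm_sq H u \<le> 2 / \<epsilon> * gap d + 2 * top_value / \<epsilon> * (cmod c)\<^sup>2"
      using \<epsilon> by (simp add: field_simps)
    moreover have "norm_sq H u = norm_sq H d - (cmod c)\<^sup>2"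
    proof -
      have "cinner H d (c \<odot> e) = of_real ((cmod c)\<^sup>2)"
        using d e(1) by (simp add: cinner_smult_right complex_norm_square mult.commute flip: c_def del: of_real_power)
      then show ?thesis using d e(1,2) by (simp add: u_def norm_sq_minus norm_sq_smult)
    qed
    ultimately have "norm_sq H d \<le> 2 / \<epsilon> * gap d + M * (cmod c)\<^sup>2"
      by (simp add: M_def algebra_simps)
    then show ?thesis by (simp add: d_def c)
  qed
  obtain z where z: "hconv H y z"
  proof (rule hilbert_convergent[OF y(1)])
    fix \<delta> :: real assume \<delta>: "\<delta> > 0"
    define \<eta> where "\<eta> = sqrt (\<delta> / (2 * M))"
    have \<eta>: "\<eta> > 0" "M * \<eta>\<^sup>2 = \<delta> / 2" using \<delta> M by (simp_all add: \<eta>_def)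
    obtain N1 where N1: "\<forall>m\<ge>N1. \<forall>n\<ge>N1. cmod (cinner H (y m) e - cinner H (y n) e) < \<eta>"
      using CauchyD[OF Ca \<eta>(1)] by blast
    have "0 < \<delta> * \<epsilon> / 16" using \<delta> \<epsilon> by simp
    then obtain N2 where N2: "1 / real (Suc N2) < \<delta> * \<epsilon> / 16" by (rule nat_approx_posE)
    have "norm_sq H (y m \<ominus> y n) < \<delta>" if mn: "m \<ge> max N1 N2" "n \<ge> max N1 N2" for m n
    proof -
      have g: "gap (y k) < \<delta> * \<epsilon> / 16" if "k \<ge> N2" for k
      proof -
        have "1 / real (Suc k) \<le> 1 / Suc N2" using that by (simp add: field_simps)
        then show ?thesis using y(4)[of k] N2 by linarith
      qed
      have "gap (y m \<ominus> y n) \<le> 2 * gap (y m) + 2 * gap (y n)" by (rule gap_minus_le) (use y in auto)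
      also have "\<dots> < \<delta> * \<epsilon> / 4" using g[of m] g[of n] mn by simp
      finally have "2 / \<epsilon> * gap (y m \<ominus> y n) < \<delta> / 2" using \<epsilon> by (simp add: field_simps)
      moreover have "M * (cmod (cinner H (y m) e - cinner H (y n) e))\<^sup>2 \<le> M * \<eta>\<^sup>2"
        using N1 mn M by (intro mult_left_mono power_mono) (auto intro: less_imp_le)
      ultimately show ?thesis using est[of m n] \<eta>(2) by linarith
    qed
    then show "\<exists>N. \<forall>m\<ge>N. \<forall>n\<ge>N. norm_sq H (y m \<ominus> y n) < \<delta>" by blast
  qed
  have zc: "z \<in> carrier H" using z by (simp add: hconv_def)
  have "(\<lambda>n. gap (y n)) \<longlonglongrightarrow> 0"
  proof (rule tendsto_sandwich[of "\<lambda>n. 0" _ _ "\<lambda>n. 1 / Suc n"])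
    show "(\<lambda>n. 1 / real (Suc n)) \<longlonglongrightarrow> 0" using LIMSEQ_Suc[OF lim_1_over_n] .
  qed (use y gap_nonneg in \<open>auto intro!: always_eventually less_imp_le simp del: of_nat_Suc\<close>)
  then have "gap z = 0" by (rule gap_limit[OF z])
  then have "z = \<zero>" using none zc unfolding top_space_def by blast
  moreover have "norm_sq H z = 1"
    using hconv_norm_sq[OF z] by (simp add: y(3) LIMSEQ_const_iff)
  ultimately show False by simp
qed

text \<open>If the supremum were not attained, iterating the preceding lemma would give arbitrarily many
  orthonormal vectors \<open>e\<close> with \<open>q e \<ge> top_value / 2\<close>, against the bound on the trace.\<close>

theorem top_value_attained:
  assumes x0: "x0 \<in> carrier H" "q x0 > 0"
  shows "top_value > 0" "top_space \<noteq> {\<zero>}"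
proof -
  have "x0 \<noteq> \<zero>" using x0 by auto
  then have s0: "norm_sq H x0 > 0" using norm_sq_eq_0[OF x0(1)] norm_sq_nonneg[OF x0(1)] by linarith
  have "0 < top_value * norm_sq H x0" using gap_nonneg[OF x0(1)] x0(2) by (simp add: gap_def)
  then show top: "top_value > 0" using s0 by (simp add: zero_less_mult_iff)
  show "top_space \<noteq> {\<zero>}"
  proof
    assume none: "top_space = {\<zero>}"
    have "\<exists>F. finite F \<and> card F = n \<and> orthonormal H (\<lambda>x. x) F \<and> (\<forall>e\<in>F. top_value / 2 \<le> q e) \<and>
        (\<forall>\<epsilon>>0. \<exists>x\<in>carrier H. (\<forall>f\<in>F. cinner H x f = 0) \<and> norm_sq H x = 1 \<and> gap x < \<epsilon>)" for n
    proof (induction n)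
      case 0
      have "\<exists>x\<in>carrier H. norm_sq H x = 1 \<and> gap x < \<epsilon>" if "\<epsilon> > 0" for \<epsilon>
      proof -
        obtain u where "u \<in> carrier H" "norm_sq H u = 1"
          using normalize x0(1) \<open>x0 \<noteq> \<zero>\<close> by blast
        then have ne: "{x \<in> carrier H. norm_sq H x = 1} \<noteq> {}" by blast
        have "\<exists>y\<in>q ` {x \<in> carrier H. norm_sq H x = 1}. top_value - \<epsilon> < y"
          unfolding top_value_def by (rule less_cSupD) (use ne that in auto)
        then show ?thesis by (force simp: gap_def)
      qed
      then show ?case by (intro exI[of _ "{}"]) (auto simp: orthonormal_def)
    next
      case (Suc n)
      then obtain F where F: "finite F" "card F = n" "orthonormal H (\<lambda>x. x) F" "\<forall>e\<in>F. top_value / 2 \<le> q e"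
        and near: "\<And>\<epsilon>. \<epsilon> > 0 \<Longrightarrow> \<exists>x\<in>carrier H. (\<forall>f\<in>F. cinner H x f = 0) \<and> norm_sq H x = 1 \<and> gap x < \<epsilon>"
        by blast
      have Fc: "F \<subseteq> carrier H" using F(3) by (auto simp: orthonormal_def)
      obtain e where e: "e \<in> carrier H" "\<forall>f\<in>F. cinner H e f = 0" "norm_sq H e = 1" "gap e < top_value / 2"
        using near[of "top_value / 2"] top by auto
      have qe: "top_value / 2 \<le> q e" using e(3,4) by (simp add: gap_def)
      have eF: "e \<notin> F" using e by (auto simp: cinner_self_norm_sq)
      have "cinner H f e = 0" if "f \<in> F" for f
        using cinner_commute[of e f] e that Fc by auto
      then have "orthonormal H (\<lambda>x. x) (insert e F)"
        using F(3) e eF by (auto simp: orthonormal_def cinner_self_norm_sq)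
      moreover have "\<forall>\<epsilon>>0. \<exists>x\<in>carrier H. (\<forall>f\<in>insert e F. cinner H x f = 0) \<and> norm_sq H x = 1 \<and> gap x < \<epsilon>"
        using near_maximizer_orthogonal_to[OF none Fc near e(1,3)] e(2) by blast
      ultimately show ?case
        using F(1,2,4) eF qe by (intro exI[of _ "insert e F"]) auto
    qed
    moreover obtain n where n: "C < real n * (top_value / 2)"
      using reals_Archimedean3[of "top_value / 2"] top by auto
    ultimately obtain F where F: "finite F" "card F = n" "orthonormal H (\<lambda>x. x) F" "\<forall>e\<in>F. top_value / 2 \<le> q e"
      by blast
    have "real n * (top_value / 2) \<le> (\<Sum>e\<in>F. q e)"
      using sum_bounded_below[of F "top_value / 2" q] F by simp
    then show False using q_trace[OF F(1,3)] n by simp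
  qed
qed

text \<open>On an orthonormal basis of the eigenspace \<open>q\<close> is constant and positive, so the bound on the
  trace limits the number of its members.\<close>

theorem top_space_fin_dim:
  assumes "top_value > 0"
  shows "vectorspace.fin_dim complex_field (H\<lparr>carrier := top_space\<rparr>)"
proof -
  interpret S: complex_hilbert_space "H\<lparr>carrier := top_space\<rparr>"
    by (rule subspace_hilbert_space[OF closed_subspace_top_space])
  obtain B where B: "orthonormal (H\<lparr>carrier := top_space\<rparr>) (\<lambda>x. x) B"
      "total_in (H\<lparr>carrier := top_space\<rparr>) (\<lambda>x. x) B"
    by (rule S.orthonormal_basis_exists)
  have BH: "orthonormal H (\<lambda>x. x) B" and Bt: "B \<subseteq> top_space"
    using B(1) by (auto simp: orthonormal_def top_space_def)
  have bound: "real (card F) * top_value \<le> C" if F: "finite F" "F \<subseteq> B" for F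
  proof -
    have FH: "orthonormal H (\<lambda>x. x) F" using BH F(2) by (auto simp: orthonormal_def subset_iff)
    have "q e = top_value" if "e \<in> F" for e
    proof -
      have "e \<in> top_space" "cinner H e e = 1" using that F(2) Bt BH by (auto simp: orthonormal_def)
      then show ?thesis by (simp add: top_space_def gap_def norm_sq_def)
    qed
    then show ?thesis using q_trace[OF F(1) FH] by simp
  qed
  have "finite B"
  proof (rule ccontr)
    assume inf: "infinite B"
    obtain n where n: "C < real n * top_value"
      using reals_Archimedean3[OF assms] by auto
    obtain F where "F \<subseteq> B" "finite F" "card F = n" using infinite_arbitrarily_large[OF inf] by blast
    then show False using bound n by fastforce
  qed
  then show ?thesis using S.fin_dim_if_finite_total[OF B(1) _ B(2)] by blast
qed

end

section \<open>Spaces of square summable functions\<close>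

definition ell2 :: "'i set \<Rightarrow> ('i \<Rightarrow> complex) cinner_space"
  where "ell2 I = \<lparr>carrier = {f. (\<forall>i. i \<notin> I \<longrightarrow> f i = 0) \<and> (\<lambda>i. (cmod (f i))\<^sup>2) summable_on I},
     mult = undefined, one = undefined, zero = (\<lambda>_. 0), add = (\<lambda>f g i. f i + g i),
     smult = (\<lambda>c f i. c * f i), cinner = (\<lambda>f g. \<Sum>\<^sub>\<infinity>i\<in>I. f i * cnj (g i))\<rparr>"

lemma ell2_simps [simp]:
  "zero (ell2 I) = (\<lambda>_. 0)" "add (ell2 I) f g = (\<lambda>i. f i + g i)" "smult (ell2 I) c f = (\<lambda>i. c * f i)"
  "cinner (ell2 I) f g = (\<Sum>\<^sub>\<infinity>i\<in>I. f i * cnj (g i))"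
  by (simp_all add: ell2_def)

lemma ell2_carrier:
  "f \<in> carrier (ell2 I) \<longleftrightarrow> (\<forall>i. i \<notin> I \<longrightarrow> f i = 0) \<and> (\<lambda>i. (cmod (f i))\<^sup>2) summable_on I"
  by (simp add: ell2_def)

lemma ell2_mult_summable:
  assumes "f \<in> carrier (ell2 I)" "g \<in> carrier (ell2 I)"
  shows "(\<lambda>i. f i * cnj (g i)) summable_on I"
proof -
  have "(\<lambda>i. (cmod (f i))\<^sup>2 + (cmod (g i))\<^sup>2) summable_on I"
    using assms by (intro summable_on_add) (auto simp: ell2_carrier)
  moreover have "norm (f i * cnj (g i)) \<le> (cmod (f i))\<^sup>2 + (cmod (g i))\<^sup>2" for i
    unfolding norm_mult complex_mod_cnj
    using sum_squares_bound[of "cmod (f i)" "cmod (g i)"]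
      mult_nonneg_nonneg[OF norm_ge_zero norm_ge_zero, of "f i" "g i"]
    by linarith
  ultimately have "(\<lambda>i. norm (f i * cnj (g i))) summable_on I"
    by (rule summable_on_comparison_test) auto
  then show ?thesis by (rule abs_summable_summable)
qed

lemma ell2_add_closed:
  assumes "f \<in> carrier (ell2 I)" "g \<in> carrier (ell2 I)"
  shows "(\<lambda>i. f i + g i) \<in> carrier (ell2 I)"
proof -
  have "(\<lambda>i. 2 * (cmod (f i))\<^sup>2 + 2 * (cmod (g i))\<^sup>2) summable_on I"
    using assms by (intro summable_on_add summable_on_cmult_right) (auto simp: ell2_carrier)
  moreover have "(cmod (f i + g i))\<^sup>2 \<le> 2 * (cmod (f i))\<^sup>2 + 2 * (cmod (g i))\<^sup>2" for i
  proof -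
    have "(cmod (f i + g i))\<^sup>2 \<le> (cmod (f i) + cmod (g i))\<^sup>2"
      by (intro power_mono norm_triangle_ineq) auto
    also have "\<dots> \<le> 2 * (cmod (f i))\<^sup>2 + 2 * (cmod (g i))\<^sup>2"
      using sum_squares_bound[of "cmod (f i)" "cmod (g i)"] by (simp add: power2_sum)
    finally show ?thesis .
  qed
  ultimately have "(\<lambda>i. (cmod (f i + g i))\<^sup>2) summable_on I"
    by (rule summable_on_comparison_test) auto
  then show ?thesis using assms by (simp add: ell2_carrier)
qed

lemma ell2_smult_closed:
  assumes "f \<in> carrier (ell2 I)"
  shows "(\<lambda>i. c * f i) \<in> carrier (ell2 I)"
  using assms summable_on_cmult_right[of "\<lambda>i. (cmod (f i))\<^sup>2" I "(cmod c)\<^sup>2"]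
  by (simp add: ell2_carrier norm_mult power_mult_distrib)

lemma norm_sq_ell2:
  assumes "f \<in> carrier (ell2 I)"
  shows "norm_sq (ell2 I) f = (\<Sum>\<^sub>\<infinity>i\<in>I. (cmod (f i))\<^sup>2)"
proof -
  have "((\<lambda>i. of_real ((cmod (f i))\<^sup>2)) has_sum complex_of_real (\<Sum>\<^sub>\<infinity>i\<in>I. (cmod (f i))\<^sup>2)) I"
    using assms by (intro has_sum_of_real has_sum_infsum) (simp add: ell2_carrier)
  then have "(\<Sum>\<^sub>\<infinity>i\<in>I. f i * cnj (f i)) = of_real (\<Sum>\<^sub>\<infinity>i\<in>I. (cmod (f i))\<^sup>2)"
    unfolding complex_norm_square by (rule infsumI)
  then show ?thesis by (simp add: norm_sq_def)
qed

lemma ell2_inner_space: "complex_inner_space (ell2 I)"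
proof -
  have "abelian_group (ell2 I)"
  proof (rule abelian_groupI)
    fix f assume f: "f \<in> carrier (ell2 I)"
    show "\<exists>g\<in>carrier (ell2 I). g \<oplus>\<^bsub>ell2 I\<^esub> f = \<zero>\<^bsub>ell2 I\<^esub>"
      using ell2_smult_closed[OF f, of "-1"] by (intro bexI[of _ "\<lambda>i. - f i"]) auto
  qed (auto simp: ell2_add_closed algebra_simps ell2_carrier[of "\<lambda>_. 0"])
  moreover have "cring complex_field"
    using field_complex_field by (simp add: field_def domain_def)
  ultimately have "module complex_field (ell2 I)"
    by (intro moduleI) (auto simp: ell2_smult_closed algebra_simps)
  then have "vectorspace complex_field (ell2 I)"
    by (simp add: vectorspace_def field_complex_field)
  moreover have "complex_inner_space_axioms (ell2 I)"
  proof
    fix f g h assume "f \<in> carrier (ell2 I)" "g \<in> carrier (ell2 I)" "h \<in> carrier (ell2 I)"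
    then show "cinner (ell2 I) (f \<oplus>\<^bsub>ell2 I\<^esub> g) h = cinner (ell2 I) f h + cinner (ell2 I) g h"
      by (simp add: distrib_right infsum_add ell2_mult_summable)
  next
    fix f g c
    show "cinner (ell2 I) (c \<odot>\<^bsub>ell2 I\<^esub> f) g = c * cinner (ell2 I) f g"
      by (simp add: mult.assoc infsum_cmult_right')
  next
    fix f g
    show "cinner (ell2 I) g f = cnj (cinner (ell2 I) f g)"
      by (simp flip: infsum_cnj add: mult.commute)
  next
    fix f assume f: "f \<in> carrier (ell2 I)" "f \<noteq> \<zero>\<^bsub>ell2 I\<^esub>"
    then obtain i where i: "i \<in> I" "f i \<noteq> 0" by (auto simp: ell2_carrier)
    have "0 < (cmod (f i))\<^sup>2" using i by simp
    also have "\<dots> \<le> (\<Sum>\<^sub>\<infinity>i\<in>I. (cmod (f i))\<^sup>2)"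
      using finite_sum_le_infsum[of "\<lambda>i. (cmod (f i))\<^sup>2" I "{i}"] f i by (simp add: ell2_carrier)
    finally show "0 < Re (cinner (ell2 I) f f)" unfolding norm_sq_ell2[OF f(1), symmetric] norm_sq_def .
  qed
  ultimately show ?thesis by (simp add: complex_inner_space_def)
qed

lemma ell2_minus:
  assumes "f \<in> carrier (ell2 I)" "g \<in> carrier (ell2 I)"
  shows "f \<ominus>\<^bsub>ell2 I\<^esub> g = (\<lambda>i. f i - g i)"
proof -
  interpret complex_inner_space "ell2 I" by (rule ell2_inner_space)
  show ?thesis using minus_smult[OF assms] by (simp add: fun_eq_iff)
qed

text \<open>A Cauchy sequence converges pointwise, and the estimates for its finite partial sums pass to
  the pointwise limit.\<close>

theorem ell2_hilbert_space: "complex_hilbert_space (ell2 I)"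
proof -
  interpret complex_inner_space "ell2 I" by (rule ell2_inner_space)
  show ?thesis
  proof (rule complete_if_Cauchy_convergent)
    fix s :: "nat \<Rightarrow> 'a \<Rightarrow> complex"
    assume s: "\<And>n. s n \<in> carrier (ell2 I)"
      and C: "\<And>e. e > 0 \<Longrightarrow> \<exists>N. \<forall>m\<ge>N. \<forall>n\<ge>N. norm_sq (ell2 I) (s m \<ominus>\<^bsub>ell2 I\<^esub> s n) < e"
    have partial: "(\<Sum>i\<in>F. (cmod (s m i - s n i))\<^sup>2) \<le> norm_sq (ell2 I) (s m \<ominus>\<^bsub>ell2 I\<^esub> s n)"
      if "finite F" "F \<subseteq> I" for F m n
    proof -
      have c: "s m \<ominus>\<^bsub>ell2 I\<^esub> s n \<in> carrier (ell2 I)" using s by simp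
      then have "(\<lambda>i. (cmod (s m i - s n i))\<^sup>2) summable_on I"
        unfolding ell2_carrier ell2_minus[OF s s] by blast
      then show ?thesis
        unfolding norm_sq_ell2[OF c] unfolding ell2_minus[OF s s] using that by (intro finite_sum_le_infsum) auto
    qed
    have s0: "s n i = 0" if "i \<notin> I" for n i using s that by (simp add: ell2_carrier)
    have "convergent (\<lambda>n. s n i)" for i
    proof (cases "i \<in> I")
      case i: True
      have "Cauchy (\<lambda>n. s n i)"
      proof (rule metric_CauchyI)
        fix e :: real assume e: "e > 0"
        then obtain N where N: "\<forall>m\<ge>N. \<forall>n\<ge>N. norm_sq (ell2 I) (s m \<ominus>\<^bsub>ell2 I\<^esub> s n) < e\<^sup>2"
          using C[of "e\<^sup>2"] by auto
        have "dist (s m i) (s n i) < e" if "m \<ge> N" "n \<ge> N" for m n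
        proof -
          have "(cmod (s m i - s n i))\<^sup>2 < e\<^sup>2"
            using partial[of "{i}" m n] N that i by force
          then show ?thesis using e by (simp add: dist_norm power_less_imp_less_base)
        qed
        then show "\<exists>M. \<forall>m\<ge>M. \<forall>n\<ge>M. dist (s m i) (s n i) < e" by blast
      qed
      then show ?thesis by (simp add: Cauchy_convergent)
    qed (simp add: s0 convergent_const)
    then obtain f where f: "\<And>i. (\<lambda>n. s n i) \<longlonglongrightarrow> f i"
      unfolding convergent_def by metis
    have tail: "(\<Sum>i\<in>F. (cmod (s n i - f i))\<^sup>2) \<le> e"
      if N: "\<forall>m\<ge>N. \<forall>n\<ge>N. norm_sq (ell2 I) (s m \<ominus>\<^bsub>ell2 I\<^esub> s n) < e" and n: "n \<ge> N"
        and F: "finite F" "F \<subseteq> I" for F N n e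
    proof (rule LIMSEQ_le_const2)
      show "(\<lambda>m. \<Sum>i\<in>F. (cmod (s n i - s m i))\<^sup>2) \<longlonglongrightarrow> (\<Sum>i\<in>F. (cmod (s n i - f i))\<^sup>2)"
        by (intro tendsto_intros f)
      show "\<exists>N. \<forall>m\<ge>N. (\<Sum>i\<in>F. (cmod (s n i - s m i))\<^sup>2) \<le> e"
        using partial[OF F] N n by (meson less_imp_le order_trans)
    qed
    have f0: "f i = 0" if "i \<notin> I" for i
      using f[of i] s0[OF that] by (simp add: LIMSEQ_const_iff)
    have diff: "(\<lambda>i. s n i - f i) \<in> carrier (ell2 I)"
      "norm_sq (ell2 I) (\<lambda>i. s n i - f i) \<le> e"
      if N: "\<forall>m\<ge>N. \<forall>n\<ge>N. norm_sq (ell2 I) (s m \<ominus>\<^bsub>ell2 I\<^esub> s n) < e" and n: "n \<ge> N" for N n e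
    proof -
      have *: "(\<lambda>i. (cmod (s n i - f i))\<^sup>2) summable_on I"
        using tail[OF N n] by (intro nonneg_bdd_above_summable_on) (auto simp: bdd_above_def)
      then show c: "(\<lambda>i. s n i - f i) \<in> carrier (ell2 I)" by (simp add: ell2_carrier s0 f0)
      show "norm_sq (ell2 I) (\<lambda>i. s n i - f i) \<le> e"
        unfolding norm_sq_ell2[OF c] by (rule infsum_le_finite_sums[OF *]) (use tail[OF N n] in auto)
    qed
    have fc: "f \<in> carrier (ell2 I)"
    proof -
      obtain N where N: "\<forall>m\<ge>N. \<forall>n\<ge>N. norm_sq (ell2 I) (s m \<ominus>\<^bsub>ell2 I\<^esub> s n) < 1" using C[of 1] by auto
      have "(\<lambda>i. s N i + (- 1) * (s N i - f i)) \<in> carrier (ell2 I)"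
        by (intro ell2_add_closed ell2_smult_closed s diff[OF N]) auto
      then show ?thesis by simp
    qed
    have "hconv (ell2 I) s f"
    proof (rule hconvI[OF s fc])
      show "(\<lambda>n. norm_sq (ell2 I) (s n \<ominus>\<^bsub>ell2 I\<^esub> f)) \<longlonglongrightarrow> 0"
      proof (rule LIMSEQ_I)
        fix e :: real assume e: "e > 0"
        then obtain N where N: "\<forall>m\<ge>N. \<forall>n\<ge>N. norm_sq (ell2 I) (s m \<ominus>\<^bsub>ell2 I\<^esub> s n) < e/2"
          using C[of "e/2"] by auto
        have "norm (norm_sq (ell2 I) (s n \<ominus>\<^bsub>ell2 I\<^esub> f) - 0) < e" if "n \<ge> N" for n
        proof -
          have "0 \<le> norm_sq (ell2 I) (s n \<ominus>\<^bsub>ell2 I\<^esub> f)" using s fc by simp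
          then show ?thesis using diff(2)[OF N that] e unfolding ell2_minus[OF s fc] by simp
        qed
        then show "\<exists>N. \<forall>n\<ge>N. norm (norm_sq (ell2 I) (s n \<ominus>\<^bsub>ell2 I\<^esub> f) - 0) < e" by blast
      qed
    qed
    then show "\<exists>x. hconv (ell2 I) s x" by blast
  qed
qed

section \<open>The tensor product\<close>

lemma has_sum_Times_mult:
  fixes f :: "'i \<Rightarrow> complex" and g :: "'j \<Rightarrow> complex"
  assumes f: "(f has_sum a) A" and g: "(g has_sum b) B"
  shows "((\<lambda>(i, j). f i * g j) has_sum a * b) (A \<times> B)"
proof (rule has_sum_SigmaI)
  show "((\<lambda>j. case (i, j) of (i, j) \<Rightarrow> f i * g j) has_sum f i * b) B" for i
    using has_sum_cmult_right[OF g] by simp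
  show "((\<lambda>i. f i * b) has_sum a * b) A"
    by (rule has_sum_cmult_left[OF f])
  have fa: "(\<lambda>i. norm (f i)) summable_on A" and ga: "(\<lambda>j. norm (g j)) summable_on B"
    using f g by (auto simp: summable_on_iff_abs_summable_on_complex[symmetric] summable_on_def)
  have "(\<lambda>p. norm (case p of (i, j) \<Rightarrow> f i * g j)) summable_on A \<times> B"
  proof (rule summable_on_SigmaI)
    show "((\<lambda>j. norm (case (i, j) of (i, j) \<Rightarrow> f i * g j)) has_sum
        norm (f i) * (\<Sum>\<^sub>\<infinity>j\<in>B. norm (g j))) B" for i
      using has_sum_cmult_right[OF has_sum_infsum[OF ga], of "norm (f i)"] by (simp add: norm_mult)
    show "(\<lambda>i. norm (f i) * (\<Sum>\<^sub>\<infinity>j\<in>B. norm (g j))) summable_on A"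
      by (rule summable_on_cmult_left[OF fa])
  qed auto
  then show "(\<lambda>(i, j). f i * g j) summable_on A \<times> B"
    by (rule abs_summable_summable)
qed

text \<open>\<open>t x y\<close> is the elementary tensor \<open>x \<otimes> y\<close>. The two conditions determine \<open>L\<close> and \<open>t\<close> up to
  unitary equivalence; bilinearity of \<open>t\<close> is a consequence.\<close>

locale hilbert_tensor = H1: complex_hilbert_space H1 + H2: complex_hilbert_space H2
    + complex_hilbert_space L
  for H1 :: "'v cinner_space" and H2 :: "'w cinner_space" and L :: "'u cinner_space" (structure) +
  fixes t :: "'v \<Rightarrow> 'w \<Rightarrow> 'u"
  assumes t_closed [simp, intro]: "\<lbrakk>x \<in> carrier H1; y \<in> carrier H2\<rbrakk> \<Longrightarrow> t x y \<in> carrier L"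
    and t_cinner: "\<lbrakk>x \<in> carrier H1; x' \<in> carrier H1; y \<in> carrier H2; y' \<in> carrier H2\<rbrakk>
      \<Longrightarrow> cinner L (t x y) (t x' y') = cinner H1 x x' * cinner H2 y y'"
    and t_total: "\<lbrakk>z \<in> carrier L; \<And>x y. \<lbrakk>x \<in> carrier H1; y \<in> carrier H2\<rbrakk> \<Longrightarrow> cinner L z (t x y) = 0\<rbrakk>
      \<Longrightarrow> z = \<zero>"

text \<open>In orthonormal bases, \<open>x \<otimes> y\<close> is the function on pairs of basis vectors whose value is the
  product of the coordinates of \<open>x\<close> and \<open>y\<close>.\<close>

theorem hilbert_tensor_exists:
  fixes H1 :: "'v cinner_space" and H2 :: "'w cinner_space"
  assumes "complex_hilbert_space H1" "complex_hilbert_space H2"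
  obtains L :: "('v \<times> 'w \<Rightarrow> complex) cinner_space" and t where "hilbert_tensor H1 H2 L t"
proof -
  interpret H1: complex_hilbert_space H1 by fact
  interpret H2: complex_hilbert_space H2 by fact
  obtain E1 where E1: "orthonormal H1 (\<lambda>x. x) E1" "total_in H1 (\<lambda>x. x) E1"
    by (rule H1.orthonormal_basis_exists)
  obtain E2 where E2: "orthonormal H2 (\<lambda>x. x) E2" "total_in H2 (\<lambda>x. x) E2"
    by (rule H2.orthonormal_basis_exists)
  have E1c: "e \<in> carrier H1" if "e \<in> E1" for e using E1 that by (auto simp: orthonormal_def)
  have E2c: "e \<in> carrier H2" if "e \<in> E2" for e using E2 that by (auto simp: orthonormal_def)
  define I where "I = E1 \<times> E2"
  interpret L: complex_hilbert_space "ell2 I" by (rule ell2_hilbert_space)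
  define t where "t x y = (\<lambda>p. if p \<in> I then cinner H1 x (fst p) * cinner H2 y (snd p) else 0)" for x y
  have prod: "((\<lambda>p. t x y p * cnj (t x' y' p)) has_sum cinner H1 x x' * cinner H2 y y') I"
    if "x \<in> carrier H1" "x' \<in> carrier H1" "y \<in> carrier H2" "y' \<in> carrier H2" for x x' y y'
  proof -
    have "((\<lambda>(i, j). (cinner H1 x i * cnj (cinner H1 x' i)) * (cinner H2 y j * cnj (cinner H2 y' j)))
        has_sum cinner H1 x x' * cinner H2 y y') (E1 \<times> E2)"
      by (rule has_sum_Times_mult) (rule H1.Parseval[OF E1] H2.Parseval[OF E2], fact+)+
    then show ?thesis
      unfolding I_def by (rule has_sum_cong[THEN iffD1, rotated]) (auto simp: t_def I_def)
  qed
  have t: "t x y \<in> carrier (ell2 I)" if "x \<in> carrier H1" "y \<in> carrier H2" for x y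
  proof -
    have "(\<lambda>p. norm (t x y p * cnj (t x y p))) summable_on I"
      using prod[OF that(1) that(1) that(2) that(2)]
      by (auto simp: summable_on_iff_abs_summable_on_complex[symmetric] summable_on_def)
    then show ?thesis
      by (simp add: ell2_carrier t_def norm_mult power2_eq_square)
  qed
  have "hilbert_tensor H1 H2 (ell2 I) t"
  proof unfold_locales
    fix x x' y y' assume "x \<in> carrier H1" "x' \<in> carrier H1" "y \<in> carrier H2" "y' \<in> carrier H2"
    then show "cinner (ell2 I) (t x y) (t x' y') = cinner H1 x x' * cinner H2 y y'"
      using infsumI[OF prod] by simp
  next
    fix z assume z: "z \<in> carrier (ell2 I)"
      and zt: "\<And>x y. \<lbrakk>x \<in> carrier H1; y \<in> carrier H2\<rbrakk> \<Longrightarrow> cinner (ell2 I) z (t x y) = 0"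
    have "z p = 0" if p: "p \<in> I" for p
    proof -
      obtain i j where ij: "p = (i, j)" "i \<in> E1" "j \<in> E2" using p by (auto simp: I_def)
      have "t i j q = (if q = p then 1 else 0)" if "q \<in> I" for q
      proof -
        obtain k l where kl: "q = (k, l)" "k \<in> E1" "l \<in> E2" using \<open>q \<in> I\<close> by (auto simp: I_def)
        have "cinner H1 i k = (if i = k then 1 else 0)" "cinner H2 j l = (if j = l then 1 else 0)"
          using E1(1) E2(1) ij kl unfolding orthonormal_def by blast+
        then show ?thesis using ij(1) kl(1) \<open>q \<in> I\<close> by (auto simp: t_def)
      qed
      then have "(\<Sum>\<^sub>\<infinity>q\<in>I. z q * cnj (t i j q)) = (\<Sum>\<^sub>\<infinity>q\<in>{p}. z q)"
        using p by (intro infsum_cong_neutral) auto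
      then show ?thesis using zt[OF E1c[OF ij(2)] E2c[OF ij(3)]] by simp
    qed
    moreover have "z p = 0" if "p \<notin> I" for p using z that unfolding ell2_carrier by blast
    ultimately show "z = \<zero>\<^bsub>ell2 I\<^esub>" unfolding ell2_simps fun_eq_iff by blast
  qed (use t in auto)
  then show thesis by (rule that)
qed

text \<open>A bounded bilinear form is determined by its values on a pair of orthonormal bases: extend to
  the whole space in one argument at a time.\<close>

lemma bilinear_zero:
  assumes H1: "complex_hilbert_space H1" and H2: "complex_hilbert_space H2"
    and B1: "orthonormal H1 b1 I1" "total_in H1 b1 I1"
    and B2: "orthonormal H2 b2 I2" "total_in H2 b2 I2"
    and add1: "\<And>x x' y. \<lbrakk>x \<in> carrier H1; x' \<in> carrier H1; y \<in> carrier H2\<rbrakk>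
      \<Longrightarrow> f (x \<oplus>\<^bsub>H1\<^esub> x') y = f x y + f x' y"
    and add2: "\<And>x y y'. \<lbrakk>x \<in> carrier H1; y \<in> carrier H2; y' \<in> carrier H2\<rbrakk>
      \<Longrightarrow> f x (y \<oplus>\<^bsub>H2\<^esub> y') = f x y + f x y'"
    and smult1: "\<And>c x y. \<lbrakk>x \<in> carrier H1; y \<in> carrier H2\<rbrakk> \<Longrightarrow> f (c \<odot>\<^bsub>H1\<^esub> x) y = c * f x y"
    and smult2: "\<And>c x y. \<lbrakk>x \<in> carrier H1; y \<in> carrier H2\<rbrakk> \<Longrightarrow> f x (c \<odot>\<^bsub>H2\<^esub> y) = c * f x y"
    and bd: "\<And>x y. \<lbrakk>x \<in> carrier H1; y \<in> carrier H2\<rbrakk> \<Longrightarrow> (cmod (f x y))\<^sup>2 \<le> C * (norm_sq H1 x * norm_sq H2 y)"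
    and zero: "\<And>i j. \<lbrakk>i \<in> I1; j \<in> I2\<rbrakk> \<Longrightarrow> f (b1 i) (b2 j) = 0"
    and x: "x \<in> carrier H1" and y: "y \<in> carrier H2"
  shows "f x y = 0"
proof -
  interpret H1: complex_hilbert_space H1 by (rule H1)
  interpret H2: complex_hilbert_space H2 by (rule H2)
  have c1: "b1 i \<in> carrier H1" if "i \<in> I1" for i using B1(1) that by (auto simp: orthonormal_def)
  have c2: "b2 j \<in> carrier H2" if "j \<in> I2" for j using B2(1) that by (auto simp: orthonormal_def)
  have 1: "f x (b2 j) = 0" if j: "j \<in> I2" for j
  proof -
    have "closed_subspace H1 {x \<in> carrier H1. f x (b2 j) = 0}"
    proof (rule H1.closed_subspace_zero_set[where g = id and B = "C * norm_sq H2 (b2 j)"])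
      show "(cmod (f x (b2 j)))\<^sup>2 \<le> C * norm_sq H2 (b2 j) * norm_sq H1 x" if "x \<in> carrier H1" for x
        using bd[OF that c2[OF j]] by (simp add: mult_ac)
    qed (use add1 smult1 c2[OF j] in auto)
    then have "{x \<in> carrier H1. f x (b2 j) = 0} = carrier H1"
      by (rule H1.total_closed_subspace[OF B1]) (use zero j c1 in auto)
    then show ?thesis using x by blast
  qed
  have "closed_subspace H2 {y \<in> carrier H2. f x y = 0}"
  proof (rule H2.closed_subspace_zero_set[where g = id and B = "C * norm_sq H1 x"])
    show "(cmod (f x y))\<^sup>2 \<le> C * norm_sq H1 x * norm_sq H2 y" if "y \<in> carrier H2" for y
      using bd[OF x that] by (simp add: mult_ac)
  qed (use add2 smult2 x in auto)
  then have "{y \<in> carrier H2. f x y = 0} = carrier H2"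
    by (rule H2.total_closed_subspace[OF B2]) (use 1 c2 in auto)
  then show ?thesis using y by blast
qed

context hilbert_tensor
begin

lemma norm_sq_t: "\<lbrakk>x \<in> carrier H1; y \<in> carrier H2\<rbrakk> \<Longrightarrow> norm_sq L (t x y) = norm_sq H1 x * norm_sq H2 y"
  using H1.cinner_self(1)[of x] H2.cinner_self(1)[of y] by (simp add: norm_sq_def t_cinner)

lemma t_ext:
  assumes "u \<in> carrier L" "v \<in> carrier L"
    and "\<And>x y. \<lbrakk>x \<in> carrier H1; y \<in> carrier H2\<rbrakk> \<Longrightarrow> cinner L u (t x y) = cinner L v (t x y)"
  shows "u = v"
proof -
  have "u \<ominus> v = \<zero>"
    by (rule t_total) (use assms in \<open>auto simp: cinner_minus_left\<close>)
  then show ?thesis using assms minus_eq_zero_iff by blast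
qed

lemma t_add_left: "\<lbrakk>x \<in> carrier H1; x' \<in> carrier H1; y \<in> carrier H2\<rbrakk>
    \<Longrightarrow> t (x \<oplus>\<^bsub>H1\<^esub> x') y = t x y \<oplus> t x' y"
  by (rule t_ext) (auto simp: t_cinner cinner_add_left H1.cinner_add_left distrib_right)

lemma t_add_right: "\<lbrakk>x \<in> carrier H1; y \<in> carrier H2; y' \<in> carrier H2\<rbrakk>
    \<Longrightarrow> t x (y \<oplus>\<^bsub>H2\<^esub> y') = t x y \<oplus> t x y'"
  by (rule t_ext) (auto simp: t_cinner cinner_add_left H2.cinner_add_left distrib_left)

lemma t_smult_left: "\<lbrakk>x \<in> carrier H1; y \<in> carrier H2\<rbrakk> \<Longrightarrow> t (c \<odot>\<^bsub>H1\<^esub> x) y = c \<odot> t x y"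
  by (rule t_ext) (auto simp: t_cinner cinner_smult_left H1.cinner_smult_left)

lemma t_smult_right: "\<lbrakk>x \<in> carrier H1; y \<in> carrier H2\<rbrakk> \<Longrightarrow> t x (c \<odot>\<^bsub>H2\<^esub> y) = c \<odot> t x y"
  by (rule t_ext) (auto simp: t_cinner cinner_smult_left H2.cinner_smult_left)

lemma t_orthonormal:
  assumes "orthonormal H1 b1 I1" "orthonormal H2 b2 I2"
  shows "orthonormal L (\<lambda>(i, j). t (b1 i) (b2 j)) (I1 \<times> I2)"
  using assms by (auto simp: orthonormal_def t_cinner image_subset_iff)

lemma t_total_in:
  assumes B1: "orthonormal H1 b1 I1" "total_in H1 b1 I1"
    and B2: "orthonormal H2 b2 I2" "total_in H2 b2 I2"
  shows "total_in L (\<lambda>(i, j). t (b1 i) (b2 j)) (I1 \<times> I2)"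
  unfolding total_in_def
proof (intro conjI ballI impI)
  show "(\<lambda>(i, j). t (b1 i) (b2 j)) ` (I1 \<times> I2) \<subseteq> carrier L"
    using t_orthonormal[OF B1(1) B2(1)] by (simp add: orthonormal_def)
  fix z assume z: "z \<in> carrier L"
    and *: "\<forall>i\<in>I1 \<times> I2. cinner L z (case i of (i, j) \<Rightarrow> t (b1 i) (b2 j)) = 0"
  have b: "b1 i \<in> carrier H1" "b2 j \<in> carrier H2" if "i \<in> I1" "j \<in> I2" for i j
    using B1(1) B2(1) that by (auto simp: orthonormal_def)
  have zero: "cinner L (t x y) z = 0" if xy: "x \<in> carrier H1" "y \<in> carrier H2" for x y
  proof (rule bilinear_zero[OF H1.complex_hilbert_space_axioms H2.complex_hilbert_space_axioms B1 B2,
        where f = "\<lambda>x y. cinner L (t x y) z" and C = "norm_sq L z"])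
    show "(cmod (cinner L (t x y) z))\<^sup>2 \<le> norm_sq L z * (norm_sq H1 x * norm_sq H2 y)"
      if "x \<in> carrier H1" "y \<in> carrier H2" for x y
      using Cauchy_Schwarz_sq[of "t x y" z] that z by (simp add: norm_sq_t mult_ac)
    show "cinner L (t (b1 i) (b2 j)) z = 0" if "i \<in> I1" "j \<in> I2" for i j
      using * that cinner_commute[of z "t (b1 i) (b2 j)"] z b by auto
  qed (use xy z in \<open>auto simp: t_add_left t_add_right t_smult_left t_smult_right
      cinner_add_left cinner_smult_left\<close>)
  show "z = \<zero>"
    using t_total[OF z] zero cinner_commute[OF t_closed z] by simp
qed

end

section \<open>Unitary operators\<close>

text \<open>Surjectivity is what makes the image of a total family total.\<close>

definition unitary_op :: "'v cinner_space \<Rightarrow> ('v \<Rightarrow> 'v) \<Rightarrow> bool"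
  where "unitary_op H V \<longleftrightarrow> V \<in> module_hom complex_field H H \<and> V ` carrier H = carrier H \<and>
    (\<forall>x\<in>carrier H. \<forall>y\<in>carrier H. cinner H (V x) (V y) = cinner H x y)"

lemma unitary_opD:
  assumes "unitary_op H V"
  shows "x \<in> carrier H \<Longrightarrow> V x \<in> carrier H"
    and "\<lbrakk>x \<in> carrier H; y \<in> carrier H\<rbrakk> \<Longrightarrow> V (x \<oplus>\<^bsub>H\<^esub> y) = V x \<oplus>\<^bsub>H\<^esub> V y"
    and "x \<in> carrier H \<Longrightarrow> V (c \<odot>\<^bsub>H\<^esub> x) = c \<odot>\<^bsub>H\<^esub> V x"
    and "\<lbrakk>x \<in> carrier H; y \<in> carrier H\<rbrakk> \<Longrightarrow> cinner H (V x) (V y) = cinner H x y"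
    and "x \<in> carrier H \<Longrightarrow> norm_sq H (V x) = norm_sq H x"
  using assms by (auto simp: unitary_op_def module_hom_def norm_sq_def)

lemma unitary_op_orthonormal:
  "\<lbrakk>unitary_op H V; orthonormal H b I\<rbrakk> \<Longrightarrow> orthonormal H (\<lambda>i. V (b i)) I"
  by (auto simp: orthonormal_def unitary_opD image_subset_iff)

lemma unitary_op_total:
  assumes H: "complex_inner_space H" and V: "unitary_op H V" and tot: "total_in H b I"
  shows "total_in H (\<lambda>i. V (b i)) I"
  unfolding total_in_def
proof (intro conjI ballI impI)
  interpret complex_inner_space H by (rule H)
  have b: "b i \<in> carrier H" if "i \<in> I" for i using tot that by (auto simp: total_in_def)
  show "(\<lambda>i. V (b i)) ` I \<subseteq> carrier H" using b V by (auto simp: unitary_opD)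
  fix x assume "x \<in> carrier H" and *: "\<forall>i\<in>I. cinner H x (V (b i)) = 0"
  then obtain y where y: "y \<in> carrier H" "x = V y" using V unfolding unitary_op_def by blast
  have "\<forall>i\<in>I. cinner H y (b i) = 0" using * b y V by (simp add: unitary_opD)
  then have "y = \<zero>\<^bsub>H\<^esub>" using tot y(1) by (simp add: total_in_def)
  then have "norm_sq H x = 0" using y V by (simp add: unitary_opD)
  then show "x = \<zero>\<^bsub>H\<^esub>" using \<open>x \<in> carrier H\<close> by (simp add: norm_sq_eq_0)
qed

context hilbert_tensor
begin

text \<open>\<open>U = V1 \<otimes> V2\<close>. Given \<open>w\<close>, the vector \<open>U w\<close> is defined by prescribing its coordinates
  with respect to the orthonormal basis \<open>V1 i \<otimes> V2 j\<close>: they are the coordinates of \<open>w\<close> with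
  respect to \<open>i \<otimes> j\<close>. The formula for general \<open>x\<close>, \<open>y\<close> follows because both sides are bounded
  and bilinear, after exchanging the arguments of the inner product.\<close>

theorem tensor_operator_exists:
  assumes V1: "unitary_op H1 V1" and V2: "unitary_op H2 V2"
  shows "\<exists>U. (\<forall>w\<in>carrier L. U w \<in> carrier L \<and>
      (\<forall>x\<in>carrier H1. \<forall>y\<in>carrier H2. cinner L (U w) (t (V1 x) (V2 y)) = cinner L w (t x y))) \<and>
      (\<forall>w\<in>carrier L. \<forall>w'\<in>carrier L. cinner L (U w) (U w') = cinner L w w')"
proof -
  note [simp] = unitary_opD[OF V1] unitary_opD[OF V2]
  obtain E1 where E1: "orthonormal H1 (\<lambda>x. x) E1" "total_in H1 (\<lambda>x. x) E1"
    by (rule H1.orthonormal_basis_exists)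
  obtain E2 where E2: "orthonormal H2 (\<lambda>x. x) E2" "total_in H2 (\<lambda>x. x) E2"
    by (rule H2.orthonormal_basis_exists)
  define b where "b = (\<lambda>(i, j). t i j)"
  define b' where "b' = (\<lambda>(i, j). t (V1 i) (V2 j))"
  have bo: "orthonormal L b (E1 \<times> E2)" and bt: "total_in L b (E1 \<times> E2)"
    unfolding b_def by (rule t_orthonormal[OF E1(1) E2(1)] t_total_in[OF E1 E2])+
  have bo': "orthonormal L b' (E1 \<times> E2)" and bt': "total_in L b' (E1 \<times> E2)"
    unfolding b'_def
    by (rule t_orthonormal t_total_in
        unitary_op_orthonormal[OF V1 E1(1)] unitary_op_orthonormal[OF V2 E2(1)]
        unitary_op_total[OF H1.complex_inner_space_axioms V1 E1(2)]
        unitary_op_total[OF H2.complex_inner_space_axioms V2 E2(2)])+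
  have "\<exists>u\<in>carrier L. \<forall>p\<in>E1 \<times> E2. cinner L u (b' p) = cinner L w (b p)" if w: "w \<in> carrier L" for w
  proof -
    have bd: "(\<Sum>p\<in>F. (cmod (cinner L w (b p)))\<^sup>2) \<le> norm_sq L w" if "finite F" "F \<subseteq> E1 \<times> E2" for F
      by (rule Bessel[OF bo that w])
    show ?thesis
      using Riesz_Fischer[OF bo' bd] by metis
  qed
  then obtain U where U: "\<And>w. w \<in> carrier L \<Longrightarrow> U w \<in> carrier L"
    "\<And>w p. \<lbrakk>w \<in> carrier L; p \<in> E1 \<times> E2\<rbrakk> \<Longrightarrow> cinner L (U w) (b' p) = cinner L w (b p)"
    by metis
  have eq: "cinner L (t (V1 x) (V2 y)) (U w) - cinner L (t x y) w = 0"
    if w: "w \<in> carrier L" and xy: "x \<in> carrier H1" "y \<in> carrier H2" for w x y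
  proof (rule bilinear_zero[OF H1.complex_hilbert_space_axioms H2.complex_hilbert_space_axioms E1 E2,
        where f = "\<lambda>x y. cinner L (t (V1 x) (V2 y)) (U w) - cinner L (t x y) w"
          and C = "2 * norm_sq L (U w) + 2 * norm_sq L w"])
    fix x y assume xy: "x \<in> carrier H1" "y \<in> carrier H2"
    let ?a = "cinner L (t (V1 x) (V2 y)) (U w)" and ?b = "cinner L (t x y) w"
    have "(cmod (?a - ?b))\<^sup>2 \<le> (cmod ?a + cmod ?b)\<^sup>2"
      by (intro power_mono norm_triangle_ineq4) auto
    also have "\<dots> \<le> 2 * (cmod ?a)\<^sup>2 + 2 * (cmod ?b)\<^sup>2"
      using sum_squares_bound[of "cmod ?a" "cmod ?b"] by (simp add: power2_sum)
    also have "\<dots> \<le> 2 * (norm_sq H1 x * norm_sq H2 y * norm_sq L (U w)) + 2 * (norm_sq H1 x * norm_sq H2 y * norm_sq L w)"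
      using Cauchy_Schwarz_sq[of "t (V1 x) (V2 y)" "U w"] Cauchy_Schwarz_sq[of "t x y" w] xy w U(1)
      by (simp add: norm_sq_t)
    finally show "(cmod (?a - ?b))\<^sup>2 \<le> (2 * norm_sq L (U w) + 2 * norm_sq L w) * (norm_sq H1 x * norm_sq H2 y)"
      by (simp add: algebra_simps)
  next
    fix i j assume ij: "i \<in> E1" "j \<in> E2"
    then have ijc: "i \<in> carrier H1" "j \<in> carrier H2" using E1(1) E2(1) by (auto simp: orthonormal_def)
    have "cinner L (U w) (t (V1 i) (V2 j)) = cinner L w (t i j)"
      using U(2)[OF w, of "(i, j)"] ij by (simp add: b_def b'_def)
    then show "cinner L (t (V1 i) (V2 j)) (U w) - cinner L (t i j) w = 0"
      using cinner_commute[of w "t i j"] cinner_commute[of "U w" "t (V1 i) (V2 j)"] ijc w U(1) by simp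
  qed (use xy w U(1) in \<open>auto simp: t_add_left t_add_right t_smult_left t_smult_right
      cinner_add_left cinner_smult_left algebra_simps\<close>)
  have eq': "cinner L (U w) (t (V1 x) (V2 y)) = cinner L w (t x y)"
    if w: "w \<in> carrier L" and xy: "x \<in> carrier H1" "y \<in> carrier H2" for w x y
    using eq[OF that] cinner_commute[of "t x y" w] cinner_commute[of "t (V1 x) (V2 y)" "U w"] xy w U(1)
    by simp
  have iso: "cinner L (U w) (U w') = cinner L w w'" if w: "w \<in> carrier L" "w' \<in> carrier L" for w w'
  proof (rule has_sum_unique)
    show "((\<lambda>p. cinner L w (b p) * cnj (cinner L w' (b p))) has_sum cinner L w w') (E1 \<times> E2)"
      by (rule Parseval[OF bo bt w])
    have "((\<lambda>p. cinner L (U w) (b' p) * cnj (cinner L (U w') (b' p))) has_sum cinner L (U w) (U w'))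
        (E1 \<times> E2)"
      by (rule Parseval[OF bo' bt' U(1)[OF w(1)] U(1)[OF w(2)]])
    then show "((\<lambda>p. cinner L w (b p) * cnj (cinner L w' (b p))) has_sum cinner L (U w) (U w'))
        (E1 \<times> E2)"
      by (rule has_sum_cong[THEN iffD1, rotated]) (simp add: U(2) w)
  qed
  show ?thesis
    by (intro exI[of _ U] conjI ballI U(1) eq' iso)
qed

end

section \<open>Unitary representations\<close>

lemma unitary_rep_unitary_op:
  assumes "unitary_rep G T H \<rho>" "g \<in> carrier G"
  shows "unitary_op H (\<rho> g)"
proof -
  interpret A: group_action G "carrier H" \<rho> using assms(1) by (simp add: unitary_rep_def)
  have "bij_betw (\<rho> g) (carrier H) (carrier H)"
    using A.bij_prop0[OF assms(2)] by (simp add: Bij_def)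
  then show ?thesis
    using assms by (auto simp: unitary_rep_def unitary_op_def bij_betw_def)
qed

lemma unitary_rep_hilbert: "unitary_rep G T H \<rho> \<Longrightarrow> complex_hilbert_space H"
  by (simp add: unitary_rep_def)

lemma unitary_rep_group: "unitary_rep G T H \<rho> \<Longrightarrow> group G"
  unfolding unitary_rep_def group_action_def group_hom_def by blast

lemma unitary_rep_mult:
  assumes "unitary_rep G T H \<rho>" "g \<in> carrier G" "h \<in> carrier G" "x \<in> carrier H"
  shows "\<rho> (g \<otimes>\<^bsub>G\<^esub> h) x = \<rho> g (\<rho> h x)"
proof -
  interpret A: group_action G "carrier H" \<rho> using assms(1) by (simp add: unitary_rep_def)
  show ?thesis using A.composition_rule assms by blast
qed

lemma unitary_rep_one:
  assumes "unitary_rep G T H \<rho>" "x \<in> carrier H"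
  shows "\<rho> \<one>\<^bsub>G\<^esub> x = x"
proof -
  interpret A: group_action G "carrier H" \<rho> using assms(1) by (simp add: unitary_rep_def)
  show ?thesis using A.id_eq_one assms(2) by (metis restrict_apply')
qed

lemma unitary_rep_inv:
  assumes r: "unitary_rep G T H \<rho>" and g: "g \<in> carrier G" and x: "x \<in> carrier H"
  shows "\<rho> (inv\<^bsub>G\<^esub> g) (\<rho> g x) = x" "\<rho> g (\<rho> (inv\<^bsub>G\<^esub> g) x) = x"
proof -
  interpret group G by (rule unitary_rep_group[OF r])
  show "\<rho> (inv\<^bsub>G\<^esub> g) (\<rho> g x) = x" "\<rho> g (\<rho> (inv\<^bsub>G\<^esub> g) x) = x"
    using unitary_rep_mult[OF r, of "inv\<^bsub>G\<^esub> g" g x] unitary_rep_mult[OF r, of g "inv\<^bsub>G\<^esub> g" x]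
      unitary_rep_one[OF r x] g x by simp_all
qed

lemma unitary_rep_cinner_inv:
  assumes r: "unitary_rep G T H \<rho>" and g: "g \<in> carrier G" and x: "x \<in> carrier H" and y: "y \<in> carrier H"
  shows "cinner H (\<rho> g x) y = cinner H x (\<rho> (inv\<^bsub>G\<^esub> g) y)"
proof -
  interpret group G by (rule unitary_rep_group[OF r])
  have "cinner H (\<rho> g x) (\<rho> g (\<rho> (inv\<^bsub>G\<^esub> g) y)) = cinner H x (\<rho> (inv\<^bsub>G\<^esub> g) y)"
    using unitary_opD[OF unitary_rep_unitary_op[OF r]] g x y by simp
  then show ?thesis using unitary_rep_inv(2)[OF r g y] by simp
qed

context complex_inner_space
begin

lemma tendsto_cinner:
  assumes ev: "\<forall>\<^sub>F h in F. \<phi> h \<in> carrier H" and x: "x \<in> carrier H" and a: "a \<in> carrier H"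
    and lim: "((\<lambda>h. norm_sq H (\<phi> h \<ominus> x)) \<longlongrightarrow> 0) F"
  shows "((\<lambda>h. cinner H (\<phi> h) a) \<longlongrightarrow> cinner H x a) F"
proof -
  have "((\<lambda>h. sqrt (norm_sq H (\<phi> h \<ominus> x) * norm_sq H a)) \<longlongrightarrow> sqrt (0 * norm_sq H a)) F"
    by (intro tendsto_intros lim)
  then have "((\<lambda>h. sqrt (norm_sq H (\<phi> h \<ominus> x) * norm_sq H a)) \<longlongrightarrow> 0) F" by simp
  moreover have "\<forall>\<^sub>F h in F. norm (cinner H (\<phi> h) a - cinner H x a) \<le> sqrt (norm_sq H (\<phi> h \<ominus> x) * norm_sq H a)"
    using ev
  proof eventually_elim
    case (elim h)
    show ?case
      using Cauchy_Schwarz_sq[of "\<phi> h \<ominus> x" a] elim x a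
      by (intro real_le_rsqrt) (simp add: cinner_minus_left)
  qed
  ultimately have "((\<lambda>h. cinner H (\<phi> h) a - cinner H x a) \<longlongrightarrow> 0) F"
    by (rule Lim_null_comparison[rotated])
  then show ?thesis by (simp add: LIM_zero_iff)
qed

text \<open>Strong continuity as a limit in the reals, where sums, products and comparison of limits are
  available.\<close>

lemma continuous_map_htopology_iff:
  assumes \<phi>: "\<And>g. g \<in> topspace T \<Longrightarrow> \<phi> g \<in> carrier H"
  shows "continuous_map T (htopology H) \<phi> \<longleftrightarrow>
    (\<forall>g\<in>topspace T. ((\<lambda>h. norm_sq H (\<phi> h \<ominus> \<phi> g)) \<longlongrightarrow> 0) (atin T g))"
proof -
  interpret MS: Metric_space "carrier H" "hdist H" by (rule Metric_space_hdist)
  have ev: "\<forall>\<^sub>F h in atin T g. \<phi> h \<in> carrier H" for g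
    unfolding eventually_atin using \<phi> openin_topspace[of T] by blast
  have "((\<lambda>h. hdist H (\<phi> h) (\<phi> g)) \<longlongrightarrow> 0) (atin T g) \<longleftrightarrow>
      ((\<lambda>h. norm_sq H (\<phi> h \<ominus> \<phi> g)) \<longlongrightarrow> 0) (atin T g)" if g: "g \<in> topspace T" for g
  proof
    assume "((\<lambda>h. hdist H (\<phi> h) (\<phi> g)) \<longlongrightarrow> 0) (atin T g)"
    then have "((\<lambda>h. (hdist H (\<phi> h) (\<phi> g))\<^sup>2) \<longlongrightarrow> 0\<^sup>2) (atin T g)"
      by (intro tendsto_power)
    moreover have "\<forall>\<^sub>F h in atin T g. (hdist H (\<phi> h) (\<phi> g))\<^sup>2 = norm_sq H (\<phi> h \<ominus> \<phi> g)"
      using ev by eventually_elim (use \<phi>[OF g] in \<open>simp add: hdist_norm_sq\<close>)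
    ultimately show "((\<lambda>h. norm_sq H (\<phi> h \<ominus> \<phi> g)) \<longlongrightarrow> 0) (atin T g)"
      by (simp add: tendsto_cong)
  next
    assume "((\<lambda>h. norm_sq H (\<phi> h \<ominus> \<phi> g)) \<longlongrightarrow> 0) (atin T g)"
    then have "((\<lambda>h. sqrt (norm_sq H (\<phi> h \<ominus> \<phi> g))) \<longlongrightarrow> sqrt 0) (atin T g)"
      by (intro tendsto_real_sqrt)
    moreover have "\<forall>\<^sub>F h in atin T g. hdist H (\<phi> h) (\<phi> g) = sqrt (norm_sq H (\<phi> h \<ominus> \<phi> g))"
      using ev by eventually_elim (use \<phi>[OF g] in \<open>simp add: hdist_norm_sq\<close>)
    ultimately show "((\<lambda>h. hdist H (\<phi> h) (\<phi> g)) \<longlongrightarrow> 0) (atin T g)"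
      by (simp add: tendsto_cong)
  qed
  then show ?thesis
    unfolding continuous_map_atin htopology_def MS.limitin_metric_dist_null using \<phi> ev by blast
qed

end

lemma unitary_repI:
  assumes "complex_hilbert_space H" "group G" "topspace T = carrier G"
    and op: "\<And>g. g \<in> carrier G \<Longrightarrow> \<rho> g \<in> extensional (carrier H)"
      "\<And>g. g \<in> carrier G \<Longrightarrow> \<rho> g \<in> module_hom complex_field H H"
      "\<And>g x y. \<lbrakk>g \<in> carrier G; x \<in> carrier H; y \<in> carrier H\<rbrakk> \<Longrightarrow> cinner H (\<rho> g x) (\<rho> g y) = cinner H x y"
    and one: "\<And>x. x \<in> carrier H \<Longrightarrow> \<rho> \<one>\<^bsub>G\<^esub> x = x"
    and mult: "\<And>g h x. \<lbrakk>g \<in> carrier G; h \<in> carrier G; x \<in> carrier H\<rbrakk> \<Longrightarrow> \<rho> (g \<otimes>\<^bsub>G\<^esub> h) x = \<rho> g (\<rho> h x)"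
    and cont: "\<And>x. x \<in> carrier H \<Longrightarrow> continuous_map T (htopology H) (\<lambda>g. \<rho> g x)"
  shows "unitary_rep G T H \<rho>"
proof -
  interpret group G by fact
  have cl: "\<rho> g x \<in> carrier H" if "g \<in> carrier G" "x \<in> carrier H" for g x
    using op(2)[OF that(1)] that(2) by (auto simp: module_hom_def)
  have "group_action G (carrier H) \<rho>"
  proof (rule group_actionI[OF assms(2)])
    fix g assume g: "g \<in> carrier G"
    have "\<rho> (inv\<^bsub>G\<^esub> g) (\<rho> g x) = x" "\<rho> g (\<rho> (inv\<^bsub>G\<^esub> g) x) = x" if "x \<in> carrier H" for x
      using mult[of "inv\<^bsub>G\<^esub> g" g x] mult[of g "inv\<^bsub>G\<^esub> g" x] one[OF that] g that by simp_all
    then have "bij_betw (\<rho> g) (carrier H) (carrier H)"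
      using cl g by (intro bij_betw_byWitness[of _ "\<rho> (inv\<^bsub>G\<^esub> g)"]) auto
    then show "\<rho> g \<in> Bij (carrier H)" using op(1)[OF g] by (simp add: Bij_def)
  qed (rule mult)
  then show ?thesis using assms by (simp add: unitary_rep_def)
qed

text \<open>The operators exist by \<open>tensor_operator_exists\<close>. They satisfy
  \<open>\<langle>\<tau> g w, \<rho>1 g x \<otimes> \<rho>2 g y\<rangle> = \<langle>w, x \<otimes> y\<rangle>\<close>, and elementary tensors are total, so that linearity
  and the homomorphism property follow by comparing inner products. The vectors with continuous
  orbit map form a closed subspace, and it contains the elementary tensors.\<close>

theorem tensor_rep_exists:
  fixes G :: "('g, 'm) monoid_scheme"
  assumes r1: "unitary_rep G T H1 \<rho>1" and r2: "unitary_rep G T H2 \<rho>2"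
    and T: "topspace T = carrier G" and L: "hilbert_tensor H1 H2 L t"
  obtains \<tau> where "unitary_rep G T L \<tau>"
    "\<And>g x y. \<lbrakk>g \<in> carrier G; x \<in> carrier H1; y \<in> carrier H2\<rbrakk> \<Longrightarrow> \<tau> g (t x y) = t (\<rho>1 g x) (\<rho>2 g y)"
proof -
  interpret group G by (rule unitary_rep_group[OF r1])
  interpret hilbert_tensor H1 H2 L t by (rule L)
  note op1 = unitary_rep_unitary_op[OF r1] and op2 = unitary_rep_unitary_op[OF r2]
  note D1 = unitary_opD[OF op1] and D2 = unitary_opD[OF op2]
  define P where "P g U \<longleftrightarrow> (\<forall>w\<in>carrier L. U w \<in> carrier L \<and>
      (\<forall>x\<in>carrier H1. \<forall>y\<in>carrier H2. cinner L (U w) (t (\<rho>1 g x) (\<rho>2 g y)) = cinner L w (t x y))) \<and>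
      (\<forall>w\<in>carrier L. \<forall>w'\<in>carrier L. cinner L (U w) (U w') = cinner L w w')" for g U
  have "\<exists>U. P g U" if g: "g \<in> carrier G" for g
    unfolding P_def by (rule tensor_operator_exists[OF op1[OF g] op2[OF g]])
  then obtain U where "\<And>g. g \<in> carrier G \<Longrightarrow> P g (U g)" by metis
  then have U: "U g w \<in> carrier L"
      "cinner L (U g w) (t (\<rho>1 g x) (\<rho>2 g y)) = cinner L w (t x y)"
      "cinner L (U g w) (U g w') = cinner L w w'"
    if "g \<in> carrier G" "w \<in> carrier L" "w' \<in> carrier L" "x \<in> carrier H1" "y \<in> carrier H2" for g w w' x y
    using that unfolding P_def by blast+
  define \<tau> where "\<tau> g = restrict (U g) (carrier L)" for g
  have \<tau>c: "\<tau> g w \<in> carrier L" and \<tau>i: "cinner L (\<tau> g w) (\<tau> g w') = cinner L w w'"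
    and \<tau>t: "cinner L (\<tau> g w) (t (\<rho>1 g x) (\<rho>2 g y)) = cinner L w (t x y)"
    if "g \<in> carrier G" "w \<in> carrier L" "w' \<in> carrier L" "x \<in> carrier H1" "y \<in> carrier H2" for g w w' x y
    using U that by (simp_all add: \<tau>_def)
  have \<tau>c: "\<tau> g w \<in> carrier L" if "g \<in> carrier G" "w \<in> carrier L" for g w
    using \<tau>c[OF that that(2) H1.M.zero_closed H2.M.zero_closed] .
  have \<tau>i: "cinner L (\<tau> g w) (\<tau> g w') = cinner L w w'"
    if "g \<in> carrier G" "w \<in> carrier L" "w' \<in> carrier L" for g w w'
    using \<tau>i[OF that H1.M.zero_closed H2.M.zero_closed] .
  have \<tau>t: "cinner L (\<tau> g w) (t (\<rho>1 g x) (\<rho>2 g y)) = cinner L w (t x y)"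
    if "g \<in> carrier G" "w \<in> carrier L" "x \<in> carrier H1" "y \<in> carrier H2" for g w x y
    using \<tau>t[OF that(1,2) that(2-4)] .
  have ext: "u = v"
    if g: "g \<in> carrier G" and uv: "u \<in> carrier L" "v \<in> carrier L"
      and eq: "\<And>x y. \<lbrakk>x \<in> carrier H1; y \<in> carrier H2\<rbrakk>
        \<Longrightarrow> cinner L u (t (\<rho>1 g x) (\<rho>2 g y)) = cinner L v (t (\<rho>1 g x) (\<rho>2 g y))" for g u v
  proof (rule t_ext[OF uv])
    fix x y assume "x \<in> carrier H1" "y \<in> carrier H2"
    then show "cinner L u (t x y) = cinner L v (t x y)"
      using eq[of "\<rho>1 (inv\<^bsub>G\<^esub> g) x" "\<rho>2 (inv\<^bsub>G\<^esub> g) y"] g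
      by (simp add: D1 D2 unitary_rep_inv[OF r1] unitary_rep_inv[OF r2])
  qed
  have \<tau>tt: "\<tau> g (t x y) = t (\<rho>1 g x) (\<rho>2 g y)"
    if g: "g \<in> carrier G" and xy: "x \<in> carrier H1" "y \<in> carrier H2" for g x y
    by (rule ext[OF g]) (use g xy in \<open>auto simp: \<tau>c \<tau>t D1 D2 t_cinner\<close>)
  have add: "\<tau> g (w \<oplus>\<^bsub>L\<^esub> w') = \<tau> g w \<oplus>\<^bsub>L\<^esub> \<tau> g w'" if "g \<in> carrier G" "w \<in> carrier L" "w' \<in> carrier L" for g w w'
    by (rule ext[OF that(1)]) (use that in \<open>simp_all add: \<tau>c \<tau>t D1 D2 cinner_add_left\<close>)
  have smult: "\<tau> g (c \<odot>\<^bsub>L\<^esub> w) = c \<odot>\<^bsub>L\<^esub> \<tau> g w" if "g \<in> carrier G" "w \<in> carrier L" for g w c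
    by (rule ext[OF that(1)]) (use that in \<open>simp_all add: \<tau>c \<tau>t D1 D2 cinner_smult_left\<close>)
  have minus: "\<tau> g (w \<ominus>\<^bsub>L\<^esub> w') = \<tau> g w \<ominus>\<^bsub>L\<^esub> \<tau> g w'"
    if "g \<in> carrier G" "w \<in> carrier L" "w' \<in> carrier L" for g w w'
    by (rule ext[OF that(1)]) (use that in \<open>simp_all add: \<tau>c \<tau>t D1 D2 cinner_minus_left\<close>)
  have norm_sq: "norm_sq L (\<tau> g w) = norm_sq L w" if "g \<in> carrier G" "w \<in> carrier L" for g w
    using \<tau>i that by (simp add: norm_sq_def)
  \<comment> \<open>the vectors with continuous orbit map\<close>
  define C where "C = {w \<in> carrier L. \<forall>g\<in>carrier G. ((\<lambda>h. norm_sq L (\<tau> h w \<ominus>\<^bsub>L\<^esub> \<tau> g w)) \<longlongrightarrow> 0) (atin T g)}"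
  have evG: "\<forall>\<^sub>F h in atin T g. h \<in> carrier G" for g
    unfolding eventually_atin using openin_topspace[of T] T by blast
  have sq2: "norm_sq L (a \<oplus>\<^bsub>L\<^esub> b) \<le> 2 * norm_sq L a + 2 * norm_sq L b" if "a \<in> carrier L" "b \<in> carrier L" for a b
  proof -
    have "0 \<le> norm_sq L (a \<ominus>\<^bsub>L\<^esub> b)" using that by simp
    then show ?thesis using parallelogram[OF that] by linarith
  qed
  have C_t: "t x y \<in> C" if xy: "x \<in> carrier H1" "y \<in> carrier H2" for x y
  proof -
    have "((\<lambda>h. norm_sq L (\<tau> h (t x y) \<ominus>\<^bsub>L\<^esub> \<tau> g (t x y))) \<longlongrightarrow> 0) (atin T g)" if g: "g \<in> carrier G" for g
    proof -
      have 1: "((\<lambda>h. cinner H1 (\<rho>1 h x) (\<rho>1 g x)) \<longlongrightarrow> cinner H1 (\<rho>1 g x) (\<rho>1 g x)) (atin T g)"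
      proof (rule H1.tendsto_cinner)
        show "((\<lambda>h. norm_sq H1 (\<rho>1 h x \<ominus>\<^bsub>H1\<^esub> \<rho>1 g x)) \<longlongrightarrow> 0) (atin T g)"
          using H1.continuous_map_htopology_iff[of T "\<lambda>g. \<rho>1 g x"] r1 g xy T
          by (simp add: unitary_rep_def D1)
        show "\<forall>\<^sub>F h in atin T g. \<rho>1 h x \<in> carrier H1"
          using evG by eventually_elim (use xy in \<open>simp add: D1\<close>)
      qed (use g xy in \<open>simp_all add: D1\<close>)
      have 2: "((\<lambda>h. cinner H2 (\<rho>2 h y) (\<rho>2 g y)) \<longlongrightarrow> cinner H2 (\<rho>2 g y) (\<rho>2 g y)) (atin T g)"
      proof (rule H2.tendsto_cinner)
        show "((\<lambda>h. norm_sq H2 (\<rho>2 h y \<ominus>\<^bsub>H2\<^esub> \<rho>2 g y)) \<longlongrightarrow> 0) (atin T g)"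
          using H2.continuous_map_htopology_iff[of T "\<lambda>g. \<rho>2 g y"] r2 g xy T
          by (simp add: unitary_rep_def D2)
        show "\<forall>\<^sub>F h in atin T g. \<rho>2 h y \<in> carrier H2"
          using evG by eventually_elim (use xy in \<open>simp add: D2\<close>)
      qed (use g xy in \<open>simp_all add: D2\<close>)
      have "((\<lambda>h. 2 * norm_sq L (t x y) - 2 * Re (cinner H1 (\<rho>1 h x) (\<rho>1 g x) * cinner H2 (\<rho>2 h y) (\<rho>2 g y)))
          \<longlongrightarrow> 2 * norm_sq L (t x y) - 2 * Re (cinner H1 (\<rho>1 g x) (\<rho>1 g x) * cinner H2 (\<rho>2 g y) (\<rho>2 g y))) (atin T g)"
        by (intro tendsto_intros 1 2)
      also have "2 * norm_sq L (t x y) - 2 * Re (cinner H1 (\<rho>1 g x) (\<rho>1 g x) * cinner H2 (\<rho>2 g y) (\<rho>2 g y)) = 0"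
        using g xy by (simp add: D1 D2 norm_sq_def t_cinner)
      finally show ?thesis
      proof (rule tendsto_cong[THEN iffD1, rotated])
        show "\<forall>\<^sub>F h in atin T g. 2 * norm_sq L (t x y) - 2 * Re (cinner H1 (\<rho>1 h x) (\<rho>1 g x) * cinner H2 (\<rho>2 h y) (\<rho>2 g y))
            = norm_sq L (\<tau> h (t x y) \<ominus>\<^bsub>L\<^esub> \<tau> g (t x y))"
          using evG
        proof eventually_elim
          case (elim h)
          then show ?case using g xy
            by (simp add: norm_sq_minus \<tau>c norm_sq) (simp add: \<tau>tt t_cinner D1 D2)
        qed
      qed
    qed
    then show ?thesis using xy by (simp add: C_def)
  qed
  have C_sub: "VectorSpace.subspace complex_field C L"
    unfolding subspace_iff
  proof (intro conjI ballI allI)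
    show "C \<subseteq> carrier L" by (auto simp: C_def)
    have z: "\<zero>\<^bsub>L\<^esub> = t \<zero>\<^bsub>H1\<^esub> \<zero>\<^bsub>H2\<^esub>" by (rule t_ext) (auto simp: t_cinner)
    show "\<zero>\<^bsub>L\<^esub> \<in> C" unfolding z by (rule C_t) auto
  next
    fix w w' assume w: "w \<in> C" and w': "w' \<in> C"
    have wc: "w \<in> carrier L" "w' \<in> carrier L" using w w' by (auto simp: C_def)
    have "((\<lambda>h. norm_sq L (\<tau> h (w \<oplus>\<^bsub>L\<^esub> w') \<ominus>\<^bsub>L\<^esub> \<tau> g (w \<oplus>\<^bsub>L\<^esub> w'))) \<longlongrightarrow> 0) (atin T g)" if g: "g \<in> carrier G" for g
    proof (rule Lim_null_comparison)
      have "((\<lambda>h. 2 * norm_sq L (\<tau> h w \<ominus>\<^bsub>L\<^esub> \<tau> g w) + 2 * norm_sq L (\<tau> h w' \<ominus>\<^bsub>L\<^esub> \<tau> g w')) \<longlongrightarrow> 2 * 0 + 2 * 0) (atin T g)"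
        using w w' g by (intro tendsto_intros) (auto simp: C_def)
      then show "((\<lambda>h. 2 * norm_sq L (\<tau> h w \<ominus>\<^bsub>L\<^esub> \<tau> g w) + 2 * norm_sq L (\<tau> h w' \<ominus>\<^bsub>L\<^esub> \<tau> g w')) \<longlongrightarrow> 0) (atin T g)"
        by simp
      show "\<forall>\<^sub>F h in atin T g. norm (norm_sq L (\<tau> h (w \<oplus>\<^bsub>L\<^esub> w') \<ominus>\<^bsub>L\<^esub> \<tau> g (w \<oplus>\<^bsub>L\<^esub> w')))
          \<le> 2 * norm_sq L (\<tau> h w \<ominus>\<^bsub>L\<^esub> \<tau> g w) + 2 * norm_sq L (\<tau> h w' \<ominus>\<^bsub>L\<^esub> \<tau> g w')"
        using evG
      proof eventually_elim
        case (elim h)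
        have "\<tau> h (w \<oplus>\<^bsub>L\<^esub> w') \<ominus>\<^bsub>L\<^esub> \<tau> g (w \<oplus>\<^bsub>L\<^esub> w') = (\<tau> h w \<ominus>\<^bsub>L\<^esub> \<tau> g w) \<oplus>\<^bsub>L\<^esub> (\<tau> h w' \<ominus>\<^bsub>L\<^esub> \<tau> g w')"
          by (rule cinner_ext) (use elim g wc in \<open>auto simp: \<tau>c add cinner_add_left cinner_minus_left\<close>)
        then show ?case
          using sq2[of "\<tau> h w \<ominus>\<^bsub>L\<^esub> \<tau> g w" "\<tau> h w' \<ominus>\<^bsub>L\<^esub> \<tau> g w'"] elim g wc by (simp add: \<tau>c)
      qed
    qed
    then show "w \<oplus>\<^bsub>L\<^esub> w' \<in> C" using wc by (simp add: C_def)
  next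
    fix c w assume w: "w \<in> C"
    have wc: "w \<in> carrier L" using w by (auto simp: C_def)
    have "((\<lambda>h. norm_sq L (\<tau> h (c \<odot>\<^bsub>L\<^esub> w) \<ominus>\<^bsub>L\<^esub> \<tau> g (c \<odot>\<^bsub>L\<^esub> w))) \<longlongrightarrow> 0) (atin T g)" if g: "g \<in> carrier G" for g
    proof (rule tendsto_cong[THEN iffD1])
      show "((\<lambda>h. (cmod c)\<^sup>2 * norm_sq L (\<tau> h w \<ominus>\<^bsub>L\<^esub> \<tau> g w)) \<longlongrightarrow> 0) (atin T g)"
        using w g by (intro tendsto_mult_right_zero) (auto simp: C_def)
      show "\<forall>\<^sub>F h in atin T g. (cmod c)\<^sup>2 * norm_sq L (\<tau> h w \<ominus>\<^bsub>L\<^esub> \<tau> g w)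
          = norm_sq L (\<tau> h (c \<odot>\<^bsub>L\<^esub> w) \<ominus>\<^bsub>L\<^esub> \<tau> g (c \<odot>\<^bsub>L\<^esub> w))"
        using evG
      proof eventually_elim
        case (elim h)
        have "\<tau> h (c \<odot>\<^bsub>L\<^esub> w) \<ominus>\<^bsub>L\<^esub> \<tau> g (c \<odot>\<^bsub>L\<^esub> w) = c \<odot>\<^bsub>L\<^esub> (\<tau> h w \<ominus>\<^bsub>L\<^esub> \<tau> g w)"
          by (rule cinner_ext)
            (use elim g wc in \<open>auto simp: \<tau>c smult cinner_smult_left cinner_minus_left algebra_simps\<close>)
        then show ?case using elim g wc by (simp add: \<tau>c norm_sq_smult)
      qed
    qed
    then show "c \<odot>\<^bsub>L\<^esub> w \<in> C" using wc by (simp add: C_def)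
  qed
  have C_closed: "closedin (htopology L) C"
    unfolding closedin_iff_hconv
  proof (intro conjI allI impI)
    show "C \<subseteq> carrier L" by (auto simp: C_def)
    fix s w assume *: "range s \<subseteq> C \<and> hconv L s w"
    then have w: "w \<in> carrier L" and sC: "\<And>n. s n \<in> C" by (auto simp: hconv_def)
    then have s: "s n \<in> carrier L" for n by (auto simp: C_def)
    have "((\<lambda>h. norm_sq L (\<tau> h w \<ominus>\<^bsub>L\<^esub> \<tau> g w)) \<longlongrightarrow> 0) (atin T g)" if g: "g \<in> carrier G" for g
    proof (rule tendstoI)
      fix e :: real assume e: "e > 0"
      have "(\<lambda>n. norm_sq L (s n \<ominus>\<^bsub>L\<^esub> w)) \<longlonglongrightarrow> 0" using * by (intro hconv_norm_sq_minus) simp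
      then obtain n where n: "norm_sq L (s n \<ominus>\<^bsub>L\<^esub> w) < e / 10"
        using order_tendstoD(2)[of _ 0 sequentially "e / 10"] e
        by (metis (no_types, lifting) divide_pos_pos eventually_sequentially order_refl zero_less_numeral)
      have "\<forall>\<^sub>F h in atin T g. norm_sq L (\<tau> h (s n) \<ominus>\<^bsub>L\<^esub> \<tau> g (s n)) < e / 10"
        using sC[of n] g e by (intro order_tendstoD(2)[of _ 0]) (auto simp: C_def)
      then show "\<forall>\<^sub>F h in atin T g. dist (norm_sq L (\<tau> h w \<ominus>\<^bsub>L\<^esub> \<tau> g w)) 0 < e"
        using evG
      proof eventually_elim
        case (elim h)
        let ?a = "\<tau> h (w \<ominus>\<^bsub>L\<^esub> s n)" and ?b = "\<tau> g (s n \<ominus>\<^bsub>L\<^esub> w)" and ?c = "\<tau> h (s n) \<ominus>\<^bsub>L\<^esub> \<tau> g (s n)"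
        have cl: "?a \<in> carrier L" "?b \<in> carrier L" "?c \<in> carrier L"
          using g elim w s by (simp_all add: \<tau>c)
        \<comment> \<open>the two applications of \<open>\<parallel>a + b\<parallel>\<^sup>2 \<le> 2 \<parallel>a\<parallel>\<^sup>2 + 2 \<parallel>b\<parallel>\<^sup>2\<close> give the weights 2, 4, 4, whence
          the choice of \<open>e / 10\<close>\<close>
        have "\<tau> h w \<ominus>\<^bsub>L\<^esub> \<tau> g w = ?c \<oplus>\<^bsub>L\<^esub> (?a \<oplus>\<^bsub>L\<^esub> ?b)"
          by (rule cinner_ext) (use elim g w s in \<open>auto simp: \<tau>c minus cinner_add_left cinner_minus_left\<close>)
        then have "norm_sq L (\<tau> h w \<ominus>\<^bsub>L\<^esub> \<tau> g w) \<le> 2 * norm_sq L ?c + 2 * (2 * norm_sq L ?a + 2 * norm_sq L ?b)"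
          using sq2[of ?c "?a \<oplus>\<^bsub>L\<^esub> ?b"] sq2[of ?a ?b] cl by simp
        moreover have "norm_sq L ?a = norm_sq L (s n \<ominus>\<^bsub>L\<^esub> w)" "norm_sq L ?b = norm_sq L (s n \<ominus>\<^bsub>L\<^esub> w)"
          using g elim w s cinner_commute[of w "s n"] by (simp_all add: norm_sq norm_sq_minus)
        ultimately have "norm_sq L (\<tau> h w \<ominus>\<^bsub>L\<^esub> \<tau> g w)
            \<le> 2 * norm_sq L ?c + 8 * norm_sq L (s n \<ominus>\<^bsub>L\<^esub> w)" by simp
        also have "\<dots> < e" using n elim(1) by (simp add: field_simps)
        finally have "norm_sq L (\<tau> h w \<ominus>\<^bsub>L\<^esub> \<tau> g w) < e" .
        then show ?case using norm_sq_nonneg[of "\<tau> h w \<ominus>\<^bsub>L\<^esub> \<tau> g w"] g elim w by (simp add: \<tau>c)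
      qed
    qed
    then show "w \<in> C" using w by (simp add: C_def)
  qed
  have C_all: "C = carrier L"
  proof -
    obtain E1 where E1: "orthonormal H1 (\<lambda>x. x) E1" "total_in H1 (\<lambda>x. x) E1"
      by (rule H1.orthonormal_basis_exists)
    obtain E2 where E2: "orthonormal H2 (\<lambda>x. x) E2" "total_in H2 (\<lambda>x. x) E2"
      by (rule H2.orthonormal_basis_exists)
    show ?thesis
    proof (rule total_closed_subspace[OF t_orthonormal[OF E1(1) E2(1)] t_total_in[OF E1 E2]])
      show "closed_subspace L C" using C_sub C_closed by (simp add: closed_subspace_def)
      show "(\<lambda>(i, j). t i j) ` (E1 \<times> E2) \<subseteq> C"
        using E1(1) E2(1) by (auto simp: orthonormal_def intro!: C_t)
    qed
  qed
  have "unitary_rep G T L \<tau>"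
  proof (rule unitary_repI[OF complex_hilbert_space_axioms is_group T])
    fix w assume w: "w \<in> carrier L"
    show "\<tau> \<one>\<^bsub>G\<^esub> w = w"
      by (rule ext[OF one_closed]) (use w \<tau>t[OF one_closed w] unitary_rep_one[OF r1] unitary_rep_one[OF r2]
        in \<open>auto simp: \<tau>c\<close>)
    show "continuous_map T (htopology L) (\<lambda>g. \<tau> g w)"
      using w T C_all by (subst continuous_map_htopology_iff) (auto simp: C_def \<tau>c)
  next
    fix g h w assume g: "g \<in> carrier G" and h: "h \<in> carrier G" and w: "w \<in> carrier L"
    show "\<tau> (g \<otimes>\<^bsub>G\<^esub> h) w = \<tau> g (\<tau> h w)"
    proof (rule ext[OF m_closed[OF g h]])
      fix x y assume xy: "x \<in> carrier H1" "y \<in> carrier H2"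
      show "cinner L (\<tau> (g \<otimes>\<^bsub>G\<^esub> h) w) (t (\<rho>1 (g \<otimes>\<^bsub>G\<^esub> h) x) (\<rho>2 (g \<otimes>\<^bsub>G\<^esub> h) y))
        = cinner L (\<tau> g (\<tau> h w)) (t (\<rho>1 (g \<otimes>\<^bsub>G\<^esub> h) x) (\<rho>2 (g \<otimes>\<^bsub>G\<^esub> h) y))"
        using \<tau>t[OF m_closed[OF g h] w xy] g h w xy
        by (simp add: unitary_rep_mult[OF r1] unitary_rep_mult[OF r2] \<tau>t \<tau>c D1 D2)
    qed (use g h w \<tau>c in auto)
  qed (use add smult \<tau>c \<tau>i in \<open>auto simp: module_hom_def \<tau>_def\<close>)
  then show thesis using \<tau>tt that by blast
qed

text \<open>Passing to a subgroup and to a stable subspace at once serves both the restriction of a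
  representation to \<open>K\<close> and, with \<open>K = carrier G\<close>, its subrepresentations.\<close>

theorem unitary_rep_subspace:
  assumes r: "unitary_rep G T H \<rho>" and K: "subgroup K G" and W: "closed_subspace H W"
    and inv: "\<And>k x. \<lbrakk>k \<in> K; x \<in> W\<rbrakk> \<Longrightarrow> \<rho> k x \<in> W" and T: "topspace T = carrier G"
  shows "unitary_rep (G\<lparr>carrier := K\<rparr>) (subtopology T K) (H\<lparr>carrier := W\<rparr>) (\<lambda>k. restrict (\<rho> k) W)"
proof -
  interpret complex_hilbert_space H by (rule unitary_rep_hilbert[OF r])
  interpret G: group G by (rule unitary_rep_group[OF r])
  have KG: "k \<in> carrier G" if "k \<in> K" for k using subgroup.subset[OF K] that by blast
  have W': "VectorSpace.subspace complex_field W H" using W by (simp add: closed_subspace_def)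
  have WH: "x \<in> carrier H" if "x \<in> W" for x using closed_subspace_carrier[OF W] that by blast
  have sub: "x \<oplus>\<^bsub>H\<^esub> y \<in> W" "c \<odot>\<^bsub>H\<^esub> x \<in> W" if "x \<in> W" "y \<in> W" for x y c
    using W' that by (auto simp: subspace_iff)
  note D = unitary_opD[OF unitary_rep_unitary_op[OF r KG]]
  show ?thesis
  proof (rule unitary_repI)
    show "complex_hilbert_space (H\<lparr>carrier := W\<rparr>)" by (rule subspace_hilbert_space[OF W])
    show "group (G\<lparr>carrier := K\<rparr>)" by (rule subgroup.subgroup_is_group[OF K G.is_group])
    show "topspace (subtopology T K) = carrier (G\<lparr>carrier := K\<rparr>)"
      using subgroup.subset[OF K] T by auto
    show "continuous_map (subtopology T K) (htopology (H\<lparr>carrier := W\<rparr>)) (\<lambda>k. restrict (\<rho> k) W x)"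
      if "x \<in> carrier (H\<lparr>carrier := W\<rparr>)" for x
    proof -
      have x: "x \<in> W" using that by simp
      have "continuous_map T (htopology H) (\<lambda>g. \<rho> g x)" using r WH[OF x] by (simp add: unitary_rep_def)
      then have "continuous_map (subtopology T K) (subtopology (htopology H) W) (\<lambda>k. \<rho> k x)"
        using inv x by (auto simp: continuous_map_in_subtopology continuous_map_from_subtopology)
      then show ?thesis using x by (simp add: htopology_subspace[OF W'])
    qed
  qed (use inv sub WH KG D unitary_rep_one[OF r] unitary_rep_mult[OF r]
      in \<open>auto simp: module_hom_def\<close>)
qed

section \<open>Irreducibility of the cyclic subspace of a spherical vector\<close>

text \<open>The representation on the closed span \<open>W\<close> of the orbit of \<open>\<xi>\<close> is irreducible. For a closed
  invariant \<open>V \<subseteq> W\<close> the projection \<open>z\<close> of \<open>\<xi>\<close> to \<open>V\<close> is invariant under \<open>K\<close>, so it is \<open>c \<xi>\<close>. If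
  \<open>c \<noteq> 0\<close>, then \<open>\<xi> \<in> V\<close> and \<open>V = W\<close>. If \<open>c = 0\<close>, then \<open>\<xi>\<close> and with it the whole orbit is
  orthogonal to \<open>V\<close>, so that \<open>V\<close> is orthogonal to itself.\<close>

theorem spherical_function_via_cyclic:
  assumes r: "unitary_rep G T L \<tau>" and T: "topspace T = carrier G" and K: "subgroup K G"
    and \<xi>: "\<xi> \<in> invariant_vectors L \<tau> K" "\<xi> \<noteq> \<zero>\<^bsub>L\<^esub>"
    and unique: "\<And>w. w \<in> invariant_vectors L \<tau> K \<Longrightarrow> \<exists>c. w = c \<odot>\<^bsub>L\<^esub> \<xi>"
  obtains W where "spherical_function_via G T K (L\<lparr>carrier := W\<rparr>) (\<lambda>g. restrict (\<tau> g) W)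
      (\<lambda>g. cinner L (\<tau> g \<xi>) \<xi>)"
proof -
  interpret complex_hilbert_space L by (rule unitary_rep_hilbert[OF r])
  interpret G: group G by (rule unitary_rep_group[OF r])
  note D = unitary_opD[OF unitary_rep_unitary_op[OF r]]
  have KG: "k \<in> carrier G" if "k \<in> K" for k using subgroup.subset[OF K] that by blast
  have \<xi>c: "\<xi> \<in> carrier L" using \<xi>(1) by (simp add: invariant_vectors_def)
  \<comment> \<open>the closed span of the orbit, obtained as the least closed subspace that contains it\<close>
  define \<S> where "\<S> = {V. closed_subspace L V \<and> (\<forall>g\<in>carrier G. \<tau> g \<xi> \<in> V)}"
  define W where "W = \<Inter>\<S>"
  have carrierS: "carrier L \<in> \<S>"
  proof -
    have "closed_subspace L {x \<in> carrier L. \<forall>a\<in>{}. cinner L x a = 0}"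
      by (rule closed_subspace_orthogonal) simp
    then show ?thesis using D(1) \<xi>c by (simp add: \<S>_def)
  qed
  have W: "closed_subspace L W"
    unfolding W_def by (rule closed_subspace_Inter) (use carrierS in \<open>auto simp: \<S>_def\<close>)
  have WL: "x \<in> carrier L" if "x \<in> W" for x using closed_subspace_carrier[OF W] that by blast
  have orbit: "\<tau> g \<xi> \<in> W" if "g \<in> carrier G" for g using that by (auto simp: W_def \<S>_def)
  have least: "W \<subseteq> V" if "closed_subspace L V" "\<And>g. g \<in> carrier G \<Longrightarrow> \<tau> g \<xi> \<in> V" for V
    using that by (auto simp: W_def \<S>_def)
  have \<xi>W: "\<xi> \<in> W" using orbit[OF G.one_closed] unitary_rep_one[OF r \<xi>c] by simp
  have Winv: "\<tau> h x \<in> W" if h: "h \<in> carrier G" and x: "x \<in> W" for h x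
  proof -
    have hc: "\<tau> h y \<in> carrier L" if "y \<in> carrier L" for y using D(1) h that by blast
    have "closed_subspace L {y \<in> carrier L. \<tau> h y \<in> W}"
      unfolding closed_subspace_def subspace_iff closedin_iff_hconv
    proof (intro conjI ballI allI impI)
      have W': "\<zero>\<^bsub>L\<^esub> \<in> W" "\<And>a b. \<lbrakk>a \<in> W; b \<in> W\<rbrakk> \<Longrightarrow> a \<oplus>\<^bsub>L\<^esub> b \<in> W" "\<And>c a. a \<in> W \<Longrightarrow> c \<odot>\<^bsub>L\<^esub> a \<in> W"
        using W by (auto simp: closed_subspace_def subspace_iff)
      have "\<tau> h \<zero>\<^bsub>L\<^esub> = \<zero>\<^bsub>L\<^esub>"
        using D(5)[OF h, of "\<zero>\<^bsub>L\<^esub>"] hc by (simp add: norm_sq_eq_0)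
      then show "\<zero>\<^bsub>L\<^esub> \<in> {y \<in> carrier L. \<tau> h y \<in> W}" using W'(1) by simp
      show "a \<oplus>\<^bsub>L\<^esub> b \<in> {y \<in> carrier L. \<tau> h y \<in> W}"
        if "a \<in> {y \<in> carrier L. \<tau> h y \<in> W}" "b \<in> {y \<in> carrier L. \<tau> h y \<in> W}" for a b
        using that W'(2) D(2)[OF h] by simp
      show "c \<odot>\<^bsub>L\<^esub> a \<in> {y \<in> carrier L. \<tau> h y \<in> W}" if "a \<in> {y \<in> carrier L. \<tau> h y \<in> W}" for c a
        using that W'(3) D(3)[OF h] by simp
      fix s y assume *: "range s \<subseteq> {y \<in> carrier L. \<tau> h y \<in> W} \<and> hconv L s y"
      have s: "s n \<in> carrier L" "\<tau> h (s n) \<in> W" for n using * by auto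
      have y: "y \<in> carrier L" using * by (simp add: hconv_def)
      have "hconv L (\<lambda>n. \<tau> h (s n)) (\<tau> h y)"
      proof (rule hconvI)
        have "norm_sq L (\<tau> h (s n) \<ominus>\<^bsub>L\<^esub> \<tau> h y) = norm_sq L (s n \<ominus>\<^bsub>L\<^esub> y)" for n
          using s y h by (simp add: norm_sq_minus D hc)
        then show "(\<lambda>n. norm_sq L (\<tau> h (s n) \<ominus>\<^bsub>L\<^esub> \<tau> h y)) \<longlonglongrightarrow> 0"
          using hconv_norm_sq_minus[of s y] * by simp
      qed (use s y hc in auto)
      moreover have "range (\<lambda>n. \<tau> h (s n)) \<subseteq> W" using s(2) by auto
      moreover have "\<forall>s x. range s \<subseteq> W \<and> hconv L s x \<longrightarrow> x \<in> W"
        using W by (simp add: closed_subspace_def closedin_iff_hconv)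
      ultimately have "\<tau> h y \<in> W" by blast
      then show "y \<in> {y \<in> carrier L. \<tau> h y \<in> W}" using y by simp
    qed auto
    moreover have "\<tau> g \<xi> \<in> {y \<in> carrier L. \<tau> h y \<in> W}" if g: "g \<in> carrier G" for g
      using orbit[of "h \<otimes>\<^bsub>G\<^esub> g"] unitary_rep_mult[OF r h g \<xi>c] D(1)[OF g \<xi>c] g h by simp
    ultimately show ?thesis using least x by blast
  qed
  let ?H = "L\<lparr>carrier := W\<rparr>" and ?r = "\<lambda>g. restrict (\<tau> g) W"
  have "unitary_rep (G\<lparr>carrier := carrier G\<rparr>) (subtopology T (carrier G)) ?H ?r"
    by (rule unitary_rep_subspace[OF r G.subgroup_self W Winv T])
  then have rep: "unitary_rep G T ?H ?r"
    using T subtopology_topspace[of T] by simp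
  have irr: "V = {\<zero>\<^bsub>L\<^esub>} \<or> V = W"
    if V: "closed_subspace L V" "V \<subseteq> W" and Vinv: "\<And>g x. \<lbrakk>g \<in> carrier G; x \<in> V\<rbrakk> \<Longrightarrow> \<tau> g x \<in> V" for V
  proof -
    obtain z where z: "z \<in> V" and perp: "\<forall>w\<in>V. cinner L w (\<xi> \<ominus>\<^bsub>L\<^esub> z) = 0"
      by (rule orthogonal_projection[OF V(1) \<xi>c])
    have VL: "x \<in> carrier L" if "x \<in> V" for x using V(2) WL that by blast
    have zc: "z \<in> carrier L" using VL z by blast
    have perp': "cinner L w \<xi> = cinner L w z" if "w \<in> V" for w
      using bspec[OF perp that] cinner_minus_right[OF \<xi>c zc VL[OF that]] by simp
    \<comment> \<open>\<open>z\<close> and \<open>\<tau> k z\<close> have the same inner product with \<open>\<tau> k z - z\<close>: replace \<open>z\<close> by \<open>\<xi>\<close>, which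
      is invariant, and replace it back\<close>
    have "\<tau> k z = z" if k: "k \<in> K" for k
    proof -
      have kz: "\<tau> k z \<in> V" using Vinv KG[OF k] z by blast
      have kinv: "inv\<^bsub>G\<^esub> k \<in> K" using K k by (rule subgroup.m_inv_closed)
      have d: "\<tau> k z \<ominus>\<^bsub>L\<^esub> z \<in> V"
        using subspace_minus[OF _ kz z] V(1) by (simp add: closed_subspace_def)
      have "cinner L (\<tau> k z \<ominus>\<^bsub>L\<^esub> z) (\<tau> k z) = cinner L (\<tau> k z \<ominus>\<^bsub>L\<^esub> z) z"
      proof -
        have k': "\<tau> (inv\<^bsub>G\<^esub> k) (\<tau> k z \<ominus>\<^bsub>L\<^esub> z) \<in> V" using Vinv[OF KG[OF kinv] d] .
        have kk: "\<tau> k (\<tau> (inv\<^bsub>G\<^esub> k) (\<tau> k z \<ominus>\<^bsub>L\<^esub> z)) = \<tau> k z \<ominus>\<^bsub>L\<^esub> z"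
          by (rule unitary_rep_inv(2)[OF r KG[OF k] VL[OF d]])
        have \<xi>k: "\<tau> k \<xi> = \<xi>" using \<xi>(1) k by (simp add: invariant_vectors_def)
        have "cinner L (\<tau> k z \<ominus>\<^bsub>L\<^esub> z) (\<tau> k z) = cinner L (\<tau> (inv\<^bsub>G\<^esub> k) (\<tau> k z \<ominus>\<^bsub>L\<^esub> z)) z"
          using D(4)[OF KG[OF k] VL[OF k'] zc] kk by simp
        also have "\<dots> = cinner L (\<tau> (inv\<^bsub>G\<^esub> k) (\<tau> k z \<ominus>\<^bsub>L\<^esub> z)) \<xi>"
          using perp'[OF k'] by simp
        also have "\<dots> = cinner L (\<tau> k z \<ominus>\<^bsub>L\<^esub> z) \<xi>"
          using D(4)[OF KG[OF k] VL[OF k'] \<xi>c] kk \<xi>k by simp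
        also have "\<dots> = cinner L (\<tau> k z \<ominus>\<^bsub>L\<^esub> z) z" by (rule perp'[OF d])
        finally show ?thesis .
      qed
      then have "norm_sq L (\<tau> k z \<ominus>\<^bsub>L\<^esub> z) = 0"
        using VL[OF d] VL[OF kz] zc unfolding norm_sq_def by (subst cinner_minus_right) auto
      then show ?thesis using VL[OF d] VL[OF kz] zc by (simp add: norm_sq_eq_0 minus_eq_zero_iff)
    qed
    then have "z \<in> invariant_vectors L \<tau> K" using zc by (simp add: invariant_vectors_def)
    then obtain c where c: "z = c \<odot>\<^bsub>L\<^esub> \<xi>" using unique by blast
    show ?thesis
    proof (cases "c = 0")
      case True
      then have z0: "z = \<zero>\<^bsub>L\<^esub>" using c \<xi>c by (intro cinner_ext) (auto simp: cinner_smult_left)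
      have Vxi: "cinner L w \<xi> = 0" if "w \<in> V" for w using perp'[OF that] z0 VL[OF that] by simp
      have "W \<subseteq> {x \<in> carrier L. \<forall>a\<in>V. cinner L x a = 0}"
      proof (rule least)
        show "closed_subspace L {x \<in> carrier L. \<forall>a\<in>V. cinner L x a = 0}"
          by (rule closed_subspace_orthogonal) (use VL in auto)
        show "\<tau> g \<xi> \<in> {x \<in> carrier L. \<forall>a\<in>V. cinner L x a = 0}" if g: "g \<in> carrier G" for g
        proof -
          have "cinner L (\<tau> g \<xi>) a = 0" if a: "a \<in> V" for a
          proof -
            have ga: "\<tau> (inv\<^bsub>G\<^esub> g) a \<in> V" using Vinv g a by simp
            have "cinner L (\<tau> g \<xi>) a = cinner L \<xi> (\<tau> (inv\<^bsub>G\<^esub> g) a)"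
              by (rule unitary_rep_cinner_inv[OF r g \<xi>c VL[OF a]])
            then show ?thesis using Vxi[OF ga] cinner_commute[OF VL[OF ga] \<xi>c] by simp
          qed
          then show ?thesis using D(1)[OF g \<xi>c] by simp
        qed
      qed
      then have "cinner L v v = 0" if "v \<in> V" for v using that V(2) by blast
      then have "v = \<zero>\<^bsub>L\<^esub>" if "v \<in> V" for v
        using that norm_sq_eq_0[OF VL[OF that]] by (simp add: norm_sq_def)
      then show ?thesis using z z0 by blast
    next
      case False
      have V': "VectorSpace.subspace complex_field V L" using V(1) by (simp add: closed_subspace_def)
      have "\<xi> = inverse c \<odot>\<^bsub>L\<^esub> z"
        using False c \<xi>c zc by (intro cinner_ext) (auto simp: cinner_smult_left)
      then have "\<xi> \<in> V" using V' z by (simp add: subspace_iff)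
      then have "W \<subseteq> V" using Vinv by (intro least V(1)) auto
      then show ?thesis using V(2) by blast
    qed
  qed
  have "irreducible_unitary_rep G T ?H ?r"
    unfolding irreducible_unitary_rep_def
  proof (intro conjI allI impI rep)
    show "carrier ?H \<noteq> {\<zero>\<^bsub>?H\<^esub>}" using \<xi>W \<xi>(2) by auto
    fix V assume V: "VectorSpace.subspace complex_field V ?H \<and> closedin (htopology ?H) V \<and>
      (\<forall>g\<in>carrier G. \<forall>x\<in>V. ?r g x \<in> V)"
    then have V': "closed_subspace L V" "V \<subseteq> W"
      using closed_subspace_subspace[OF W] by (auto simp: closed_subspace_def)
    have "\<tau> g x \<in> V" if "g \<in> carrier G" "x \<in> V" for g x
    proof -
      have "?r g x \<in> V" using V that by blast
      moreover have "?r g x = \<tau> g x" using that V'(2) by (simp add: subset_iff)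
      ultimately show ?thesis by simp
    qed
    then show "V = {\<zero>\<^bsub>?H\<^esub>} \<or> V = carrier ?H" using irr[OF V'] by simp
  qed
  moreover have "\<xi> \<in> invariant_vectors ?H ?r K"
    using \<xi> \<xi>W by (simp add: invariant_vectors_def)
  moreover have "\<exists>c. w = c \<odot>\<^bsub>?H\<^esub> \<xi>" if "w \<in> invariant_vectors ?H ?r K" for w
    using unique[of w] that WL by (auto simp: invariant_vectors_def)
  ultimately have "spherical_function_via G T K ?H ?r (\<lambda>g. cinner L (\<tau> g \<xi>) \<xi>)"
    unfolding spherical_function_via_def using \<xi>(2) \<xi>W by (auto intro!: bexI[of _ \<xi>])
  then show thesis by (rule that)
qed

section \<open>Products of spherical functions\<close>

text \<open>The form \<open>q x = \<langle>A x, A x\<rangle>\<close> of \<open>A\<^sup>*A\<close> has trace at most \<open>\<langle>w, w\<rangle>\<close>, and it is invariant under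
  \<open>K\<close>. A nonzero vector \<open>x\<close> of its top eigenspace is \<open>K\<close>-invariant, and so is \<open>A x\<close>, which makes
  \<open>q x = \<langle>w, x \<otimes> A x\<rangle>\<close> vanish by assumption; but \<open>q x\<close> is a positive multiple of \<open>\<langle>x, x\<rangle>\<close>.\<close>

theorem tensor_invariant_vector_zero:
  fixes G :: "('g, 'm) monoid_scheme" and H1 :: "('g \<Rightarrow> complex) cinner_space"
  assumes r1: "unitary_rep G T H1 \<rho>1" and r2: "unitary_rep G T H2 \<rho>2" and r: "unitary_rep G T L \<tau>"
    and T: "topspace T = carrier G" and K: "subgroup K G"
    and nofd: "no_nontrivial_findim_unitary_rep (G\<lparr>carrier := K\<rparr>) (subtopology T K)"
    and L: "hilbert_tensor H1 H2 L t"
    and \<tau>t: "\<And>g x y. \<lbrakk>g \<in> carrier G; x \<in> carrier H1; y \<in> carrier H2\<rbrakk> \<Longrightarrow> \<tau> g (t x y) = t (\<rho>1 g x) (\<rho>2 g y)"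
    and w: "w \<in> invariant_vectors L \<tau> K"
    and perp: "\<And>x y. \<lbrakk>x \<in> invariant_vectors H1 \<rho>1 K; y \<in> invariant_vectors H2 \<rho>2 K\<rbrakk> \<Longrightarrow> cinner L w (t x y) = 0"
  shows "w = \<zero>\<^bsub>L\<^esub>"
proof (rule ccontr)
  assume "w \<noteq> \<zero>\<^bsub>L\<^esub>"
  interpret hilbert_tensor H1 H2 L t by (rule L)
  note D1 = unitary_opD[OF unitary_rep_unitary_op[OF r1]]
  note D2 = unitary_opD[OF unitary_rep_unitary_op[OF r2]]
  note D = unitary_opD[OF unitary_rep_unitary_op[OF r]]
  have KG: "k \<in> carrier G" if "k \<in> K" for k using subgroup.subset[OF K] that by blast
  have wc: "w \<in> carrier L" and wK: "\<And>k. k \<in> K \<Longrightarrow> \<tau> k w = w"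
    using w by (auto simp: invariant_vectors_def)
  have wt: "cinner L w (t (\<rho>1 k x) (\<rho>2 k y)) = cinner L w (t x y)"
    if k: "k \<in> K" and xy: "x \<in> carrier H1" "y \<in> carrier H2" for k x y
    using D(4)[OF KG[OF k] wc t_closed[OF xy]] wK[OF k] \<tau>t[OF KG[OF k] xy] by simp
  have "\<exists>u\<in>carrier H2. \<forall>y\<in>carrier H2. cinner H2 u y = cinner L w (t x y)" if x: "x \<in> carrier H1" for x
  proof (rule H2.Riesz_representation[where B = "norm_sq L w * norm_sq H1 x"])
    show "(cmod (cinner L w (t x y)))\<^sup>2 \<le> norm_sq L w * norm_sq H1 x * norm_sq H2 y" if "y \<in> carrier H2" for y
      using Cauchy_Schwarz_sq[OF wc t_closed[OF x that]] x that by (simp add: norm_sq_t mult_ac)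
  qed (use x wc in \<open>auto simp: t_add_right t_smult_right cinner_add_right cinner_smult_right\<close>)
  then obtain A where A: "\<And>x. x \<in> carrier H1 \<Longrightarrow> A x \<in> carrier H2"
    "\<And>x y. \<lbrakk>x \<in> carrier H1; y \<in> carrier H2\<rbrakk> \<Longrightarrow> cinner H2 (A x) y = cinner L w (t x y)"
    by metis
  have A_add: "A (x \<oplus>\<^bsub>H1\<^esub> y) = A x \<oplus>\<^bsub>H2\<^esub> A y" if "x \<in> carrier H1" "y \<in> carrier H1" for x y
    by (rule H2.cinner_ext) (use that wc in \<open>auto simp: A H2.cinner_add_left t_add_left cinner_add_right\<close>)
  have A_smult: "A (c \<odot>\<^bsub>H1\<^esub> x) = cnj c \<odot>\<^bsub>H2\<^esub> A x" if "x \<in> carrier H1" for x c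
    by (rule H2.cinner_ext) (use that wc in \<open>auto simp: A H2.cinner_smult_left t_smult_left cinner_smult_right\<close>)
  have A_minus: "A (x \<ominus>\<^bsub>H1\<^esub> y) = A x \<ominus>\<^bsub>H2\<^esub> A y" if "x \<in> carrier H1" "y \<in> carrier H1" for x y
    using that by (simp add: H1.minus_smult H2.minus_smult A_add A_smult A)
  have A_K: "A (\<rho>1 k x) = \<rho>2 k (A x)" if k: "k \<in> K" and x: "x \<in> carrier H1" for k x
  proof (rule H2.cinner_ext)
    fix y assume y: "y \<in> carrier H2"
    interpret G: group G by (rule unitary_rep_group[OF r])
    have ky: "\<rho>2 (inv\<^bsub>G\<^esub> k) y \<in> carrier H2" using D2(1) KG[OF k] y by simp
    have "cinner H2 (\<rho>2 k (A x)) y = cinner H2 (A x) (\<rho>2 (inv\<^bsub>G\<^esub> k) y)"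
      by (rule unitary_rep_cinner_inv[OF r2 KG[OF k] A(1)[OF x] y])
    also have "\<dots> = cinner L w (t (\<rho>1 k x) (\<rho>2 k (\<rho>2 (inv\<^bsub>G\<^esub> k) y)))"
      using wt[OF k x ky] by (simp add: A(2)[OF x ky])
    also have "\<dots> = cinner H2 (A (\<rho>1 k x)) y"
      using unitary_rep_inv(2)[OF r2 KG[OF k] y] D1(1)[OF KG[OF k] x] y by (simp add: A(2))
    finally show "cinner H2 (A (\<rho>1 k x)) y = cinner H2 (\<rho>2 k (A x)) y" by simp
  qed (use A D1 D2 KG k x in auto)
  define q where "q x = norm_sq H2 (A x)" for x
  interpret Q: trace_class_quadratic_form H1 q "norm_sq L w"
  proof
    show "q (x \<oplus>\<^bsub>H1\<^esub> y) + q (x \<ominus>\<^bsub>H1\<^esub> y) = 2 * q x + 2 * q y"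
      if "x \<in> carrier H1" "y \<in> carrier H1" for x y
      using H2.parallelogram[of "A x" "A y"] that by (simp add: q_def A_add A_minus A)
    fix F assume F: "finite F" "orthonormal H1 (\<lambda>x. x) F"
    have Fc: "e \<in> carrier H1" if "e \<in> F" for e using F(2) that by (auto simp: orthonormal_def)
    have tc: "t e (A e) \<in> carrier L" if "e \<in> F" for e using Fc[OF that] A(1) by simp
    \<comment> \<open>\<open>z = \<Sum>e\<in>F. e \<otimes> A e\<close> is an orthogonal sum, and \<open>\<langle>z, z\<rangle>\<close> and \<open>\<langle>z, w\<rangle>\<close> both equal the
      partial trace\<close>
    obtain z where z: "z \<in> carrier L"
      "\<And>y. y \<in> carrier L \<Longrightarrow> cinner L z y = (\<Sum>e\<in>F. cinner L (t e (A e)) y)"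
      using vsum_exists[of F "\<lambda>e. t e (A e)", OF F(1) tc] by blast
    have zt: "cinner L z (t e (A e)) = of_real (q e)" if e: "e \<in> F" for e
    proof -
      have "cinner L z (t e (A e)) = (\<Sum>f\<in>F. if f = e then cinner H2 (A e) (A e) else 0)"
        unfolding z(2)[OF tc[OF e]] using e F(2)
        by (intro sum.cong) (auto simp: t_cinner Fc A orthonormal_def)
      then show ?thesis using e F(1) A(1)[OF Fc[OF e]] by (simp add: q_def H2.cinner_self_norm_sq)
    qed
    have "cinner L z z = (\<Sum>e\<in>F. of_real (q e))"
      unfolding z(2)[OF z(1)] using cinner_commute[OF z(1) tc] zt by (intro sum.cong) auto
    then have zz: "norm_sq L z = (\<Sum>e\<in>F. q e)" by (simp add: norm_sq_def)
    have "cinner L z w = (\<Sum>e\<in>F. of_real (q e))"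
      unfolding z(2)[OF wc]
    proof (rule sum.cong[OF refl])
      fix e assume e: "e \<in> F"
      have "cinner L w (t e (A e)) = of_real (q e)"
        using A(2)[OF Fc[OF e] A(1)[OF Fc[OF e]]] A(1)[OF Fc[OF e]] by (simp add: q_def H2.cinner_self_norm_sq)
      then show "cinner L (t e (A e)) w = of_real (q e)"
        using cinner_commute[OF wc tc[OF e]] by simp
    qed
    then have "Re (cinner L z w) = (\<Sum>e\<in>F. q e)" by simp
    moreover have "0 \<le> norm_sq L (z \<ominus>\<^bsub>L\<^esub> w)" using z(1) wc by simp
    ultimately show "(\<Sum>e\<in>F. q e) \<le> norm_sq L w" using zz z(1) wc by (simp add: norm_sq_minus)
  qed (auto simp: q_def A A_smult H2.norm_sq_smult)
  obtain x0 y0 where xy0: "x0 \<in> carrier H1" "y0 \<in> carrier H2" "cinner L w (t x0 y0) \<noteq> 0"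
    using t_total[OF wc] \<open>w \<noteq> \<zero>\<^bsub>L\<^esub>\<close> by blast
  have "A x0 \<noteq> \<zero>\<^bsub>H2\<^esub>" using A(2)[OF xy0(1,2)] xy0 by auto
  then have "q x0 \<noteq> 0" using A(1)[OF xy0(1)] by (simp add: q_def H2.norm_sq_eq_0)
  then have "q x0 > 0" using Q.q_nonneg[OF xy0(1)] by simp
  note top = Q.top_value_attained[OF xy0(1) this]
  let ?V = "Q.top_space"
  have V: "closed_subspace H1 ?V" by (rule Q.closed_subspace_top_space)
  have VK: "\<rho>1 k x \<in> ?V" if "k \<in> K" "x \<in> ?V" for k x
    using that KG[OF that(1)] by (simp add: Q.top_space_def Q.gap_def q_def A_K A D1 D2)
  have "unitary_rep (G\<lparr>carrier := K\<rparr>) (subtopology T K) (H1\<lparr>carrier := ?V\<rparr>) (\<lambda>k. restrict (\<rho>1 k) ?V)"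
    by (rule unitary_rep_subspace[OF r1 K V VK T])
  then have triv: "\<forall>k\<in>carrier (G\<lparr>carrier := K\<rparr>). \<forall>x\<in>carrier (H1\<lparr>carrier := ?V\<rparr>). restrict (\<rho>1 k) ?V x = x"
    using nofd Q.top_space_fin_dim[OF top(1)] unfolding no_nontrivial_findim_unitary_rep_def by blast
  obtain x where x: "x \<in> ?V" "x \<noteq> \<zero>\<^bsub>H1\<^esub>"
  proof -
    have "\<zero>\<^bsub>H1\<^esub> \<in> ?V" by (simp add: Q.top_space_def Q.gap_def)
    then show thesis using top(2) that by blast
  qed
  have xc: "x \<in> carrier H1" and gap: "Q.gap x = 0" using x(1) by (auto simp: Q.top_space_def)
  have xK: "\<rho>1 k x = x" if "k \<in> K" for k using triv that x(1) by simp
  have "x \<in> invariant_vectors H1 \<rho>1 K" using xc xK by (simp add: invariant_vectors_def)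
  moreover have "A x \<in> invariant_vectors H2 \<rho>2 K"
    using A_K[OF _ xc] xK A(1)[OF xc] by (simp add: invariant_vectors_def)
  ultimately have "cinner L w (t x (A x)) = 0" by (rule perp)
  then have "q x = 0" using A(2)[OF xc A(1)[OF xc]] by (simp add: q_def norm_sq_def)
  then have "Q.top_value * norm_sq H1 x = 0" using gap by (simp add: Q.gap_def)
  then show False using top(1) x(2) xc by (simp add: H1.norm_sq_eq_0)
qed

theorem theorem4:
  fixes G :: "('g, 'm) monoid_scheme"
    and T :: "'g topology"
    and K :: "'g set"
    and \<Phi>\<^sub>1 \<Phi>\<^sub>2 :: "'g \<Rightarrow> complex"
  assumes "topological_group G T"
    and "spherical_subgroup G T K"
    and "no_nontrivial_findim_unitary_rep (G\<lparr>carrier := K\<rparr>) (subtopology T K)"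
    and "spherical_function G T K \<Phi>\<^sub>1"
    and "spherical_function G T K \<Phi>\<^sub>2"
  shows "spherical_function G T K (\<lambda>g. \<Phi>\<^sub>1 g * \<Phi>\<^sub>2 g)"
proof -
  have T: "topspace T = carrier G" using assms(1) by (rule topological_group.topspace_eq)
  have K: "subgroup K G" using assms(2) by (simp add: spherical_subgroup_def)
  have KG: "k \<in> carrier G" if "k \<in> K" for k using subgroup.subset[OF K] that by blast
  obtain H1 :: "('g \<Rightarrow> complex) cinner_space" and \<rho>1 v1 where
    r1: "unitary_rep G T H1 \<rho>1" and v1: "v1 \<in> invariant_vectors H1 \<rho>1 K" "v1 \<noteq> \<zero>\<^bsub>H1\<^esub>"
      "\<And>w. w \<in> invariant_vectors H1 \<rho>1 K \<Longrightarrow> \<exists>c. w = c \<odot>\<^bsub>H1\<^esub> v1"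
      "\<And>g. g \<in> carrier G \<Longrightarrow> \<Phi>\<^sub>1 g = cinner H1 (\<rho>1 g v1) v1"
    using assms(4) unfolding spherical_function_def spherical_function_via_def irreducible_unitary_rep_def
    by metis
  obtain H2 :: "('g \<Rightarrow> complex) cinner_space" and \<rho>2 v2 where
    r2: "unitary_rep G T H2 \<rho>2" and v2: "v2 \<in> invariant_vectors H2 \<rho>2 K" "v2 \<noteq> \<zero>\<^bsub>H2\<^esub>"
      "\<And>w. w \<in> invariant_vectors H2 \<rho>2 K \<Longrightarrow> \<exists>c. w = c \<odot>\<^bsub>H2\<^esub> v2"
      "\<And>g. g \<in> carrier G \<Longrightarrow> \<Phi>\<^sub>2 g = cinner H2 (\<rho>2 g v2) v2"
    using assms(5) unfolding spherical_function_def spherical_function_via_def irreducible_unitary_rep_def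
    by metis
  obtain L :: "(('g \<Rightarrow> complex) \<times> ('g \<Rightarrow> complex) \<Rightarrow> complex) cinner_space" and t
    where L: "hilbert_tensor H1 H2 L t"
    by (rule hilbert_tensor_exists[OF unitary_rep_hilbert[OF r1] unitary_rep_hilbert[OF r2]])
  obtain \<tau> where r: "unitary_rep G T L \<tau>"
    and \<tau>t: "\<And>g x y. \<lbrakk>g \<in> carrier G; x \<in> carrier H1; y \<in> carrier H2\<rbrakk> \<Longrightarrow> \<tau> g (t x y) = t (\<rho>1 g x) (\<rho>2 g y)"
    using tensor_rep_exists[OF r1 r2 T L] by metis
  interpret hilbert_tensor H1 H2 L t by (rule L)
  note D = unitary_opD[OF unitary_rep_unitary_op[OF r]]
  have vc: "v1 \<in> carrier H1" "v2 \<in> carrier H2" using v1(1) v2(1) by (auto simp: invariant_vectors_def)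
  define \<xi> where "\<xi> = t v1 v2"
  have \<xi>c: "\<xi> \<in> carrier L" using vc by (simp add: \<xi>_def)
  have \<xi>K: "\<tau> k \<xi> = \<xi>" if "k \<in> K" for k
    using \<tau>t[OF KG[OF that] vc] v1(1) v2(1) that by (simp add: \<xi>_def invariant_vectors_def)
  have s: "norm_sq L \<xi> \<noteq> 0" using vc v1(2) v2(2) by (simp add: \<xi>_def norm_sq_t H1.norm_sq_eq_0 H2.norm_sq_eq_0)
  have unique: "\<exists>c. w = c \<odot>\<^bsub>L\<^esub> \<xi>" if w: "w \<in> invariant_vectors L \<tau> K" for w
  proof -
    have wc: "w \<in> carrier L" and wK: "\<And>k. k \<in> K \<Longrightarrow> \<tau> k w = w"
      using w by (auto simp: invariant_vectors_def)
    \<comment> \<open>the component of \<open>w\<close> orthogonal to \<open>\<xi>\<close> is still invariant, so it vanishes\<close>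
    define c where "c = cinner L w \<xi> / of_real (norm_sq L \<xi>)"
    define u where "u = w \<ominus>\<^bsub>L\<^esub> c \<odot>\<^bsub>L\<^esub> \<xi>"
    have uc: "u \<in> carrier L" using wc \<xi>c by (simp add: u_def)
    have u\<xi>: "cinner L u \<xi> = 0"
      using wc \<xi>c s by (simp add: u_def c_def cinner_minus_left cinner_smult_left cinner_self_norm_sq)
    have "\<tau> k u = u" if k: "k \<in> K" for k
      using wc \<xi>c KG[OF k] wK[OF k] \<xi>K[OF k] by (simp add: u_def minus_smult D)
    then have u: "u \<in> invariant_vectors L \<tau> K" using uc by (simp add: invariant_vectors_def)
    have "u = \<zero>\<^bsub>L\<^esub>"
    proof (rule tensor_invariant_vector_zero[OF r1 r2 r T K assms(3) L _ u])
      show "\<tau> g (t x y) = t (\<rho>1 g x) (\<rho>2 g y)"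
        if "g \<in> carrier G" "x \<in> carrier H1" "y \<in> carrier H2" for g x y
        by (rule \<tau>t[OF that])
      fix x y assume "x \<in> invariant_vectors H1 \<rho>1 K" "y \<in> invariant_vectors H2 \<rho>2 K"
      then obtain a b where "x = a \<odot>\<^bsub>H1\<^esub> v1" "y = b \<odot>\<^bsub>H2\<^esub> v2" using v1(3) v2(3) by blast
      then show "cinner L u (t x y) = 0"
        using u\<xi> uc vc \<xi>c by (simp add: t_smult_left t_smult_right cinner_smult_right flip: \<xi>_def)
    qed
    then show ?thesis using minus_eq_zero_iff[OF wc, of "c \<odot>\<^bsub>L\<^esub> \<xi>"] \<xi>c by (auto simp: u_def)
  qed
  have \<xi>inv: "\<xi> \<in> invariant_vectors L \<tau> K" using \<xi>c \<xi>K by (simp add: invariant_vectors_def)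
  have \<xi>0: "\<xi> \<noteq> \<zero>\<^bsub>L\<^esub>" using s by auto
  obtain W where W: "spherical_function_via G T K (L\<lparr>carrier := W\<rparr>) (\<lambda>g. restrict (\<tau> g) W)
      (\<lambda>g. cinner L (\<tau> g \<xi>) \<xi>)"
    by (rule spherical_function_via_cyclic[OF r T K \<xi>inv \<xi>0 unique])
  have "cinner L (\<tau> g \<xi>) \<xi> = \<Phi>\<^sub>1 g * \<Phi>\<^sub>2 g" if g: "g \<in> carrier G" for g
    using \<tau>t[OF g vc] v1(4)[OF g] v2(4)[OF g] vc unitary_opD(1)[OF unitary_rep_unitary_op[OF r1 g]]
      unitary_opD(1)[OF unitary_rep_unitary_op[OF r2 g]]
    by (simp add: \<xi>_def t_cinner)
  then have "spherical_function_via G T K (L\<lparr>carrier := W\<rparr>) (\<lambda>g. restrict (\<tau> g) W) (\<lambda>g. \<Phi>\<^sub>1 g * \<Phi>\<^sub>2 g)"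
    using W unfolding spherical_function_via_def by metis
  then show ?thesis by (rule spherical_function_via_imp_spherical_function[OF K])
qed

end
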